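(* As $\epsilon\to0$, $\theta^{(1)}_\epsilon\, I_\epsilon$ $\Gamma$-converges to $J^{(1)}$, where $\theta^{(1)}_\epsilon=e^{\mathfrak h_1/\epsilon}$ and $$J^{(1)}(\mu)=\begin{cases} \mathbb I^{(1)}(\omega)&\text{if }\mu=\sum_{k=0}^{N-1}\omega(k)\,\delta_{\Pi(m_k)}\text{ for some probability measure }\omega\text{ on }\{0,\dots,N-1\},\\+\infty&\text{otherwise.}\end{cases}$$
   Context: $\mathbb T=[0,1)$ is the one-dimensional torus of length $1$. Standing assumptions: $a,b:\mathbb T\to\mathbb R$ are of class $C^2(\mathbb T)$; $a(x)\ge c_0>0$ for all $x$; $b$ vanishes at exactly finitely many points $x_1,\dots,x_{2N}$ ($N\ge1$), and $b'(x_j)\ne0$ for each $j$. Put $B=\int_{\mathbb T} b(x)/a(x)\,dx$; it is assumed that $B\ge0$. For $\epsilon>0$, $L_\epsilon f=b f'+\epsilon\, a f''$, $f\in C^2(\mathbb T)$, is the generator of the diffusion $dX_\epsilon=b(X_\epsilon)dt+\sqrt{2\epsilon a(X_\epsilon)}\,dW_t$ on $\mathbb T$. $\mathcal P(\mathbb T)$ is the set of Borel probability measures on $\mathbb T$ with the weak topology. The level-two (Donsker–Varadhan) rate functional is $I_\epsilon(\mu)=\sup_{u}-\int_{\mathbb T}\frac{L_\epsilon u}{u}\,d\mu$, the supremum being over all strictly positive $u\in C^2(\mathbb T)$ (the domain of the generator). Regard $a,b$ as $1$-periodic functions on $\mathbb R$ and let $S(x)=-\int_0^x b(z)/a(z)\,dz$,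 $x\in\mathbb R$. The zeros of $b$ in $\mathbb R$ with $b'<0$ (local minima of $S$) are labelled $m_k$, $k\in\mathbb Z$, and those with $b'>0$ (local maxima of $S$) are labelled $\sigma_k$, $k\in\mathbb Z$, with $m_{k+N}=m_k+1$, $\sigma_{k+N}=\sigma_k+1$ and, choosing the origin suitably (without loss of generality), $m_{-1}<0<\sigma_0<m_0<\dots<\sigma_{N-1}<m_{N-1}<1<\sigma_N$. $\Pi(x)=x-\lfloor x\rfloor$ is the projection $\mathbb R\to\mathbb T$. Set $h_k^+=S(\sigma_{k+1})-S(m_k)$, $h_k^-=S(\sigma_k)-S(m_k)$, $\mathfrak h_1=\min_{k\in\mathbb Z}\min\{h_k^-,h_k^+\}$ (positive, by periodicity of $h_k^\pm$). Let $\pi_1(k)=\frac1{a(m_k)}\sqrt{\frac{2\pi}{S''(m_k)}}$, $\sigma_1(k,k+1)=\sigma_1(k+1,k)=\sqrt{\frac{2\pi}{-S''(\sigma_{k+1})}}$, and $$R_1(k,k\pm1)=\frac{1}{\pi_1(k)\,\sigma_1(k,k\pm1)}\,\mathbf 1\{h_k^\pm=\mathfrak h_1\}.$$ These rates are $N$-periodic in $k$. Let $\widehat{\mathbb L}_1$ be the generator on functions $f:\{0,\dots,N-1\}\to\mathbb R$ given by $(\widehat{\mathbb L}_1f)(k)=\sum_{c=\pm1}R_1(k,k+c)[f(k+c)-f(k)]$, where the arguments of $f$ are taken modulo $N$ (state $k$ represents the point $\Pi(m_k)$), and let $$\mathbb I^{(1)}(\omega)=\sup_{H}\;-\sum_{k=0}^{N-1}\frac{(\widehat{\mathbb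 L}_1H)(k)}{H(k)}\,\omega(k),$$ the supremum being over all $H:\{0,\dots,N-1\}\to(0,\infty)$. A family of functionals $F_\epsilon:\mathcal P(\mathbb T)\to[0,+\infty]$ $\Gamma$-converges to $F$ as $\epsilon\to0$ if for every $\mu$: (i) $\liminf_{\epsilon\to0}F_\epsilon(\mu_\epsilon)\ge F(\mu)$ for every $\mu_\epsilon\to\mu$ weakly; (ii) there exists $\mu_\epsilon\to\mu$ weakly with $\limsup_{\epsilon\to0}F_\epsilon(\mu_\epsilon)\le F(\mu)$. *)

theory Defs
  imports "HOL-Probability.Probability"
begin

text \<open>
  Functions on the torus \<open>[0,1)\<close> are represented by \<open>1\<close>-periodic functions on the real line, so that
  continuity and smoothness on the torus are continuity and smoothness on the line.
\<close>

definition torus_continuous :: "(real \<Rightarrow> real) set" where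
  "torus_continuous = {f. (\<forall>x. f (x + 1) = f x) \<and> continuous_on UNIV f}"

definition torus_C2 :: "(real \<Rightarrow> real) set" where
  "torus_C2 = {f. (\<forall>x. f (x + 1) = f x) \<and> (\<forall>x. f differentiable at x) \<and>
     (\<forall>x. deriv f differentiable at x) \<and> continuous_on UNIV (deriv (deriv f))}"

text \<open>
  The circle topology and the subspace topology on \<open>[0,1)\<close> differ, but they generate the same
  Borel sets. The circle topology enters through the test functions for weak convergence.
\<close>

definition torus :: "real measure" where
  "torus = restrict_space borel {0..<1}"

definition torus_prob :: "real measure set" where
  "torus_prob = {\<mu>. prob_space \<mu> \<and> sets \<mu> = sets torus}"

definition torus_weak_conv :: "('i \<Rightarrow> real measure) \<Rightarrow> real measure \<Rightarrow> 'i filter \<Rightarrow> bool" where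
  "torus_weak_conv M \<mu> F \<longleftrightarrow>
     (\<forall>f\<in>torus_continuous. ((\<lambda>i. \<integral>x. f x \<partial>M i) \<longlongrightarrow> (\<integral>x. f x \<partial>\<mu>)) F)"

definition gamma_converges ::
  "(real \<Rightarrow> real measure \<Rightarrow> ereal) \<Rightarrow> (real measure \<Rightarrow> ereal) \<Rightarrow> bool" where
  "gamma_converges F G \<longleftrightarrow>
     (\<forall>\<mu>\<in>torus_prob.
        (\<forall>M. (\<forall>\<epsilon>>0. M \<epsilon> \<in> torus_prob) \<and> torus_weak_conv M \<mu> (at_right 0) \<longrightarrow>
             G \<mu> \<le> Liminf (at_right 0) (\<lambda>\<epsilon>. F \<epsilon> (M \<epsilon>))) \<and>
        (\<exists>M. (\<forall>\<epsilon>>0. M \<epsilon> \<in> torus_prob) \<and> torus_weak_conv M \<mu> (at_right 0) \<and>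
             Limsup (at_right 0) (\<lambda>\<epsilon>. F \<epsilon> (M \<epsilon>)) \<le> G \<mu>))"

definition generator ::
  "(real \<Rightarrow> real) \<Rightarrow> (real \<Rightarrow> real) \<Rightarrow> real \<Rightarrow> (real \<Rightarrow> real) \<Rightarrow> real \<Rightarrow> real" where
  "generator a b \<epsilon> f x = b x * deriv f x + \<epsilon> * a x * deriv (deriv f) x"

definition rate_functional ::
  "(real \<Rightarrow> real) \<Rightarrow> (real \<Rightarrow> real) \<Rightarrow> real \<Rightarrow> real measure \<Rightarrow> ereal" where
  "rate_functional a b \<epsilon> \<mu> =
     (SUP u\<in>{u\<in>torus_C2. \<forall>x. 0 < u x}. ereal (- (\<integral>x. generator a b \<epsilon> u x / u x \<partial>\<mu>)))"

lemma rate_functional_nonneg: "0 \<le> rate_functional a b \<epsilon> \<mu>"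
proof -
  have "(\<lambda>_. 1) \<in> {u\<in>torus_C2. \<forall>x. (0::real) < u x}"
    by (simp add: torus_C2_def)
  then show ?thesis
    unfolding rate_functional_def
    by (rule SUP_upper2) (simp add: generator_def zero_ereal_def)
qed

text \<open>The interval integral is signed: it is minus the integral over \<open>[x,0]\<close> when \<open>x < 0\<close>.\<close>

definition potential :: "(real \<Rightarrow> real) \<Rightarrow> (real \<Rightarrow> real) \<Rightarrow> real \<Rightarrow> real" where
  "potential a b x = - (LBINT z=ereal 0..ereal x. b z / a z)"

text \<open>
  In the following, \<open>S\<close> is the potential, \<open>m k\<close> are its local minima and \<open>\<sigma> k\<close> its local maxima,
  indexed by the integers so that \<open>\<sigma> k < m k < \<sigma> (k + 1)\<close>.
\<close>

definition barrier_right :: "(real \<Rightarrow> real) \<Rightarrow> (int \<Rightarrow> real) \<Rightarrow> (int \<Rightarrow> real) \<Rightarrow> int \<Rightarrow> real" where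
  "barrier_right S m \<sigma> k = S (\<sigma> (k + 1)) - S (m k)"

definition barrier_left :: "(real \<Rightarrow> real) \<Rightarrow> (int \<Rightarrow> real) \<Rightarrow> (int \<Rightarrow> real) \<Rightarrow> int \<Rightarrow> real" where
  "barrier_left S m \<sigma> k = S (\<sigma> k) - S (m k)"

text \<open>\<open>Min\<close> is meaningful since the barriers are periodic in \<open>k\<close>, so that the range is finite.\<close>

definition min_barrier :: "(real \<Rightarrow> real) \<Rightarrow> (int \<Rightarrow> real) \<Rightarrow> (int \<Rightarrow> real) \<Rightarrow> real" where
  "min_barrier S m \<sigma> = Min (range (\<lambda>k. min (barrier_left S m \<sigma> k) (barrier_right S m \<sigma> k)))"

definition well_weight :: "(real \<Rightarrow> real) \<Rightarrow> (real \<Rightarrow> real) \<Rightarrow> (int \<Rightarrow> real) \<Rightarrow> int \<Rightarrow> real" where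
  "well_weight a S m k = 1 / a (m k) * sqrt (2 * pi / deriv (deriv S) (m k))"

text \<open>The maximum separating \<open>m k\<close> from \<open>m (k + 1)\<close> is \<open>\<sigma> (k + 1)\<close>, whence \<open>max k l\<close>.\<close>

definition saddle_weight :: "(real \<Rightarrow> real) \<Rightarrow> (int \<Rightarrow> real) \<Rightarrow> int \<Rightarrow> int \<Rightarrow> real" where
  "saddle_weight S \<sigma> k l = sqrt (2 * pi / (- deriv (deriv S) (\<sigma> (max k l))))"

definition jump_rate ::
  "(real \<Rightarrow> real) \<Rightarrow> (real \<Rightarrow> real) \<Rightarrow> (int \<Rightarrow> real) \<Rightarrow> (int \<Rightarrow> real) \<Rightarrow> int \<Rightarrow> int \<Rightarrow> real" where
  "jump_rate a S m \<sigma> k l =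
     (if l = k + 1 \<and> barrier_right S m \<sigma> k = min_barrier S m \<sigma> \<or>
         l = k - 1 \<and> barrier_left S m \<sigma> k = min_barrier S m \<sigma>
      then 1 / (well_weight a S m k * saddle_weight S \<sigma> k l) else 0)"

text \<open>
  The state space of the reduced chain is \<open>{0..<N}\<close>, understood modulo \<open>N\<close>. The rates are kept
  indexed by the integers, so for \<open>N = 2\<close> the jumps to the left and to the right both contribute.
\<close>

definition chain_generator :: "(int \<Rightarrow> int \<Rightarrow> real) \<Rightarrow> nat \<Rightarrow> (int \<Rightarrow> real) \<Rightarrow> int \<Rightarrow> real" where
  "chain_generator R N f k = (\<Sum>c\<in>{1, -1}. R k (k + c) * (f ((k + c) mod int N) - f k))"

definition chain_rate_functional :: "(int \<Rightarrow> int \<Rightarrow> real) \<Rightarrow> nat \<Rightarrow> (int \<Rightarrow> real) \<Rightarrow> ereal" where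
  "chain_rate_functional R N \<omega> =
     (SUP H\<in>{H. \<forall>k\<in>{0..<int N}. 0 < H k}.
        ereal (- (\<Sum>k\<in>{0..<int N}. chain_generator R N H k / H k * \<omega> k)))"

definition prob_vector :: "nat \<Rightarrow> (int \<Rightarrow> real) \<Rightarrow> bool" where
  "prob_vector N \<omega> \<longleftrightarrow> (\<forall>k\<in>{0..<int N}. 0 \<le> \<omega> k) \<and> (\<Sum>k\<in>{0..<int N}. \<omega> k) = 1"

text \<open>\<open>\<mu>\<close> is the sum of the point masses \<open>\<omega> k\<close> at \<open>p k\<close>; \<open>return torus x\<close> is the Dirac mass at \<open>x\<close>.\<close>

definition is_dirac_sum :: "nat \<Rightarrow> (int \<Rightarrow> real) \<Rightarrow> (int \<Rightarrow> real) \<Rightarrow> real measure \<Rightarrow> bool" where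
  "is_dirac_sum N p \<omega> \<mu> \<longleftrightarrow> sets \<mu> = sets torus \<and>
     (\<forall>A\<in>sets torus. emeasure \<mu> A =
        (\<Sum>k\<in>{0..<int N}. ennreal (\<omega> k) * emeasure (return torus (p k)) A))"

text \<open>
  The choice of \<open>\<omega>\<close> is immaterial: for distinct points \<open>p k\<close> the weights are determined by \<open>\<mu>\<close> on
  \<open>{0..<N}\<close>, see below.
\<close>

definition limit_functional ::
  "(int \<Rightarrow> int \<Rightarrow> real) \<Rightarrow> nat \<Rightarrow> (int \<Rightarrow> real) \<Rightarrow> real measure \<Rightarrow> ereal" where
  "limit_functional R N p \<mu> =
     (if \<exists>\<omega>. prob_vector N \<omega> \<and> is_dirac_sum N p \<omega> \<mu>
      then chain_rate_functional R N (SOME \<omega>. prob_vector N \<omega> \<and> is_dirac_sum N p \<omega> \<mu>)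
      else \<infinity>)"

lemma dirac_sum_weight:
  assumes "prob_vector N \<omega>" "is_dirac_sum N p \<omega> \<mu>" "inj_on p {0..<int N}"
    and "\<And>k. k \<in> {0..<int N} \<Longrightarrow> p k \<in> {0..<1}" and k: "k \<in> {0..<int N}"
  shows "\<omega> k = measure \<mu> {p k}"
proof -
  have sing: "{p k} \<in> sets torus"
    using assms(4)[OF k] by (auto simp: torus_def sets_restrict_space image_iff intro!: exI[of _ "{p k}"])
  have "emeasure \<mu> {p k} = (\<Sum>j\<in>{0..<int N}. ennreal (\<omega> j) * emeasure (return torus (p j)) {p k})"
    using assms(2) sing by (simp add: is_dirac_sum_def)
  also have "\<dots> = (\<Sum>j\<in>{0..<int N}. if j = k then ennreal (\<omega> j) else 0)"
    using sing assms(3) k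
    by (intro sum.cong refl) (auto simp: indicator_def inj_on_def)
  also have "\<dots> = ennreal (\<omega> k)"
    using k by simp
  finally show ?thesis
    using assms(1) k by (simp add: measure_def prob_vector_def)
qed

lemma limit_functional_dirac_sum:
  assumes "prob_vector N \<omega>" "is_dirac_sum N p \<omega> \<mu>" "inj_on p {0..<int N}"
    and "\<And>k. k \<in> {0..<int N} \<Longrightarrow> p k \<in> {0..<1}"
  shows "limit_functional R N p \<mu> = chain_rate_functional R N \<omega>"
proof -
  define \<omega>' where "\<omega>' = (SOME \<omega>. prob_vector N \<omega> \<and> is_dirac_sum N p \<omega> \<mu>)"
  have \<omega>': "prob_vector N \<omega>' \<and> is_dirac_sum N p \<omega>' \<mu>"
    unfolding \<omega>'_def by (rule someI[of _ \<omega>]) (use assms in blast)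
  have "\<omega>' k = \<omega> k" if "k \<in> {0..<int N}" for k
    using dirac_sum_weight[of N _ p \<mu> k] \<omega>' assms that by metis
  then have "chain_rate_functional R N \<omega>' = chain_rate_functional R N \<omega>"
    by (simp add: chain_rate_functional_def)
  then show ?thesis
    using assms(1,2) by (auto simp: limit_functional_def \<omega>'_def)
qed

end

theory Submission
  imports Defs
begin

text \<open>
  The proof rests on two functions on the line: the Gibbs weight \<open>exp (- S / \<epsilon>) / a\<close> and the scale
  function, whose derivative is \<open>exp (S / \<epsilon>)\<close>. They bring the generator into the form
  \<open>L u = \<epsilon> a exp (S / \<epsilon>) (exp (- S / \<epsilon>) u')'\<close>, so that \<open>L u = 0\<close> means that \<open>u\<close> is affine in the
  scale. The scale increases almost only near the maxima of \<open>S\<close> and the Gibbs weight sits near the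
  minima; Laplace's method gives \<open>well_int\<close>, the Gibbs weight of a well, and \<open>saddle_int\<close>, the
  increment of the scale between two minima. The ratio \<open>\<epsilon> / (well_int * saddle_int)\<close> is a jump rate, and
  multiplied by \<open>exp (\<h> / \<epsilon>)\<close> it converges to the rate of the reduced chain, with limit zero unless
  the barrier is the minimal one (\<open>rate_right_limit\<close>, \<open>rate_left_limit\<close>). The potential is periodic
  only up to the constant \<open>S 0 - S 1\<close>; one period multiplies the Gibbs weight and the scale by inverse
  factors, which cancel in all rates.

  For the upper bound let \<open>\<mu>\<close> have density \<open>f * gibbs\<close>. With \<open>\<phi> = ln u\<close>, integration by parts
  turns \<open>- \<integral> L u / u d\<mu>\<close> into the integral of \<open>f' \<phi>' - f \<phi>'\<^sup>2\<close> against \<open>\<epsilon> exp (- S / \<epsilon>)\<close>. If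
  \<open>f\<close> is a product of two functions affine in the scale on every edge between neighbouring minima,
  completing the square bounds this integral, whatever \<open>u\<close> is, by a tangent line to
  \<open>y \<mapsto> A (1 - exp y) + B (1 - exp (- y))\<close>, evaluated at the increment of \<open>\<phi>\<close>; here \<open>A\<close> and \<open>B\<close> are
  the jump rates weighted with the masses of the two wells (\<open>edge_bound\<close>). The slopes of these tangents
  are, up to sign, the currents through the edges. If they coincide on all edges, the increments of
  \<open>\<phi>\<close> telescope around the circle, and the rate functional of \<open>\<mu>\<close> is at most the value at one tilt of
  the functional that the chain functional with the rates at \<open>\<epsilon>\<close> maximises. Such a tilt exists by the
  intermediate value theorem (\<open>chain_tilt_exists\<close>), so the limit \<open>\<epsilon> \<rightarrow> 0\<close> only involves the
  convergence of the rates (\<open>recovery_sequence\<close>).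

  For the lower bound at a sum of point masses, each positive \<open>H\<close> on the wells is lifted to a function
  \<open>u\<close> on the torus that is nearly \<open>H k\<close> at the bottom of well \<open>k\<close> and affine in the scale except in
  small neighbourhoods of the minima. There \<open>L u\<close> is a multiple of a fixed bump function, so that
  \<open>exp (\<h> / \<epsilon>) L u / u\<close> converges uniformly to a continuous function. Its value at \<open>m k\<close> is the
  generator of the chain applied to \<open>H\<close>, divided by \<open>H k\<close> (\<open>well_test_uniform\<close>), and weak
  convergence suffices to conclude. All other measures give positive mass to the points that are not
  minima, and then \<open>I\<^sub>\<epsilon>\<close> itself stays bounded away from zero along every approximating family. This
  is detected where \<open>b \<noteq> 0\<close> by a fixed test function (\<open>drift_test\<close>), at a maximum of \<open>S\<close> by one
  that lives on the scale \<open>sqrt \<epsilon>\<close> (\<open>saddle_test\<close>).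
\<close>

section \<open>Laplace's method\<close>

lemma tendsto_second_order:
  fixes V V' :: "real \<Rightarrow> real"
  assumes V: "\<And>x. (V has_real_derivative V' x) (at x)"
    and crit: "V' c = 0" and V': "(V' has_real_derivative \<kappa>) (at c)"
  shows "((\<lambda>x. (V x - V c) / (x - c)^2) \<longlongrightarrow> \<kappa> / 2) (at c)"
proof (rule lhopital[where f' = V' and g' = "\<lambda>x. 2 * (x - c)"])
  have "isCont V c" using V DERIV_isCont by blast
  then show "((\<lambda>x. V x - V c) \<longlongrightarrow> 0) (at c)"
    using LIM_zero isCont_def by blast
  show "((\<lambda>x. (x - c)^2) \<longlongrightarrow> 0) (at c)"
    by (auto intro!: tendsto_eq_intros)
  have ne: "eventually (\<lambda>x. x \<noteq> c) (at c)"
    by (simp add: eventually_at_filter)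
  show "eventually (\<lambda>x. (x - c)^2 \<noteq> 0) (at c)" "eventually (\<lambda>x. 2 * (x - c) \<noteq> 0) (at c)"
    using ne by (eventually_elim; simp)+
  show "eventually (\<lambda>x. ((\<lambda>x. V x - V c) has_real_derivative V' x) (at x)) (at c)"
    by (rule always_eventually) (auto intro!: derivative_eq_intros V)
  show "eventually (\<lambda>x. ((\<lambda>x. (x - c)^2) has_real_derivative 2 * (x - c)) (at x)) (at c)"
    by (rule always_eventually) (auto intro!: derivative_eq_intros)
  have "((\<lambda>x. (V' x - V' c) / (x - c)) \<longlongrightarrow> \<kappa>) (at c)"
    using V' by (simp add: has_field_derivative_iff)
  then have "((\<lambda>x. (V' x - V' c) / (x - c) / 2) \<longlongrightarrow> \<kappa> / 2) (at c)"
    by (intro tendsto_intros) auto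
  then show "((\<lambda>x. V' x / (2 * (x - c))) \<longlongrightarrow> \<kappa> / 2) (at c)"
    by (simp add: crit mult.commute)
qed

text \<open>
  Near \<open>c\<close> the bound comes from the second derivative and elsewhere from compactness: the quotient
  \<open>(V x - V c) / (x - c)\<^sup>2\<close>, continued by \<open>\<kappa> / 2\<close>, is continuous and positive.
\<close>

lemma quadratic_lower_bound:
  fixes V V' :: "real \<Rightarrow> real"
  assumes V: "\<And>x. (V has_real_derivative V' x) (at x)"
    and crit: "V' c = 0" and V': "(V' has_real_derivative \<kappa>) (at c)" and "\<kappa> > 0"
    and min: "\<And>x. x \<in> {l..r} \<Longrightarrow> x \<noteq> c \<Longrightarrow> V c < V x"
  shows "\<exists>\<eta>>0. \<forall>x\<in>{l..r}. \<eta> * (x - c)^2 \<le> V x - V c"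
proof (cases "{l..r} = {}")
  case False
  define g where "g x = (if x = c then \<kappa> / 2 else (V x - V c) / (x - c)^2)" for x
  have lim: "((\<lambda>x. (V x - V c) / (x - c)^2) \<longlongrightarrow> \<kappa> / 2) (at c)"
    by (rule tendsto_second_order[OF V crit V'])
  have "isCont g x" for x
  proof (cases "x = c")
    case True
    have "(g \<longlongrightarrow> \<kappa> / 2) (at c)"
      by (rule Lim_transform_eventually[OF lim]) (auto simp: eventually_at_filter g_def)
    then show ?thesis
      using True by (simp add: isCont_def g_def)
  next
    case False
    have "isCont (\<lambda>x. (V x - V c) / (x - c)^2) x"
      using False V DERIV_isCont by (intro continuous_intros) auto
    then show ?thesis
      by (subst isCont_cong[where g = "\<lambda>x. (V x - V c) / (x - c)^2"])
         (use False in \<open>auto simp: g_def eventually_nhds intro!: exI[of _ "-{c}"]\<close>)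
  qed
  then have "continuous_on {l..r} g"
    by (simp add: continuous_at_imp_continuous_on)
  from continuous_attains_inf[OF _ False this]
  obtain x0 where x0: "x0 \<in> {l..r}" "\<And>x. x \<in> {l..r} \<Longrightarrow> g x0 \<le> g x" by auto
  have "g x0 > 0"
    using min[OF x0(1)] \<open>\<kappa> > 0\<close> by (auto simp: g_def)
  moreover have "g x0 * (x - c)^2 \<le> V x - V c" if "x \<in> {l..r}" for x
    using x0(2)[OF that] by (cases "x = c") (auto simp: g_def field_simps)
  ultimately show ?thesis by blast
qed (auto intro: exI[of _ 1])

text \<open>
  After the substitution \<open>x = c + t / T\<close> with \<open>T = 1 / sqrt \<epsilon>\<close> the exponent converges to
  \<open>- \<kappa> t\<^sup>2 / 2\<close>, and the quadratic lower bound supplies an integrable majorant.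
\<close>

lemma laplace_at_top:
  fixes V V' \<phi> :: "real \<Rightarrow> real"
  assumes V: "\<And>x. (V has_real_derivative V' x) (at x)"
    and crit: "V' c = 0" and V': "(V' has_real_derivative \<kappa>) (at c)" and \<kappa>: "\<kappa> > 0"
    and min: "\<And>x. x \<in> {l..r} \<Longrightarrow> x \<noteq> c \<Longrightarrow> V c < V x"
    and c: "l < c" "c < r" and \<phi>: "continuous_on {l..r} \<phi>"
  shows "((\<lambda>T. integral {l..r} (\<lambda>x. \<phi> x * exp (- (V x - V c) * T^2)) * T)
           \<longlongrightarrow> \<phi> c * sqrt (2 * pi / \<kappa>)) at_top"
proof -
  obtain \<eta> where \<eta>: "\<eta> > 0" "\<And>x. x \<in> {l..r} \<Longrightarrow> \<eta> * (x - c)^2 \<le> V x - V c"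
    using quadratic_lower_bound[OF V crit V' \<kappa> min] by blast
  have contV: "continuous_on A V" for A
    by (meson DERIV_isCont V continuous_at_imp_continuous_on)
  obtain K where K: "\<And>x. x \<in> {l..r} \<Longrightarrow> \<bar>\<phi> x\<bar> \<le> K"
    using compact_imp_bounded[OF compact_continuous_image[OF \<phi> compact_Icc]]
    unfolding bounded_iff by fastforce
  have K0: "0 \<le> K" using K[of c] c by auto
  define F where "F T x = indicator {l..r} x * (\<phi> x * exp (- (V x - V c) * T^2))" for T x
  define s where "s T t = F T (c + t / T)" for T t
  have intF: "integrable lborel (F T)" for T
  proof -
    have "set_integrable lborel {l..r} (\<lambda>x. \<phi> x * exp (- (V x - V c) * T^2))"
      by (intro borel_integrable_atLeastAtMost' continuous_intros \<phi> contV)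
    then show ?thesis unfolding set_integrable_def F_def[abs_def] by simp
  qed
  have eq: "integral {l..r} (\<lambda>x. \<phi> x * exp (- (V x - V c) * T^2)) * T = (\<integral>t. s T t \<partial>lborel)"
    if "T > 0" for T
  proof -
    have "set_integrable lborel {l..r} (\<lambda>x. \<phi> x * exp (- (V x - V c) * T^2))"
      by (intro borel_integrable_atLeastAtMost' continuous_intros \<phi> contV)
    then have "integral {l..r} (\<lambda>x. \<phi> x * exp (- (V x - V c) * T^2)) = (\<integral>x. F T x \<partial>lborel)"
      using set_borel_integral_eq_integral(2) unfolding set_lebesgue_integral_def F_def by fastforce
    also have "\<dots> = \<bar>1 / T\<bar> *\<^sub>R (\<integral>t. F T (c + (1 / T) * t) \<partial>lborel)"
      by (rule lborel_integral_real_affine) (use that in auto)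
    finally show ?thesis using that by (simp add: s_def)
  qed
  have "((\<lambda>T. \<integral>t. s T t \<partial>lborel) \<longlongrightarrow> (\<integral>t. \<phi> c * exp (- \<kappa> / 2 * t^2) \<partial>lborel)) at_top"
  proof (rule integral_dominated_convergence_at_top[where w = "\<lambda>t. K * exp (- \<eta> * t^2)"])
    have sig: "normal_density 0 (sqrt (1 / (2 * \<eta>))) t = exp (- \<eta> * t^2) / sqrt (pi / \<eta>)" for t
      using \<eta>(1) by (simp add: normal_density_def)
    have "integrable lborel (\<lambda>t. K * sqrt (pi / \<eta>) * normal_density 0 (sqrt (1 / (2 * \<eta>))) t)"
      using \<eta>(1) by (intro integrable_mult_right integrable_normal_density) auto
    then show "integrable lborel (\<lambda>t. K * exp (- \<eta> * t^2))"
      unfolding sig using \<eta>(1) by simp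
    have meas: "F T \<in> borel_measurable borel" for T
      using borel_measurable_integrable[OF intF] by simp
    show "s T \<in> borel_measurable lborel" for T
      unfolding s_def[abs_def] using meas[of T] by measurable
    show "(\<lambda>t. \<phi> c * exp (- \<kappa> / 2 * t^2)) \<in> borel_measurable lborel"
      by measurable
    show "\<forall>\<^sub>F T in at_top. AE t in lborel. norm (s T t) \<le> K * exp (- \<eta> * t^2)"
      using eventually_gt_at_top[of 0]
    proof eventually_elim
      case (elim T)
      have "norm (s T t) \<le> K * exp (- \<eta> * t^2)" for t
      proof (cases "c + t / T \<in> {l..r}")
        case True
        have "\<eta> * t^2 = \<eta> * (c + t / T - c)^2 * T^2"
          using elim by (simp add: power_divide)
        also have "\<dots> \<le> (V (c + t / T) - V c) * T^2"
          by (intro mult_right_mono \<eta>(2) True) auto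
        finally have "exp (- (V (c + t / T) - V c) * T^2) \<le> exp (- \<eta> * t^2)"
          by (simp add: left_diff_distrib)
        then show ?thesis
          using K[OF True] K0 True unfolding s_def F_def
          by (auto simp: abs_mult intro!: mult_mono)
      next
        case False
        then show ?thesis using K0 by (simp add: s_def F_def)
      qed
      then show ?case by simp
    qed
    have "((\<lambda>T. s T t) \<longlongrightarrow> \<phi> c * exp (- \<kappa> / 2 * t^2)) at_top" for t
    proof -
      have l0: "((\<lambda>T. c + t / T) \<longlongrightarrow> c) at_top"
        by (rule tendsto_eq_intros tendsto_divide_0 filterlim_at_top_imp_at_infinity filterlim_ident refl | simp)+
      have "eventually (\<lambda>T. c + t / T \<in> {l<..<r}) at_top"
        by (rule topological_tendstoD[OF l0]) (use c in auto)
      then have inr: "eventually (\<lambda>T. c + t / T \<in> {l..r}) at_top"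
        by eventually_elim auto
      have "isCont \<phi> c"
        using c by (intro continuous_on_interior[OF \<phi>]) (auto simp: interior_atLeastAtMost_real)
      then have 1: "((\<lambda>T. \<phi> (c + t / T)) \<longlongrightarrow> \<phi> c) at_top"
        using l0 by (rule isCont_tendsto_compose)
      have 2: "((\<lambda>T. (V (c + t / T) - V c) * T^2) \<longlongrightarrow> \<kappa> / 2 * t^2) at_top"
      proof (cases "t = 0")
        case False
        have "filterlim (\<lambda>T. c + t / T) (at c) at_top"
          unfolding filterlim_at using l0 False eventually_gt_at_top[of 0]
          by (auto elim!: eventually_mono)
        from filterlim_compose[OF tendsto_second_order[OF V crit V'] this]
        have "((\<lambda>T. (V (c + t / T) - V c) / (t / T)^2) \<longlongrightarrow> \<kappa> / 2) at_top" by simp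
        then have "((\<lambda>T. (V (c + t / T) - V c) / (t / T)^2 * t^2) \<longlongrightarrow> \<kappa> / 2 * t^2) at_top"
          by (rule tendsto_mult_right)
        then show ?thesis
          by (rule Lim_transform_eventually)
             (use eventually_gt_at_top[of 0] in eventually_elim, use False in \<open>auto simp: field_simps\<close>)
      qed simp
      have "((\<lambda>T. \<phi> (c + t / T) * exp (- ((V (c + t / T) - V c) * T^2))) \<longlongrightarrow> \<phi> c * exp (- (\<kappa> / 2 * t^2))) at_top"
        by (intro tendsto_intros 1 2)
      moreover have "eventually (\<lambda>T. \<phi> (c + t / T) * exp (- ((V (c + t / T) - V c) * T^2)) = s T t) at_top"
        using inr by eventually_elim (auto simp: s_def F_def left_diff_distrib)
      ultimately show ?thesis
        by (auto intro: Lim_transform_eventually)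
    qed
    then show "AE t in lborel. ((\<lambda>T. s T t) \<longlongrightarrow> \<phi> c * exp (- \<kappa> / 2 * t^2)) at_top"
      by simp
  qed
  moreover have "(\<integral>t. \<phi> c * exp (- \<kappa> / 2 * t^2) \<partial>lborel) = \<phi> c * sqrt (2 * pi / \<kappa>)"
  proof -
    have sig: "exp (- \<kappa> / 2 * t^2) = sqrt (2 * pi / \<kappa>) * normal_density 0 (sqrt (1 / \<kappa>)) t" for t
      using \<kappa> by (simp add: normal_density_def)
    show ?thesis
      using \<kappa> integral_normal_density[of "sqrt (1 / \<kappa>)" 0] unfolding sig by simp
  qed
  ultimately have "((\<lambda>T. \<integral>t. s T t \<partial>lborel) \<longlongrightarrow> \<phi> c * sqrt (2 * pi / \<kappa>)) at_top"
    by (simp only:)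
  then show ?thesis
    by (rule Lim_transform_eventually)
       (use eventually_gt_at_top[of 0] in eventually_elim, simp only: eq)
qed

lemma laplace_interval:
  fixes V V' \<phi> :: "real \<Rightarrow> real"
  assumes "\<And>x. (V has_real_derivative V' x) (at x)"
    and "V' c = 0" and "(V' has_real_derivative \<kappa>) (at c)" and "\<kappa> > 0"
    and "\<And>x. x \<in> {l..r} \<Longrightarrow> x \<noteq> c \<Longrightarrow> V c < V x"
    and "l < c" "c < r" and "continuous_on {l..r} \<phi>"
  shows "((\<lambda>\<epsilon>. integral {l..r} (\<lambda>x. \<phi> x * exp (- (V x - V c) / \<epsilon>)) / sqrt \<epsilon>)
           \<longlongrightarrow> \<phi> c * sqrt (2 * pi / \<kappa>)) (at_right 0)"
proof -
  have "filterlim (\<lambda>\<epsilon>. inverse (sqrt \<epsilon>)) at_top (at_right 0)"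
  proof (rule filterlim_inverse_at_top)
    show "(sqrt \<longlongrightarrow> 0) (at_right 0)"
      using tendsto_real_sqrt[OF tendsto_ident_at[of 0 "{0<..}"]] by simp
    show "\<forall>\<^sub>F \<epsilon> in at_right 0. 0 < sqrt \<epsilon>"
      by (simp add: eventually_at_right_less)
  qed
  moreover have "((\<lambda>T. integral {l..r} (\<lambda>x. \<phi> x * exp (- (V x - V c) * T^2)) * T)
           \<longlongrightarrow> \<phi> c * sqrt (2 * pi / \<kappa>)) at_top"
    by (rule laplace_at_top[where V' = V']) (fact assms)+
  ultimately have "((\<lambda>\<epsilon>. integral {l..r} (\<lambda>x. \<phi> x * exp (- (V x - V c) * (inverse (sqrt \<epsilon>))^2)) * inverse (sqrt \<epsilon>))
           \<longlongrightarrow> \<phi> c * sqrt (2 * pi / \<kappa>)) (at_right 0)"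
    by (rule filterlim_compose[rotated])
  then show ?thesis
    by (rule Lim_transform_eventually)
       (use eventually_at_right_less[of 0] in eventually_elim, simp add: field_simps)
qed


section \<open>Functions and measures on the torus\<close>

lemma has_real_derivative_LBINT:
  fixes f :: "real \<Rightarrow> real"
  assumes f: "continuous_on UNIV f"
  shows "((\<lambda>x. LBINT z=ereal 0..ereal x. f z) has_real_derivative f x) (at x)"
proof -
  define l r where "l = min 0 x - 1" and "r = max 0 x + 1"
  have "((\<lambda>u. LBINT y=ereal 0..ereal u. f y) has_vector_derivative f x) (at x within {l..r})"
    by (rule interval_integral_FTC2) (auto simp: l_def r_def intro: continuous_on_subset[OF f])
  moreover have "at x within {l..r} = at x"
    by (rule at_within_interior) (auto simp: l_def r_def interior_atLeastAtMost_real)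
  ultimately show ?thesis
    by (simp add: has_real_derivative_iff_has_vector_derivative)
qed

lemma antiderivative_exists:
  fixes f :: "real \<Rightarrow> real"
  assumes "continuous_on UNIV f"
  obtains F where "\<And>x. (F has_real_derivative f x) (at x)"
  using has_real_derivative_LBINT[OF assms] by blast

lemma has_integral_antiderivative:
  fixes F :: "real \<Rightarrow> real"
  assumes "\<And>x. (F has_real_derivative f x) (at x)" and "l \<le> r"
  shows "(f has_integral (F r - F l)) {l..r}"
  using assms
  by (intro fundamental_theorem_of_calculus)
     (auto simp: has_real_derivative_iff_has_vector_derivative[symmetric] intro: has_field_derivative_at_within)

lemma integral_antiderivative:
  fixes F :: "real \<Rightarrow> real"
  assumes "\<And>x. (F has_real_derivative f x) (at x)" and "l \<le> r"
  shows "integral {l..r} f = F r - F l"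
  using has_integral_antiderivative[OF assms] by (rule integral_unique)

lemma integral_pos_of_continuous:
  fixes f :: "real \<Rightarrow> real"
  assumes "continuous_on {l..r} f" "\<And>x. x \<in> {l..r} \<Longrightarrow> 0 \<le> f x" "l < r" "z \<in> {l..r}" "0 < f z"
  shows "0 < integral {l..r} f"
proof -
  have "integral {l..r} f \<noteq> 0"
    using assms by (subst integral_eq_0_iff) (auto intro!: bexI[of _ z])
  moreover have "0 \<le> integral {l..r} f"
    using assms by (intro integral_nonneg integrable_continuous_interval)
  ultimately show ?thesis by simp
qed

lemma deriv_shift_eq:
  fixes f :: "real \<Rightarrow> real"
  assumes "\<And>x. f (x + 1) = f x + C" and "\<And>x. (f has_real_derivative f' x) (at x)"
  shows "f' (x + 1) = f' x"
proof -
  have "((\<lambda>x. f (x + 1)) has_real_derivative f' (x + 1)) (at x)"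
    using assms(2)[of "x + 1"] DERIV_shift by blast
  moreover have "((\<lambda>x. f (x + 1)) has_real_derivative f' x) (at x)"
    unfolding assms(1) by (auto intro!: derivative_eq_intros assms(2))
  ultimately show ?thesis by (rule DERIV_unique)
qed

lemma periodic_of_int:
  fixes f :: "real \<Rightarrow> real"
  assumes "\<And>x. f (x + 1) = f x"
  shows "f (x + of_int n) = f x"
proof (induction n)
  case (nonneg n) then show ?case
  proof (induction n)
    case (Suc n)
    have "f (x + of_int (int (Suc n))) = f ((x + of_int (int n)) + 1)" by (simp add: algebra_simps)
    then show ?case using Suc assms by simp
  qed simp
next
  case (neg n)
  show ?case
  proof (induction n)
    case 0
    show ?case using assms[of "x - 1"] by simp
  next
    case (Suc n)
    have "x + of_int (- int (Suc n)) = (x + of_int (- int (Suc (Suc n)))) + 1"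
      by simp
    then show ?case using Suc assms by metis
  qed
qed

lemma periodic_frac:
  fixes f :: "real \<Rightarrow> real"
  assumes "\<And>x. f (x + 1) = f x"
  shows "f (frac x) = f x"
  using periodic_of_int[where f = f and x = x and n = "- \<lfloor>x\<rfloor>", OF assms] by (simp add: frac_def)

text \<open>
  The conclusions on \<open>deriv\<close> let explicit derivatives be substituted in the generator.
\<close>

lemma torus_C2I:
  assumes "\<And>x. f (x + 1) = f x"
    and "\<And>x. (f has_real_derivative f' x) (at x)" and "\<And>x. (f' has_real_derivative f'' x) (at x)"
    and "continuous_on UNIV f''"
  shows "f \<in> torus_C2" "deriv f = f'" "deriv (deriv f) = f''"
proof -
  show 1: "deriv f = f'" using assms(2) DERIV_imp_deriv by blast
  have 3: "deriv f' = f''" using assms(3) DERIV_imp_deriv by blast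
  then show 2: "deriv (deriv f) = f''" by (simp add: 1)
  show "f \<in> torus_C2"
    using assms unfolding torus_C2_def mem_Collect_eq 1 3
    by (auto simp: real_differentiable_def)
qed

lemma torus_C2D:
  assumes "f \<in> torus_C2"
  shows torus_C2_periodic: "f (x + 1) = f x"
    and torus_C2_deriv: "(f has_real_derivative deriv f x) (at x)"
    and torus_C2_deriv2: "(deriv f has_real_derivative deriv (deriv f) x) (at x)"
    and torus_C2_continuous: "continuous_on A f"
    and torus_C2_continuous_deriv: "continuous_on A (deriv f)"
    and torus_C2_continuous_deriv2: "continuous_on A (deriv (deriv f))"
proof -
  show "f (x + 1) = f x" and c: "continuous_on A (deriv (deriv f))"
    using assms by (auto simp: torus_C2_def intro: continuous_on_subset)
  have d: "(f has_real_derivative deriv f x) (at x)" "(deriv f has_real_derivative deriv (deriv f) x) (at x)" for x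
    using assms by (auto simp: torus_C2_def DERIV_deriv_iff_real_differentiable)
  then show "(f has_real_derivative deriv f x) (at x)" "(deriv f has_real_derivative deriv (deriv f) x) (at x)"
    by auto
  show "continuous_on A f" "continuous_on A (deriv f)"
    using d by (intro continuous_at_imp_continuous_on ballI; metis DERIV_isCont)+
qed

lemma torus_continuousI:
  "(\<And>x. f (x + 1) = f x) \<Longrightarrow> continuous_on UNIV f \<Longrightarrow> f \<in> torus_continuous"
  by (simp add: torus_continuous_def)

lemma torus_continuousD:
  assumes "f \<in> torus_continuous"
  shows "f (x + 1) = f x" "continuous_on A f"
  using assms by (auto simp: torus_continuous_def intro: continuous_on_subset)

lemma torus_C2_imp_continuous: "f \<in> torus_C2 \<Longrightarrow> f \<in> torus_continuous"
  by (simp add: torus_continuousI torus_C2D)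

lemma torus_C2_deriv_torus_continuous:
  assumes "f \<in> torus_C2"
  shows "deriv f \<in> torus_continuous" "deriv (deriv f) \<in> torus_continuous"
proof -
  have 1: "deriv f (x + 1) = deriv f x" for x
    by (rule deriv_shift_eq[where f = f and C = 0]) (use assms torus_C2D in auto)
  have 2: "deriv (deriv f) (x + 1) = deriv (deriv f) x" for x
    by (rule deriv_shift_eq[where f = "deriv f" and C = 0]) (use assms torus_C2D 1 in auto)
  show "deriv f \<in> torus_continuous" "deriv (deriv f) \<in> torus_continuous"
    using 1 2 assms torus_C2_continuous_deriv torus_C2_continuous_deriv2
    by (auto intro!: torus_continuousI)
qed

lemma torus_continuous_generator_div:
  assumes "a \<in> torus_C2" "b \<in> torus_C2" "u \<in> torus_C2" "\<And>x. 0 < u x"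
  shows "(\<lambda>x. generator a b \<epsilon> u x / u x) \<in> torus_continuous"
proof (rule torus_continuousI)
  have pos: "u x \<noteq> 0" for x using assms(4)[of x] by simp
  show "continuous_on UNIV (\<lambda>x. generator a b \<epsilon> u x / u x)"
    unfolding generator_def using pos
    by (intro continuous_intros torus_C2_continuous torus_C2_continuous_deriv torus_C2_continuous_deriv2 assms) auto
  show "generator a b \<epsilon> u (x + 1) / u (x + 1) = generator a b \<epsilon> u x / u x" for x
    using torus_C2_deriv_torus_continuous[OF assms(3), THEN torus_continuousD(1)]
    by (simp add: generator_def torus_C2_periodic assms(1-3))
qed

lemma torus_continuous_bounded:
  assumes "f \<in> torus_continuous"
  obtains K where "\<And>x. \<bar>f x\<bar> \<le> K" "0 < K"
proof -
  obtain K where K: "\<And>x. x \<in> {0..1} \<Longrightarrow> \<bar>f x\<bar> \<le> K"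
    using compact_imp_bounded[OF compact_continuous_image[OF torus_continuousD(2)[OF assms, of "{0..1}"] compact_Icc]]
    unfolding bounded_iff by fastforce
  have "\<bar>f x\<bar> \<le> max K 1" for x
  proof -
    have "f x = f (frac x)" using periodic_frac[of f x] torus_continuousD(1)[OF assms] by simp
    then show ?thesis using K[of "frac x"] frac_lt_1[of x] by (simp add: le_max_iff_disj)
  qed
  then show ?thesis using that[of "max K 1"] by simp
qed

lemma torus_prob_measurable:
  assumes "M \<in> torus_prob" "f \<in> torus_continuous"
  shows "f \<in> borel_measurable M"
proof -
  have "f \<in> borel_measurable torus"
    unfolding torus_def
    by (intro measurable_restrict_space1 borel_measurable_continuous_onI torus_continuousD[OF assms(2)])
  then show ?thesis
    using assms(1) by (subst measurable_cong_sets[of M torus]) (auto simp: torus_prob_def)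
qed

lemma torus_prob_integrable:
  assumes "M \<in> torus_prob" "f \<in> torus_continuous"
  shows "integrable M f"
proof -
  interpret prob_space M using assms(1) by (simp add: torus_prob_def)
  obtain K where "\<And>x. \<bar>f x\<bar> \<le> K" using torus_continuous_bounded[OF assms(2)] by blast
  then show ?thesis
    by (intro integrable_const_bound[where B = K] torus_prob_measurable assms) auto
qed

text \<open>
  All lower bounds for the rate functional come from a test function \<open>u\<close> for which \<open>- L u / u\<close>
  dominates a continuous function up to a small constant.
\<close>

lemma rate_functional_ge:
  assumes "a \<in> torus_C2" "b \<in> torus_C2" "u \<in> torus_C2" "\<And>x. 0 < u x"
    and M: "M \<in> torus_prob" and g: "g \<in> torus_continuous"
    and le: "\<And>x. generator a b \<epsilon> u x / u x \<le> c - g x"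
  shows "ereal ((\<integral>x. g x \<partial>M) - c) \<le> rate_functional a b \<epsilon> M"
proof -
  interpret prob_space M using M by (simp add: torus_prob_def)
  have i: "integrable M (\<lambda>x. generator a b \<epsilon> u x / u x)"
    by (intro torus_prob_integrable M torus_continuous_generator_div assms)
  have "(\<integral>x. generator a b \<epsilon> u x / u x \<partial>M) \<le> (\<integral>x. c - g x \<partial>M)"
    by (intro integral_mono i le Bochner_Integration.integrable_diff integrable_const torus_prob_integrable[OF M g])
  also have "\<dots> = c - (\<integral>x. g x \<partial>M)"
    using torus_prob_integrable[OF M g] by (simp add: prob_space)
  finally have "ereal ((\<integral>x. g x \<partial>M) - c) \<le> ereal (- (\<integral>x. generator a b \<epsilon> u x / u x \<partial>M))"
    by simp
  also have "\<dots> \<le> rate_functional a b \<epsilon> M"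
    unfolding rate_functional_def using assms by (intro SUP_upper) auto
  finally show ?thesis .
qed

section \<open>The tilt that equalises the currents\<close>

lemma sum_shift_periodic:
  fixes F :: "int \<Rightarrow> real"
  assumes "\<And>k. F (k + int N) = F k"
  shows "(\<Sum>k\<in>{0..<int N}. F (k + 1)) = (\<Sum>k\<in>{0..<int N}. F k)"
proof (cases N)
  case (Suc n)
  have "(\<Sum>k\<in>{0..<int N}. F (k + 1)) = (\<Sum>k\<in>{1..<int N + 1}. F k)"
    by (rule sum.reindex_bij_witness[of _ "\<lambda>k. k - 1" "\<lambda>k. k + 1"]) auto
  also have "{1..<int N + 1} = insert (int N) {1..<int N}" using Suc by auto
  also have "(\<Sum>k\<in>\<dots>. F k) = F (0 + int N) + (\<Sum>k\<in>{1..<int N}. F k)" by simp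
  also have "\<dots> = (\<Sum>k\<in>insert 0 {1..<int N}. F k)" by (simp only: assms) simp
  also have "insert 0 {1..<int N} = {0..<int N}" using Suc by auto
  finally show ?thesis .
qed simp

text \<open>
  For a fixed slope \<open>j\<close> the equation \<open>B exp (- w) - A exp w = j\<close> is quadratic in \<open>exp w\<close> and has one
  positive root. Summed over the edges, the logarithms of the roots are nonnegative for very negative
  \<open>j\<close> and nonpositive for large \<open>j\<close>, so some slope gives increments with sum zero. The last claim
  says that this tilt does at least as well as \<open>w = 0\<close> in the concave functional
  \<open>\<Sum> A (1 - exp w) + B (1 - exp (- w))\<close>; it controls the size of the tilt.
\<close>

lemma chain_tilt_exists:
  fixes A B :: "'k \<Rightarrow> real"
  assumes "finite K" and A: "\<And>k. k \<in> K \<Longrightarrow> 0 < A k" and B: "\<And>k. k \<in> K \<Longrightarrow> 0 < B k"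
  obtains w j where "(\<Sum>k\<in>K. w k) = 0"
    and "\<And>k. k \<in> K \<Longrightarrow> B k * exp (- w k) - A k * exp (w k) = j"
    and "(\<Sum>k\<in>K. A k * exp (w k) + B k * exp (- w k)) \<le> (\<Sum>k\<in>K. A k + B k)"
proof -
  define x where "x j k = (sqrt (j^2 + 4 * A k * B k) - j) / (2 * A k)" for j k
  have x_pos: "0 < x j k" if "k \<in> K" for j k
  proof -
    have "\<bar>j\<bar> < sqrt (j^2 + 4 * A k * B k)"
      using A[OF that] B[OF that] by (intro real_less_rsqrt) auto
    then show ?thesis using A[OF that] by (simp add: x_def)
  qed
  have x_root: "A k * x j k ^ 2 + j * x j k = B k" if "k \<in> K" for j k
  proof -
    define d where "d = sqrt (j^2 + 4 * A k * B k)"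
    have "d^2 = j^2 + 4 * A k * B k"
      unfolding d_def using A[OF that] B[OF that] by (intro real_sqrt_pow2) auto
    moreover have "x j k = (d - j) / (2 * A k)" by (simp add: x_def d_def)
    moreover have "A k * ((d - j) / (2 * A k))^2 + j * ((d - j) / (2 * A k)) = (d^2 - j^2) / (4 * A k)"
      using A[OF that] by (simp add: field_simps power2_eq_square)
    ultimately show ?thesis using A[OF that] by simp
  qed
  define f where "f j = (\<Sum>k\<in>K. ln (x j k))" for j
  have "continuous_on UNIV f"
    unfolding f_def
  proof (intro continuous_intros)
    fix k assume k: "k \<in> K"
    show "continuous_on UNIV (\<lambda>j. x j k)"
      unfolding x_def using A[OF k] by (intro continuous_intros) auto
    show "\<forall>j\<in>UNIV. x j k \<noteq> 0" using x_pos[OF k] by (metis less_irrefl)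
  qed
  have up: "f (\<Sum>k\<in>K. B k) \<le> 0"
    unfolding f_def
  proof (intro sum_nonpos)
    fix k assume k: "k \<in> K"
    let ?j = "\<Sum>k\<in>K. B k"
    have "B k \<le> ?j" using assms(1) B k by (intro member_le_sum) (auto intro: less_imp_le)
    have "x ?j k \<le> 1"
    proof -
      have "?j * x ?j k \<le> B k"
        using x_root[OF k, of ?j] x_pos[OF k, of ?j] A[OF k] by (smt (verit) mult_pos_pos zero_less_power)
      also have "\<dots> \<le> ?j * 1" using \<open>B k \<le> ?j\<close> by simp
      finally show ?thesis using \<open>B k \<le> ?j\<close> B[OF k] by (subst (asm) mult_le_cancel_left_pos) auto
    qed
    then show "ln (x ?j k) \<le> 0" using x_pos[OF k] by simp
  qed
  have lo: "0 \<le> f (- (\<Sum>k\<in>K. A k))"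
    unfolding f_def
  proof (intro sum_nonneg)
    fix k assume k: "k \<in> K"
    let ?j = "- (\<Sum>k\<in>K. A k)"
    have le: "A k \<le> - ?j" using assms(1) A k by (simp, intro member_le_sum) (auto intro: less_imp_le)
    have "1 \<le> x ?j k"
    proof (rule ccontr)
      assume "\<not> 1 \<le> x ?j k"
      then have "A k * x ?j k ^ 2 \<le> A k * x ?j k"
        using x_pos[OF k, of ?j] A[OF k] by (simp add: power2_eq_square)
      also have "\<dots> \<le> - ?j * x ?j k" using le x_pos[OF k, of ?j] by (intro mult_right_mono) auto
      finally show False using x_root[OF k, of ?j] B[OF k] by simp
    qed
    then show "0 \<le> ln (x ?j k)" by simp
  qed
  have ord: "- (\<Sum>k\<in>K. A k) \<le> (\<Sum>k\<in>K. B k)"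
    using sum_nonneg[of K A] sum_nonneg[of K B] A B by (force intro: less_imp_le)
  obtain j where j: "f j = 0"
    using IVT2'[OF up lo ord] \<open>continuous_on UNIV f\<close> continuous_on_subset by blast
  define w where "w k = ln (x j k)" for k
  have w0: "(\<Sum>k\<in>K. w k) = 0" using j by (simp add: f_def w_def)
  have cur: "B k * exp (- w k) - A k * exp (w k) = j" if "k \<in> K" for k
    using x_root[OF that, of j] x_pos[OF that, of j]
    by (simp add: w_def exp_minus field_simps power2_eq_square)
  \<comment> \<open>compare the concave functional at \<open>0\<close> with its tangent at \<open>w\<close>, whose slopes all equal \<open>j\<close>\<close>
  have "(\<Sum>k\<in>K. A k * exp (w k) + B k * exp (- w k)) \<le> (\<Sum>k\<in>K. A k + B k - j * w k)"
  proof (intro sum_mono)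
    fix k assume k: "k \<in> K"
    have "exp (w k) * (1 + - w k) \<le> exp (w k) * exp (- w k)" "exp (- w k) * (1 + w k) \<le> exp (- w k) * exp (w k)"
      using exp_ge_add_one_self[of "- w k"] exp_ge_add_one_self[of "w k"] by (auto intro!: mult_left_mono)
    then have "exp (w k) * (1 - w k) \<le> 1" "exp (- w k) * (1 + w k) \<le> 1"
      by (simp_all add: exp_minus)
    then have "A k * (exp (w k) * (1 - w k)) \<le> A k * 1" "B k * (exp (- w k) * (1 + w k)) \<le> B k * 1"
      using A[OF k] B[OF k] by (intro mult_left_mono; simp)+
    then show "A k * exp (w k) + B k * exp (- w k) \<le> A k + B k - j * w k"
      unfolding cur[OF k, symmetric] by (simp add: algebra_simps)
  qed
  also have "\<dots> = (\<Sum>k\<in>K. A k + B k)"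
    using w0 by (simp add: sum_subtractf sum_distrib_left[symmetric])
  finally show ?thesis using that[OF w0 cur] by blast
qed

section \<open>The landscape of wells and saddles\<close>

lemma int_periodic_mod:
  fixes F :: "int \<Rightarrow> 'a"
  assumes "\<And>k. F (k + int N) = F k"
  shows "F (k mod int N) = F k"
proof -
  have *: "F (k + int n * int N) = F k" for k n
  proof (induction n)
    case (Suc n)
    have "k + int (Suc n) * int N = (k + int n * int N) + int N" by (simp add: algebra_simps)
    then show ?case using Suc assms by metis
  qed simp
  have "F (k mod int N + int n * int N) = F (k mod int N)" for n by (rule *)
  moreover have "F (k + int n * int N) = F k" for n by (rule *)
  moreover have "k = k mod int N + (k div int N) * int N" by simp
  moreover have "k mod int N = k + (- (k div int N)) * int N" by (simp add: minus_div_mult_eq_mod [symmetric])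
  ultimately show ?thesis
    by (cases "k div int N \<ge> 0") (metis nonneg_int_cases, metis nonneg_int_cases linorder_not_le neg_0_le_iff_le order_less_imp_le)
qed

text \<open>
  The prefactor \<open>\<epsilon>\<close> cancels the two factors \<open>sqrt \<epsilon>\<close> of the Laplace asymptotics, so that the
  exponential decides between a nonzero limit and zero.
\<close>

lemma arrhenius_limit:
  fixes Z Y :: "real \<Rightarrow> real"
  assumes Z: "((\<lambda>\<epsilon>. Z \<epsilon> * exp (v / \<epsilon>) / sqrt \<epsilon>) \<longlongrightarrow> p) (at_right 0)"
    and Y: "((\<lambda>\<epsilon>. Y \<epsilon> * exp (- s / \<epsilon>) / sqrt \<epsilon>) \<longlongrightarrow> q) (at_right 0)"
    and "p > 0" "q > 0" and h: "h \<le> s - v"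
  shows "((\<lambda>\<epsilon>. exp (h / \<epsilon>) * (\<epsilon> / (Z \<epsilon> * Y \<epsilon>))) \<longlongrightarrow> (if s - v = h then 1 / (p * q) else 0)) (at_right 0)"
proof -
  have e: "((\<lambda>\<epsilon>. exp ((h - (s - v)) / \<epsilon>)) \<longlongrightarrow> (if s - v = h then 1 else 0)) (at_right 0)"
  proof (cases "s - v = h")
    case False
    define d where "d = (s - v) - h"
    have "d > 0" using h False by (simp add: d_def)
    then have "filterlim (\<lambda>\<epsilon>. - d * inverse \<epsilon>) at_bot (at_right 0)"
      by (intro filterlim_tendsto_neg_mult_at_bot[OF tendsto_const _ filterlim_inverse_at_top_right]) auto
    from filterlim_compose[OF exp_at_bot this] show ?thesis
      using False by (simp add: d_def divide_inverse algebra_simps)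
  qed simp
  have "((\<lambda>\<epsilon>. exp ((h - (s - v)) / \<epsilon>) / ((Z \<epsilon> * exp (v / \<epsilon>) / sqrt \<epsilon>) * (Y \<epsilon> * exp (- s / \<epsilon>) / sqrt \<epsilon>)))
     \<longlongrightarrow> (if s - v = h then 1 else 0) / (p * q)) (at_right 0)"
    using assms by (intro tendsto_intros e) auto
  then have "((\<lambda>\<epsilon>. exp ((h - (s - v)) / \<epsilon>) / ((Z \<epsilon> * exp (v / \<epsilon>) / sqrt \<epsilon>) * (Y \<epsilon> * exp (- s / \<epsilon>) / sqrt \<epsilon>)))
     \<longlongrightarrow> (if s - v = h then 1 / (p * q) else 0)) (at_right 0)"
    by (cases "s - v = h") auto
  then show ?thesis
  proof (rule Lim_transform_eventually)
    show "\<forall>\<^sub>F \<epsilon> in at_right 0. exp ((h - (s - v)) / \<epsilon>) / ((Z \<epsilon> * exp (v / \<epsilon>) / sqrt \<epsilon>) * (Y \<epsilon> * exp (- s / \<epsilon>) / sqrt \<epsilon>))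
      = exp (h / \<epsilon>) * (\<epsilon> / (Z \<epsilon> * Y \<epsilon>))"
      using eventually_at_right_less[of 0]
    proof eventually_elim
      case (elim \<epsilon>)
      have 1: "exp ((h - (s - v)) / \<epsilon>) = exp (h / \<epsilon>) * exp (v / \<epsilon>) * exp (- s / \<epsilon>)"
        by (simp add: exp_add[symmetric] add_divide_distrib diff_divide_distrib)
      have 2: "sqrt \<epsilon> * sqrt \<epsilon> = \<epsilon>" using elim by simp
      have "exp (v / \<epsilon>) * exp (- s / \<epsilon>) / ((Z \<epsilon> * exp (v / \<epsilon>) / sqrt \<epsilon>) * (Y \<epsilon> * exp (- s / \<epsilon>) / sqrt \<epsilon>))
        = (sqrt \<epsilon> * sqrt \<epsilon>) / (Z \<epsilon> * Y \<epsilon>)"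
        using exp_not_eq_zero[of "v / \<epsilon>"] exp_not_eq_zero[of "- s / \<epsilon>"]
        by (cases "Z \<epsilon> = 0 \<or> Y \<epsilon> = 0") (auto simp: divide_simps)
      then show ?case unfolding 1 2 by (simp only: mult.assoc times_divide_eq_right[symmetric])
    qed
  qed
qed

locale landscape =
  fixes a b :: "real \<Rightarrow> real" and c\<^sub>0 :: real and N :: nat and m \<sigma> :: "int \<Rightarrow> real"
  assumes a_C2: "a \<in> torus_C2" and b_C2: "b \<in> torus_C2"
    and c0_pos: "c\<^sub>0 > 0" and a_ge: "\<And>x. a x \<ge> c\<^sub>0"
    and N_pos: "N \<ge> 1"
    and range_m: "range m = {x. b x = 0 \<and> deriv b x < 0}"
    and range_\<sigma>: "range \<sigma> = {x. b x = 0 \<and> deriv b x > 0}"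
    and nondegenerate: "\<And>x. b x = 0 \<Longrightarrow> deriv b x \<noteq> 0"
    and m_shift: "\<And>k. m (k + int N) = m k + 1" and \<sigma>_shift: "\<And>k. \<sigma> (k + int N) = \<sigma> k + 1"
    and \<sigma>_less_m: "\<And>k. \<sigma> k < m k" and m_less_\<sigma>: "\<And>k. m k < \<sigma> (k + 1)"
begin

abbreviation "S \<equiv> potential a b"
abbreviation "\<h> \<equiv> min_barrier S m \<sigma>"

lemma a_pos: "0 < a x"
  using a_ge[of x] c0_pos by linarith

lemma a_nonzero: "a x \<noteq> 0"
  using a_pos[of x] by simp

lemma continuous_drift: "continuous_on A (\<lambda>x. b x / a x)"
  by (intro continuous_intros torus_C2_continuous a_C2 b_C2) (auto simp: a_nonzero)

lemma S_deriv: "(S has_real_derivative - (b x / a x)) (at x)"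
  unfolding potential_def[abs_def]
  by (intro DERIV_minus has_real_derivative_LBINT[OF continuous_drift])

lemma continuous_S [continuous_intros]: "continuous_on A S"
  by (meson DERIV_isCont S_deriv continuous_at_imp_continuous_on)

lemma continuous_a [continuous_intros]: "continuous_on A a"
  by (rule torus_C2_continuous[OF a_C2])

lemma S_shift: "S (x + 1) = S x - (S 0 - S 1)"
proof -
  have "((\<lambda>x. S (x + 1) - S x) has_real_derivative 0) (at x)" for x
  proof -
    have "((\<lambda>x. S (x + 1)) has_real_derivative - (b (x + 1) / a (x + 1))) (at x)"
      using S_deriv[of "x + 1"] DERIV_shift by blast
    then show ?thesis
      by (auto intro!: derivative_eq_intros S_deriv simp: torus_C2_periodic[OF a_C2] torus_C2_periodic[OF b_C2])
  qed
  then have "S (x + 1) - S x = S (0 + 1) - S 0"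
    using DERIV_isconst_all[of "\<lambda>x. S (x + 1) - S x" x 0] by blast
  then show ?thesis by simp
qed

lemma deriv_S: "deriv S = (\<lambda>x. - (b x / a x))"
  using S_deriv DERIV_imp_deriv by blast

lemma S_deriv2: "(deriv S has_real_derivative - ((deriv b x * a x - b x * deriv a x) / (a x * a x))) (at x)"
  unfolding deriv_S
  by (auto intro!: derivative_eq_intros torus_C2_deriv a_C2 b_C2 simp: a_nonzero)

lemma deriv_deriv_S: "deriv (deriv S) x = - ((deriv b x * a x - b x * deriv a x) / (a x * a x))"
  using S_deriv2 DERIV_imp_deriv by blast

lemma b_m: "b (m k) = 0" "deriv b (m k) < 0" and b_\<sigma>: "b (\<sigma> k) = 0" "deriv b (\<sigma> k) > 0"
  using range_m range_\<sigma> by auto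

lemma curvature_m: "deriv (deriv S) (m k) > 0"
  unfolding deriv_deriv_S using b_m[of k] a_pos[of "m k"] by (simp add: divide_neg_pos)

lemma curvature_\<sigma>: "deriv (deriv S) (\<sigma> k) < 0"
  unfolding deriv_deriv_S using b_\<sigma>[of k] a_pos[of "\<sigma> k"] by simp

lemma m_less: "k < l \<Longrightarrow> m k < m l" and \<sigma>_less: "k < l \<Longrightarrow> \<sigma> k < \<sigma> l"
proof -
  have step: "m k < m (k + 1)" "\<sigma> k < \<sigma> (k + 1)" for k
    using \<sigma>_less_m m_less_\<sigma> less_trans by blast+
  have *: "f k < f l" if "\<And>k. f k < f (k + 1)" "k < l" for f :: "int \<Rightarrow> real" and k l
    using that(2)
  proof (induction l rule: int_gr_induct)
    case base show ?case by (rule that(1))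
  next
    case (step i) then show ?case using that(1)[of i] by simp
  qed
  show "k < l \<Longrightarrow> m k < m l" "k < l \<Longrightarrow> \<sigma> k < \<sigma> l" using step * by blast+
qed

lemma m_le: "k \<le> l \<Longrightarrow> m k \<le> m l" and \<sigma>_le: "k \<le> l \<Longrightarrow> \<sigma> k \<le> \<sigma> l"
  using m_less[of k l] \<sigma>_less[of k l] by (auto simp: le_less)

lemma zero_cases:
  assumes "b x = 0"
  obtains j where "x = m j" | j where "x = \<sigma> j"
proof (cases "deriv b x < 0")
  case True
  then have "x \<in> range m" using assms range_m by auto
  then show ?thesis using that by auto
next
  case False
  then have "deriv b x > 0" using nondegenerate[OF assms] by linarith
  then have "x \<in> range \<sigma>" using assms range_\<sigma> by auto
  then show ?thesis using that by auto
qed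

lemma no_zero_right: assumes "\<sigma> k < x" "x < m k" shows "b x \<noteq> 0"
proof
  assume "b x = 0"
  then show False
  proof (cases rule: zero_cases)
    case (1 j)
    then show False using assms m_le[of k j] m_le[of j "k - 1"] m_less_\<sigma>[of "k - 1"]
      by (cases "j \<ge> k") auto
  next
    case (2 j)
    then show False using assms \<sigma>_le[of "k + 1" j] \<sigma>_le[of j k] m_less_\<sigma>[of k]
      by (cases "j \<ge> k + 1") auto
  qed
qed

lemma no_zero_left: assumes "m k < x" "x < \<sigma> (k + 1)" shows "b x \<noteq> 0"
proof
  assume "b x = 0"
  then show False
  proof (cases rule: zero_cases)
    case (1 j)
    then show False using assms m_le[of "k + 1" j] m_le[of j k] \<sigma>_less_m[of "k + 1"]
      by (cases "j \<ge> k + 1") auto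
  next
    case (2 j)
    then show False using assms \<sigma>_le[of "k + 1" j] \<sigma>_le[of j k] \<sigma>_less_m[of k]
      by (cases "j \<ge> k + 1") auto
  qed
qed

text \<open>
  The sign of \<open>b'\<close> at the saddle fixes the sign of \<open>b\<close> just to its right, and \<open>b\<close> has no zero up to
  the next minimum.
\<close>

lemma b_pos: assumes "\<sigma> k < x" "x < m k" shows "b x > 0"
proof (rule ccontr)
  assume "\<not> b x > 0"
  then have neg: "b x < 0" using no_zero_right[OF assms] by linarith
  obtain d where d: "d > 0" "\<And>h. 0 < h \<Longrightarrow> h < d \<Longrightarrow> b (\<sigma> k) < b (\<sigma> k + h)"
    using DERIV_pos_inc_right[OF torus_C2_deriv[OF b_C2] b_\<sigma>(2)] by metis
  define y where "y = \<sigma> k + min (d / 2) ((x - \<sigma> k) / 2)"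
  have y: "\<sigma> k < y" "y < x" "b y > 0"
    using d(1) d(2)[of "min (d / 2) ((x - \<sigma> k) / 2)"] assms b_\<sigma>(1)[of k]
    by (auto simp: y_def min_def field_simps)
  obtain z where "y \<le> z" "z \<le> x" "b z = 0"
    using IVT2'[of b x 0 y] neg y torus_C2_continuous[OF b_C2] by force
  then show False using no_zero_right[of k z] y assms by auto
qed

lemma b_neg: assumes "m k < x" "x < \<sigma> (k + 1)" shows "b x < 0"
proof (rule ccontr)
  assume "\<not> b x < 0"
  then have pos: "b x > 0" using no_zero_left[OF assms] by linarith
  obtain d where d: "d > 0" "\<And>h. 0 < h \<Longrightarrow> h < d \<Longrightarrow> b (m k + h) < b (m k)"
    using DERIV_neg_dec_right[OF torus_C2_deriv[OF b_C2] b_m(2)] by metis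
  define y where "y = m k + min (d / 2) ((x - m k) / 2)"
  have y: "m k < y" "y < x" "b y < 0"
    using d(1) d(2)[of "min (d / 2) ((x - m k) / 2)"] assms b_m(1)[of k]
    by (auto simp: y_def min_def field_simps)
  obtain z where "y \<le> z" "z \<le> x" "b z = 0"
    using IVT'[of b y 0 x] pos y torus_C2_continuous[OF b_C2] by force
  then show False using no_zero_left[of k z] y assms by auto
qed

lemma S_decreasing: assumes "\<sigma> k \<le> x" "x < y" "y \<le> m k" shows "S y < S x"
proof (rule DERIV_neg_imp_decreasing_open[OF assms(2)])
  fix z assume "x < z" "z < y"
  then have "b z > 0" using assms by (intro b_pos[of k]) auto
  then show "\<exists>d. (S has_real_derivative d) (at z) \<and> d < 0"
    using S_deriv[of z] a_pos[of z] by (intro exI[of _ "- (b z / a z)"]) auto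
qed (rule continuous_S)

lemma S_increasing: assumes "m k \<le> x" "x < y" "y \<le> \<sigma> (k + 1)" shows "S x < S y"
proof (rule DERIV_pos_imp_increasing_open[OF assms(2)])
  fix z assume "x < z" "z < y"
  then have "b z < 0" using assms by (intro b_neg[of k]) auto
  then show "\<exists>d. (S has_real_derivative d) (at z) \<and> d > 0"
    using S_deriv[of z] a_pos[of z] by (intro exI[of _ "- (b z / a z)"]) (auto simp: divide_neg_pos)
qed (rule continuous_S)

lemma S_well: assumes "x \<in> {\<sigma> k..\<sigma> (k + 1)}" "x \<noteq> m k" shows "S (m k) < S x"
  using assms S_decreasing[of k x "m k"] S_increasing[of k "m k" x] by (cases "x < m k") auto

lemma S_saddle: assumes "x \<in> {m k..m (k + 1)}" "x \<noteq> \<sigma> (k + 1)" shows "S x < S (\<sigma> (k + 1))"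
  using assms S_increasing[of k x "\<sigma> (k + 1)"] S_decreasing[of "k + 1" "\<sigma> (k + 1)" x]
  by (cases "x < \<sigma> (k + 1)") auto

lemma cover_period:
  assumes "\<sigma> 0 \<le> x" "x < \<sigma> 0 + 1"
  obtains k where "k \<in> {0..<int N}" "\<sigma> k \<le> x" "x < \<sigma> (k + 1)"
proof -
  define K where "K = {k \<in> {0..<int N}. \<sigma> k \<le> x}"
  have "0 \<in> K" using assms N_pos by (simp add: K_def)
  moreover have "finite K" by (rule finite_subset[of _ "{0..<int N}"]) (auto simp: K_def)
  ultimately have fin: "finite K" "K \<noteq> {}" by auto
  define k where "k = Max K"
  have k: "k \<in> K" unfolding k_def using fin by (rule Max_in)
  have "x < \<sigma> (k + 1)"
  proof (cases "k + 1 < int N")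
    case True
    have "k + 1 \<notin> K" using Max_ge[OF fin(1), of "k + 1"] by (auto simp: k_def)
    then show ?thesis using True k by (auto simp: K_def)
  next
    case False
    then have "k + 1 = 0 + int N" using k by (auto simp: K_def)
    then show ?thesis using \<sigma>_shift[of 0] assms by simp
  qed
  then show ?thesis using k that by (auto simp: K_def)
qed

lemma S_shift_m: "S (m (k + int N)) = S (m k) - (S 0 - S 1)"
  and S_shift_\<sigma>: "S (\<sigma> (k + int N)) = S (\<sigma> k) - (S 0 - S 1)"
  by (simp_all add: m_shift \<sigma>_shift S_shift[symmetric])

text \<open>
  Periodicity makes the set of barriers finite, so that \<open>Min\<close> is attained.
\<close>

lemma barrier_ge:
  shows barrier_right_ge: "\<h> \<le> S (\<sigma> (k + 1)) - S (m k)" and barrier_left_ge: "\<h> \<le> S (\<sigma> k) - S (m k)"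
    and min_barrier_pos: "0 < \<h>"
proof -
  define F where "F k = min (barrier_left S m \<sigma> k) (barrier_right S m \<sigma> k)" for k
  have per: "F (k + int N) = F k" for k
    using S_shift_\<sigma>[of k] S_shift_\<sigma>[of "k + 1"] S_shift_m[of k]
    by (simp add: F_def barrier_left_def barrier_right_def add.commute add.left_commute)
  have F_mod: "F k = F (k mod int N)" for k
    using int_periodic_mod[of F, OF per] by simp
  have "F k \<in> F ` {0..<int N}" for k
    by (subst F_mod) (use N_pos in auto)
  then have "range F \<subseteq> F ` {0..<int N}" by auto
  then have fin: "finite (range F)" by (rule finite_subset) auto
  have h: "\<h> = Min (range F)" by (simp add: min_barrier_def F_def)
  have "\<h> \<le> F k" for k unfolding h using fin by (intro Min_le) auto
  then show "\<h> \<le> S (\<sigma> (k + 1)) - S (m k)" "\<h> \<le> S (\<sigma> k) - S (m k)"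
    by (auto simp: F_def barrier_left_def barrier_right_def dest!: spec[of _ k] meta_spec[of _ k])
  have "F k > 0" for k
    using S_well[of "\<sigma> k" k] S_well[of "\<sigma> (k + 1)" k] \<sigma>_less_m[of k] m_less_\<sigma>[of k]
    by (auto simp: F_def barrier_left_def barrier_right_def)
  then show "0 < \<h>" unfolding h using fin by (subst Min_gr_iff) auto
qed

lemma well_laplace:
  assumes "continuous_on UNIV \<phi>"
  shows "((\<lambda>\<epsilon>. integral {\<sigma> k..\<sigma> (k + 1)} (\<lambda>x. \<phi> x * exp (- S x / \<epsilon>)) * exp (S (m k) / \<epsilon>) / sqrt \<epsilon>)
          \<longlongrightarrow> \<phi> (m k) * sqrt (2 * pi / deriv (deriv S) (m k))) (at_right 0)"
proof -
  have "((\<lambda>\<epsilon>. integral {\<sigma> k..\<sigma> (k + 1)} (\<lambda>x. \<phi> x * exp (- (S x - S (m k)) / \<epsilon>)) / sqrt \<epsilon>)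
          \<longlongrightarrow> \<phi> (m k) * sqrt (2 * pi / deriv (deriv S) (m k))) (at_right 0)"
  proof (rule laplace_interval[where V' = "deriv S"])
    show "(S has_real_derivative deriv S x) (at x)" for x using S_deriv deriv_S by simp
    show "deriv S (m k) = 0" by (simp add: deriv_S b_m)
    show "(deriv S has_real_derivative deriv (deriv S) (m k)) (at (m k))"
      using S_deriv2 deriv_deriv_S by simp
  qed (auto intro: S_well curvature_m \<sigma>_less_m m_less_\<sigma> continuous_on_subset[OF assms])
  moreover have "integral {\<sigma> k..\<sigma> (k + 1)} (\<lambda>x. \<phi> x * exp (- (S x - S (m k)) / \<epsilon>))
     = integral {\<sigma> k..\<sigma> (k + 1)} (\<lambda>x. \<phi> x * exp (- S x / \<epsilon>)) * exp (S (m k) / \<epsilon>)" for \<epsilon>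
    unfolding integral_mult_left[symmetric]
    by (intro integral_cong) (simp add: exp_add[symmetric] diff_divide_distrib mult.assoc)
  ultimately show ?thesis by simp
qed

lemma saddle_laplace:
  "((\<lambda>\<epsilon>. integral {m k..m (k + 1)} (\<lambda>x. exp (S x / \<epsilon>)) * exp (- S (\<sigma> (k + 1)) / \<epsilon>) / sqrt \<epsilon>)
          \<longlongrightarrow> sqrt (2 * pi / - deriv (deriv S) (\<sigma> (k + 1)))) (at_right 0)"
proof -
  have "((\<lambda>\<epsilon>. integral {m k..m (k + 1)} (\<lambda>x. 1 * exp (- (- S x - - S (\<sigma> (k + 1))) / \<epsilon>)) / sqrt \<epsilon>)
          \<longlongrightarrow> 1 * sqrt (2 * pi / - deriv (deriv S) (\<sigma> (k + 1)))) (at_right 0)"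
  proof (rule laplace_interval[where V' = "\<lambda>x. - deriv S x"])
    show "((\<lambda>x. - S x) has_real_derivative - deriv S x) (at x)" for x
      using S_deriv[of x] by (auto intro!: derivative_eq_intros simp: deriv_S)
    show "- deriv S (\<sigma> (k + 1)) = 0" by (simp add: deriv_S b_\<sigma>)
    show "((\<lambda>x. - deriv S x) has_real_derivative - deriv (deriv S) (\<sigma> (k + 1))) (at (\<sigma> (k + 1)))"
      using S_deriv2 deriv_deriv_S by (auto intro!: derivative_eq_intros)
    show "0 < - deriv (deriv S) (\<sigma> (k + 1))" using curvature_\<sigma>[of "k + 1"] by simp
  qed (auto intro: S_saddle \<sigma>_less_m m_less_\<sigma>)
  moreover have "integral {m k..m (k + 1)} (\<lambda>x. 1 * exp (- (- S x - - S (\<sigma> (k + 1))) / \<epsilon>))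
     = integral {m k..m (k + 1)} (\<lambda>x. exp (S x / \<epsilon>)) * exp (- S (\<sigma> (k + 1)) / \<epsilon>)" for \<epsilon>
    unfolding integral_mult_left[symmetric]
    by (intro integral_cong) (simp add: exp_add[symmetric] diff_divide_distrib add_divide_distrib)
  ultimately show ?thesis by simp
qed

end

section \<open>Measures with piecewise densities\<close>

text \<open>
  The pieces live on the line and are pushed to the torus by \<open>frac\<close>. Periodic functions do not see the
  difference, so that no global density has to be glued together.
\<close>

lemma torus_prob_of_pieces:
  fixes \<rho> :: "'k \<Rightarrow> real \<Rightarrow> real" and l r :: "'k \<Rightarrow> real"
  assumes fin: "finite K" and \<rho>: "\<And>k. k \<in> K \<Longrightarrow> continuous_on {l k..r k} (\<rho> k)"
    and nonneg: "\<And>k x. k \<in> K \<Longrightarrow> x \<in> {l k..r k} \<Longrightarrow> 0 \<le> \<rho> k x"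
    and mass: "mass = (\<Sum>k\<in>K. integral {l k..r k} (\<rho> k))" "mass > 0"
  obtains M where "M \<in> torus_prob"
    and "\<And>g. g \<in> torus_continuous \<Longrightarrow>
           (\<integral>x. g x \<partial>M) = (\<Sum>k\<in>K. integral {l k..r k} (\<lambda>x. g x * \<rho> k x)) / mass"
proof -
  define R where "R x = (\<Sum>k\<in>K. indicator {l k..r k} x *\<^sub>R \<rho> k x) / mass" for x
  have int_piece: "set_integrable lborel {l k..r k} (\<lambda>x. g x * \<rho> k x)"
    if "k \<in> K" "continuous_on UNIV g" for g :: "real \<Rightarrow> real" and k
    using that by (intro borel_integrable_atLeastAtMost' continuous_intros \<rho>)
      (auto intro: continuous_on_subset)
  have gR: "g x * R x = (\<Sum>k\<in>K. indicator {l k..r k} x *\<^sub>R (g x * \<rho> k x)) / mass" for g :: "real \<Rightarrow> real" and x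
    by (simp add: R_def sum_distrib_left mult_ac)
  have int_gR: "integrable lborel (\<lambda>x. g x * R x)" if "continuous_on UNIV g" for g
    unfolding gR using int_piece that unfolding set_integrable_def
    by (intro integrable_divide_zero Bochner_Integration.integrable_sum) auto
  have integral_gR: "(\<integral>x. g x * R x \<partial>lborel) = (\<Sum>k\<in>K. integral {l k..r k} (\<lambda>x. g x * \<rho> k x)) / mass"
    if "continuous_on UNIV g" for g
  proof -
    have "(\<integral>x. g x * R x \<partial>lborel) = (\<Sum>k\<in>K. (LINT x:{l k..r k}|lborel. g x * \<rho> k x)) / mass"
      unfolding gR integral_divide_zero set_lebesgue_integral_def
      using int_piece that by (subst Bochner_Integration.integral_sum) (auto simp: set_integrable_def)
    also have "\<dots> = (\<Sum>k\<in>K. integral {l k..r k} (\<lambda>x. g x * \<rho> k x)) / mass"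
      by (intro arg_cong2[where f = "(/)"] sum.cong refl set_borel_integral_eq_integral(2) int_piece that)
    finally show ?thesis .
  qed
  have R_int: "integrable lborel R" "(\<integral>x. R x \<partial>lborel) = 1"
    using int_gR[of "\<lambda>_. 1"] integral_gR[of "\<lambda>_. 1"] mass(2) by (simp_all flip: mass(1))
  have R_meas [measurable]: "R \<in> borel_measurable borel"
    using borel_measurable_integrable[OF R_int(1)] by simp
  have R_nonneg: "0 \<le> R x" for x
    unfolding R_def using nonneg mass by (intro divide_nonneg_pos sum_nonneg) (auto simp: indicator_def)
  define D where "D = density lborel (\<lambda>x. ennreal (R x))"
  have frac_meas: "frac \<in> measurable D torus"
    unfolding torus_def
  proof (rule measurable_restrict_space2)
    show "frac \<in> space D \<rightarrow> {0..<1}" by (auto simp: frac_lt_1)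
    show "frac \<in> borel_measurable D" unfolding D_def frac_def by measurable
  qed
  have "prob_space D"
  proof
    have "emeasure D (space D) = (\<integral>\<^sup>+x. ennreal (R x) \<partial>lborel)"
      by (simp add: D_def emeasure_density)
    also have "\<dots> = 1"
      using R_int R_nonneg by (subst nn_integral_eq_integral) auto
    finally show "emeasure D (space D) = 1" .
  qed
  show ?thesis
  proof
    show "distr D torus frac \<in> torus_prob"
      unfolding torus_prob_def using \<open>prob_space D\<close> frac_meas by (auto intro: prob_space.prob_space_distr)
    show "(\<integral>x. g x \<partial>distr D torus frac) = (\<Sum>k\<in>K. integral {l k..r k} (\<lambda>x. g x * \<rho> k x)) / mass"
      if g: "g \<in> torus_continuous" for g
    proof -
      have "g \<in> borel_measurable torus"
        unfolding torus_def
        by (intro measurable_restrict_space1 borel_measurable_continuous_onI torus_continuousD[OF g])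
      then have "(\<integral>x. g x \<partial>distr D torus frac) = (\<integral>x. g (frac x) \<partial>D)"
        by (intro integral_distr frac_meas)
      also have "\<dots> = (\<integral>x. g x \<partial>D)"
        using periodic_frac[of g, OF torus_continuousD(1)[OF g]] by simp
      also have "\<dots> = (\<integral>x. R x * g x \<partial>lborel)"
        unfolding D_def using R_nonneg borel_measurable_continuous_onI[OF torus_continuousD(2)[OF g]]
        by (subst integral_density) auto
      finally show ?thesis
        using integral_gR[OF torus_continuousD(2)[OF g]] by (simp add: mult.commute)
    qed
  qed
qed

section \<open>Jump rates of the reduced chain\<close>

context landscape
begin

definition gibbs :: "real \<Rightarrow> real \<Rightarrow> real" where
  "gibbs \<epsilon> x = 1 / a x * exp (- S x / \<epsilon>)"

definition scale :: "real \<Rightarrow> real \<Rightarrow> real" where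
  "scale \<epsilon> x = (LBINT z=ereal 0..ereal x. exp (S z / \<epsilon>))"

definition well_int :: "real \<Rightarrow> int \<Rightarrow> real" where
  "well_int \<epsilon> k = integral {\<sigma> k..\<sigma> (k + 1)} (gibbs \<epsilon>)"

text \<open>
  The integral of \<open>exp (S / \<epsilon>)\<close> from one minimum to the next, dominated by the maximum in between.
\<close>

definition saddle_int :: "real \<Rightarrow> int \<Rightarrow> real" where
  "saddle_int \<epsilon> k = scale \<epsilon> (m (k + 1)) - scale \<epsilon> (m k)"

lemma gibbs_pos: "0 < gibbs \<epsilon> x"
  using a_pos by (simp add: gibbs_def)

lemma continuous_exp_S: "continuous_on A (\<lambda>x. exp (c * S x / \<epsilon>))"
  by (cases "\<epsilon> = 0") (auto intro!: continuous_intros)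

lemma continuous_gibbs: "continuous_on A (gibbs \<epsilon>)"
  unfolding gibbs_def[abs_def] using continuous_exp_S[of A "-1" \<epsilon>]
  by (auto intro!: continuous_intros simp: a_nonzero)

lemma gibbs_shift: "gibbs \<epsilon> (x + 1) = exp ((S 0 - S 1) / \<epsilon>) * gibbs \<epsilon> x"
  by (simp add: gibbs_def S_shift torus_C2_periodic[OF a_C2] exp_add[symmetric] diff_divide_distrib)

lemma scale_deriv: "(scale \<epsilon> has_real_derivative exp (S x / \<epsilon>)) (at x)"
  unfolding scale_def[abs_def]
  using continuous_exp_S[of UNIV 1 \<epsilon>] by (intro has_real_derivative_LBINT) auto

lemma scale_less: "x < y \<Longrightarrow> scale \<epsilon> x < scale \<epsilon> y"
  by (rule DERIV_pos_imp_increasing) (auto intro: scale_deriv exI[of _ "exp (S _ / \<epsilon>)"] conjI)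

lemma scale_le: "x \<le> y \<Longrightarrow> scale \<epsilon> x \<le> scale \<epsilon> y"
  using scale_less[of x y] by (auto simp: le_less)

lemma saddle_int_eq: "saddle_int \<epsilon> k = integral {m k..m (k + 1)} (\<lambda>x. exp (S x / \<epsilon>))"
  unfolding saddle_int_def
  by (rule integral_antiderivative[symmetric, OF scale_deriv]) (simp add: m_le)

lemma saddle_int_pos: "0 < saddle_int \<epsilon> k"
  unfolding saddle_int_def using scale_less[OF m_less[of k "k + 1"]] by simp

lemma well_int_pos: "0 < well_int \<epsilon> k"
  unfolding well_int_def using gibbs_pos \<sigma>_less[of k "k + 1"]
  by (intro integral_pos_of_continuous[where z = "\<sigma> k"] continuous_gibbs) (auto intro: less_imp_le)

lemma integral_gibbs_shift:
  assumes "\<And>x. g (x + 1) = g x"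
  shows "integral {l + 1..r + 1} (\<lambda>x. g x * gibbs \<epsilon> x)
    = exp ((S 0 - S 1) / \<epsilon>) * integral {l..r} (\<lambda>x. g x * gibbs \<epsilon> x)"
proof -
  have "integral {l + 1..r + 1} (\<lambda>x. g x * gibbs \<epsilon> x) = integral {l..r} (\<lambda>x. g (x + 1) * gibbs \<epsilon> (x + 1))"
    using integral_shift_real_ivl[of "l + 1" 1 "r + 1" "\<lambda>x. g x * gibbs \<epsilon> x"] by simp
  also have "\<dots> = integral {l..r} (\<lambda>x. exp ((S 0 - S 1) / \<epsilon>) * (g x * gibbs \<epsilon> x))"
    by (simp add: assms gibbs_shift mult_ac)
  finally show ?thesis by simp
qed

lemma well_int_shift: "well_int \<epsilon> (k + int N) = exp ((S 0 - S 1) / \<epsilon>) * well_int \<epsilon> k"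
proof -
  have "\<sigma> (k + int N + 1) = \<sigma> (k + 1) + 1" using \<sigma>_shift[of "k + 1"] by (simp add: algebra_simps)
  then show ?thesis
    using integral_gibbs_shift[of "\<lambda>_. 1" "\<sigma> k" "\<sigma> (k + 1)" \<epsilon>]
    by (simp add: well_int_def \<sigma>_shift)
qed

lemma well_weight_pos: "0 < well_weight a S m k"
  unfolding well_weight_def using a_pos curvature_m by simp

lemma well_int_asymp:
  "((\<lambda>\<epsilon>. well_int \<epsilon> k * exp (S (m k) / \<epsilon>) / sqrt \<epsilon>) \<longlongrightarrow> well_weight a S m k) (at_right 0)"
  using well_laplace[of "\<lambda>x. 1 / a x" k]
  by (simp add: well_weight_def well_int_def gibbs_def[abs_def] a_nonzero continuous_intros)

lemma saddle_int_asymp: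
  "((\<lambda>\<epsilon>. saddle_int \<epsilon> k * exp (- S (\<sigma> (k + 1)) / \<epsilon>) / sqrt \<epsilon>)
     \<longlongrightarrow> sqrt (2 * pi / - deriv (deriv S) (\<sigma> (k + 1)))) (at_right 0)"
  using saddle_laplace[of k] by (simp add: saddle_int_eq)

lemma jump_rate_eqs:
  shows jump_rate_right: "jump_rate a S m \<sigma> k (k + 1) =
      (if S (\<sigma> (k + 1)) - S (m k) = \<h>
       then 1 / (well_weight a S m k * sqrt (2 * pi / - deriv (deriv S) (\<sigma> (k + 1)))) else 0)"
    and jump_rate_left: "jump_rate a S m \<sigma> (k + 1) k =
      (if S (\<sigma> (k + 1)) - S (m (k + 1)) = \<h>
       then 1 / (well_weight a S m (k + 1) * sqrt (2 * pi / - deriv (deriv S) (\<sigma> (k + 1)))) else 0)"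
  by (auto simp: jump_rate_def barrier_right_def barrier_left_def saddle_weight_def)

lemma rate_right_limit:
  "((\<lambda>\<epsilon>. exp (\<h> / \<epsilon>) * (\<epsilon> / (well_int \<epsilon> k * saddle_int \<epsilon> k))) \<longlongrightarrow> jump_rate a S m \<sigma> k (k + 1)) (at_right 0)"
  unfolding jump_rate_right using curvature_\<sigma>[of "k + 1"]
  by (intro arrhenius_limit well_int_asymp saddle_int_asymp well_weight_pos barrier_right_ge)
     (simp add: divide_pos_neg)

lemma rate_left_limit:
  "((\<lambda>\<epsilon>. exp (\<h> / \<epsilon>) * (\<epsilon> / (well_int \<epsilon> (k + 1) * saddle_int \<epsilon> k))) \<longlongrightarrow> jump_rate a S m \<sigma> (k + 1) k) (at_right 0)"
  unfolding jump_rate_left using curvature_\<sigma>[of "k + 1"] barrier_left_ge[of "k + 1"]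
  by (intro arrhenius_limit well_int_asymp saddle_int_asymp well_weight_pos) (simp_all add: divide_pos_neg)

lemma jump_rate_shift: "jump_rate a S m \<sigma> (k + int N) (l + int N) = jump_rate a S m \<sigma> k l"
proof -
  have "deriv (deriv S) (x + 1) = deriv (deriv S) x" for x
    using torus_C2_deriv_torus_continuous(1)[OF a_C2, THEN torus_continuousD(1)]
      torus_C2_deriv_torus_continuous(1)[OF b_C2, THEN torus_continuousD(1)]
    by (simp add: deriv_deriv_S torus_C2_periodic[OF a_C2] torus_C2_periodic[OF b_C2])
  then have dd: "deriv (deriv S) (m (k + int N)) = deriv (deriv S) (m k)"
    "deriv (deriv S) (\<sigma> (k + int N)) = deriv (deriv S) (\<sigma> k)" for k
    by (simp_all add: m_shift \<sigma>_shift)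
  have "well_weight a S m (k + int N) = well_weight a S m k"
    unfolding well_weight_def dd by (simp add: m_shift torus_C2_periodic[OF a_C2])
  moreover have "saddle_weight S \<sigma> (k + int N) (l + int N) = saddle_weight S \<sigma> k l"
    unfolding saddle_weight_def max_add_distrib_left[symmetric] dd ..
  moreover have "barrier_left S m \<sigma> (k + int N) = barrier_left S m \<sigma> k"
    by (simp add: barrier_left_def S_shift_m S_shift_\<sigma>)
  moreover have "barrier_right S m \<sigma> (k + int N) = barrier_right S m \<sigma> k"
    using S_shift_m[of k] S_shift_\<sigma>[of "k + 1"] by (simp add: barrier_right_def add_ac)
  ultimately show ?thesis by (simp add: jump_rate_def)
qed

section \<open>The rate functional of a tilted density\<close>

text \<open>
  The scale function, normalised to run from \<open>0\<close> to \<open>1\<close> on the edge from \<open>m k\<close> to \<open>m (k + 1)\<close>. It is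
  also the probability that the diffusion started at \<open>x\<close> reaches \<open>m (k + 1)\<close> before \<open>m k\<close>.
\<close>

definition crossing :: "real \<Rightarrow> int \<Rightarrow> real \<Rightarrow> real" where
  "crossing \<epsilon> k x = (scale \<epsilon> x - scale \<epsilon> (m k)) / saddle_int \<epsilon> k"

lemma crossing_deriv: "(crossing \<epsilon> k has_real_derivative exp (S x / \<epsilon>) / saddle_int \<epsilon> k) (at x)"
  unfolding crossing_def[abs_def] using saddle_int_pos[of \<epsilon> k]
  by (auto intro!: derivative_eq_intros scale_deriv)

lemma crossing_ends: "crossing \<epsilon> k (m k) = 0" "crossing \<epsilon> k (m (k + 1)) = 1"
  using saddle_int_pos[of \<epsilon> k] by (auto simp: crossing_def saddle_int_def)

lemma crossing_bounds: assumes "x \<in> {m k..m (k + 1)}" shows "0 \<le> crossing \<epsilon> k x" "crossing \<epsilon> k x \<le> 1"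
  using assms scale_le[of "m k" x \<epsilon>] scale_le[of x "m (k + 1)" \<epsilon>] saddle_int_pos[of \<epsilon> k]
  by (auto simp: crossing_def saddle_int_def divide_simps)

lemma continuous_crossing: "continuous_on A (crossing \<epsilon> k)"
  by (meson DERIV_isCont crossing_deriv continuous_at_imp_continuous_on)

end

text \<open>
  The first factor \<open>p\<close> is affine from \<open>1\<close> to \<open>exp w\<close>, the second factor \<open>r\<close> from \<open>\<alpha>\<close> to
  \<open>\<beta> exp (- w)\<close>; their product goes from \<open>\<alpha>\<close> to \<open>\<beta>\<close>. In the scale, \<open>p\<close> is the harmonic function by
  which the diffusion is conditioned, and the stationary density of the conditioned process is
  \<open>p r\<close> times the Gibbs weight. The Wronskian \<open>p r' - p' r\<close>,
  which is the negative of the current, is constant along the edge.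
\<close>

definition tilted :: "real \<Rightarrow> real \<Rightarrow> real \<Rightarrow> real \<Rightarrow> real" where
  "tilted \<alpha> \<beta> w s = (1 + s * (exp w - 1)) * (\<alpha> + s * (\<beta> * exp (- w) - \<alpha>))"

lemma tilted_expand:
  "tilted \<alpha> \<beta> w s = (1 - s)^2 * \<alpha> + s^2 * \<beta> + s * (1 - s) * (\<alpha> * exp w + \<beta> * exp (- w))"
proof -
  have "(1 + s * (W - 1)) * (\<alpha> + s * (\<beta> * V - \<alpha>)) = (1 - s)^2 * \<alpha> + s^2 * \<beta> + s * (1 - s) * (\<alpha> * W + \<beta> * V)"
    if "W * V = 1" for V W :: real
    using that by algebra
  from this[of "exp w" "exp (- w)"] show ?thesis unfolding tilted_def by (simp add: exp_minus)
qed

lemma tilted_nonneg: "0 \<le> \<alpha> \<Longrightarrow> 0 \<le> \<beta> \<Longrightarrow> 0 \<le> s \<Longrightarrow> s \<le> 1 \<Longrightarrow> 0 \<le> tilted \<alpha> \<beta> w s"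
  unfolding tilted_expand by (intro add_nonneg_nonneg mult_nonneg_nonneg) auto

lemma tilted_near_0:
  assumes "0 \<le> \<alpha>" "0 \<le> \<beta>" "0 \<le> s" "s \<le> 1"
  shows "\<bar>tilted \<alpha> \<beta> w s - \<alpha>\<bar> \<le> s * (2 * \<alpha> + 2 * \<beta> + \<alpha> * exp w + \<beta> * exp (- w))"
proof -
  define c where "c = \<alpha> * exp w + \<beta> * exp (- w)"
  have c: "0 \<le> c" using assms by (simp add: c_def)
  have "tilted \<alpha> \<beta> w s - \<alpha> = s * (s * \<alpha> + s * \<beta> + (1 - s) * c - 2 * \<alpha>)"
    unfolding tilted_expand c_def[symmetric] by algebra
  moreover have "\<bar>s * \<alpha> + s * \<beta> + (1 - s) * c - 2 * \<alpha>\<bar> \<le> 2 * \<alpha> + 2 * \<beta> + c"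
  proof -
    have "s * \<alpha> \<le> 1 * \<alpha>" "s * \<beta> \<le> 1 * \<beta>" "(1 - s) * c \<le> 1 * c"
      using assms c by (intro mult_right_mono; simp)+
    moreover have "0 \<le> s * \<alpha>" "0 \<le> s * \<beta>" "0 \<le> (1 - s) * c" using assms c by auto
    ultimately show ?thesis using assms by linarith
  qed
  ultimately show ?thesis
    using assms by (simp add: abs_mult c_def mult_left_mono add_ac)
qed

lemma tilted_swap: "tilted \<alpha> \<beta> w s = tilted \<beta> \<alpha> (- w) (1 - s)"
  unfolding tilted_expand by (simp add: algebra_simps)

lemma tilted_near_1:
  assumes "0 \<le> \<alpha>" "0 \<le> \<beta>" "0 \<le> s" "s \<le> 1"
  shows "\<bar>tilted \<alpha> \<beta> w s - \<beta>\<bar> \<le> (1 - s) * (2 * \<alpha> + 2 * \<beta> + \<alpha> * exp w + \<beta> * exp (- w))"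
  using tilted_near_0[of \<beta> \<alpha> "1 - s" "- w"] assms by (simp add: tilted_swap[of \<alpha>] add_ac)

text \<open>
  Here \<open>q\<close> stands for \<open>u' / u\<close>, \<open>E\<close> for \<open>exp (S / \<epsilon>)\<close> and \<open>\<tau>\<close> for the derivative of the
  normalised scale; the right-hand side equals \<open>1 / E * (r / p) * (p * q - ps * \<tau>)\<^sup>2\<close>.
\<close>

lemma tilted_completes_square:
  fixes p r ps rs q \<tau> E Y :: real
  assumes "p > 0" "r \<ge> 0" "E > 0" "\<tau> = E / Y" "Y > 0"
  shows "0 \<le> (1 / E) * (q^2 * (p * r) - q * ((ps * r + p * rs) * \<tau>))
     + (1 / Y) * ((rs * p - ps * r) * q + ps * rs * \<tau> - (rs * p - ps * r) * (ps * \<tau> / p))"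
proof -
  have E: "E = \<tau> * Y" and "\<tau> > 0" using assms by auto
  then have "(1 / E) * (q^2 * (p * r) - q * ((ps * r + p * rs) * \<tau>))
     + (1 / Y) * ((rs * p - ps * r) * q + ps * rs * \<tau> - (rs * p - ps * r) * (ps * \<tau> / p))
     = (1 / E) * (r / p) * (p * q - ps * \<tau>)^2"
    using assms(1,5) unfolding E by (simp add: field_simps power2_eq_square)
  also have "\<dots> \<ge> 0" using assms by (intro mult_nonneg_nonneg) auto
  finally show ?thesis .
qed

context landscape
begin

text \<open>
  With \<open>q = u' / u\<close> the integrand is, up to the derivative of the boundary term
  \<open>- \<epsilon> exp (- S / \<epsilon>) q f\<close>, a concave quadratic in \<open>q\<close>. Completing the square around
  \<open>q = p' / p\<close> bounds it by the derivative of \<open>\<Theta>\<close>, in which \<open>u\<close> enters only through \<open>j ln u\<close>. The last two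
  lines of the bound are the tangent at \<open>w\<close> to
  \<open>y \<mapsto> \<epsilon> / Y * (\<alpha> (1 - exp y) + \<beta> (1 - exp (- y)))\<close>, evaluated at the increment of \<open>ln u\<close>.
\<close>

lemma edge_bound:
  fixes u :: "real \<Rightarrow> real" and \<alpha> \<beta> w \<epsilon> :: real and k :: int
  assumes u: "u \<in> torus_C2" "\<And>x. 0 < u x" and \<epsilon>: "\<epsilon> > 0" and ab: "0 \<le> \<alpha>" "0 \<le> \<beta>"
  defines "f \<equiv> \<lambda>x. tilted \<alpha> \<beta> w (crossing \<epsilon> k x)"
    and "j \<equiv> \<beta> * exp (- w) - \<alpha> * exp w" and "Y \<equiv> saddle_int \<epsilon> k"
  shows "integral {m k..m (k + 1)} (\<lambda>x. - (generator a b \<epsilon> u x / u x) * (f x * gibbs \<epsilon> x))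
    \<le> \<epsilon> * (exp (- S (m k) / \<epsilon>) * (deriv u (m k) / u (m k)) * \<alpha>
         - exp (- S (m (k + 1)) / \<epsilon>) * (deriv u (m (k + 1)) / u (m (k + 1))) * \<beta>)
      + \<epsilon> / Y * (\<alpha> * (1 - exp w) + \<beta> * (1 - exp (- w)))
      + \<epsilon> / Y * j * (ln (u (m (k + 1))) - ln (u (m k)) - w)"
proof -
  define s where "s = crossing \<epsilon> k"
  define ps rs where "ps = exp w - 1" and "rs = \<beta> * exp (- w) - \<alpha>"
  define p r where "p x = 1 + s x * ps" and "r x = \<alpha> + s x * rs" for x
  have f: "f x = p x * r x" for x
    by (simp add: f_def tilted_def p_def r_def s_def ps_def rs_def)
  \<comment> \<open>as a function of \<open>s\<close>, \<open>ps * rs * s - j * ln p\<close> has the derivative \<open>ps\<^sup>2 * r / p\<close>, since \<open>ps * r = rs * p - j\<close>\<close>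
  define \<Theta> where "\<Theta> x = - \<epsilon> * (exp (- S x / \<epsilon>) * (deriv u x / u x) * (p x * r x))
     + \<epsilon> / Y * (j * ln (u x) + ps * rs * s x - j * ln (p x))" for x
  define E where "E x = exp (S x / \<epsilon>)" for x
  have E: "E x > 0" "exp (- S x / \<epsilon>) = 1 / E x" for x
    by (simp_all add: E_def exp_minus field_simps)
  have Y: "Y > 0" unfolding Y_def by (rule saddle_int_pos)
  have ee: "exp w * exp (- w) = 1" by (simp add: exp_minus)
  have j: "j = rs * p x - ps * r x" for x
  proof -
    have "\<beta> * V - \<alpha> * W = (\<beta> * V - \<alpha>) * (1 + t * (W - 1)) - (W - 1) * (\<alpha> + t * (\<beta> * V - \<alpha>))"
      for V W t :: real
      by (simp add: algebra_simps)
    from this show ?thesis unfolding j_def rs_def ps_def p_def r_def .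
  qed
  have s01: "0 \<le> s x" "s x \<le> 1" if "x \<in> {m k..m (k + 1)}" for x
    using crossing_bounds[OF that] by (auto simp: s_def)
  have p_pos: "p x > 0" if "x \<in> {m k..m (k + 1)}" for x
  proof -
    have "p x = (1 - s x) + s x * exp w" by (simp add: p_def ps_def algebra_simps)
    then show ?thesis using s01[OF that] exp_gt_zero[of w]
      by (cases "s x = 0") (auto intro: add_nonneg_pos)
  qed
  have r_nonneg: "r x \<ge> 0" if "x \<in> {m k..m (k + 1)}" for x
  proof -
    have "r x = (1 - s x) * \<alpha> + s x * (\<beta> * exp (- w))" by (simp add: r_def rs_def algebra_simps)
    then show ?thesis using s01[OF that] ab by simp
  qed
  have un: "u x \<noteq> 0" for x using u(2)[of x] by simp
  define D where "D x = - (generator a b \<epsilon> u x / u x) * (f x * gibbs \<epsilon> x)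
     + \<epsilon> * ((1 / E x) * ((deriv u x / u x)^2 * (p x * r x) - (deriv u x / u x) * ((ps * r x + p x * rs) * (E x / Y)))
     + (1 / Y) * ((rs * p x - ps * r x) * (deriv u x / u x) + ps * rs * (E x / Y) - (rs * p x - ps * r x) * (ps * (E x / Y) / p x)))" for x
  have \<Theta>_deriv: "(\<Theta> has_real_derivative D x) (at x)" if x: "x \<in> {m k..m (k + 1)}" for x
  proof -
    have ds: "(s has_real_derivative E x / Y) (at x)" unfolding s_def E_def Y_def by (rule crossing_deriv)
    have dp: "(p has_real_derivative (E x / Y) * ps) (at x)"
      unfolding p_def[abs_def] by (auto intro!: derivative_eq_intros ds)
    have dr: "(r has_real_derivative (E x / Y) * rs) (at x)"
      unfolding r_def[abs_def] by (auto intro!: derivative_eq_intros ds)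
    have dpr: "((\<lambda>x. p x * r x) has_real_derivative ((E x / Y) * ps * r x + (E x / Y) * rs * p x)) (at x)"
      by (rule DERIV_mult[OF dp dr])
    have de: "((\<lambda>x. exp (- S x / \<epsilon>)) has_real_derivative (b x / a x / \<epsilon>) * (1 / E x)) (at x)"
      using \<epsilon> by (auto intro!: derivative_eq_intros S_deriv simp: E(2)[symmetric])
    have dq: "((\<lambda>x. deriv u x / u x) has_real_derivative (deriv (deriv u) x * u x - deriv u x * deriv u x) / (u x * u x)) (at x)"
      by (intro DERIV_divide torus_C2_deriv torus_C2_deriv2 u un)
    have dlu: "((\<lambda>x. ln (u x)) has_real_derivative deriv u x / u x) (at x)"
      using torus_C2_deriv[OF u(1), of x] u(2)[of x] by (auto intro!: derivative_eq_intros)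
    have dlp: "((\<lambda>x. ln (p x)) has_real_derivative (E x / Y) * ps / p x) (at x)"
      using dp p_pos[OF x] by (auto intro!: derivative_eq_intros)
    have "(\<Theta> has_real_derivative
        - \<epsilon> * (((b x / a x / \<epsilon>) * (1 / E x) * (deriv u x / u x)
                 + (deriv (deriv u) x * u x - deriv u x * deriv u x) / (u x * u x) * exp (- S x / \<epsilon>)) * (p x * r x)
              + ((E x / Y) * ps * r x + (E x / Y) * rs * p x) * (exp (- S x / \<epsilon>) * (deriv u x / u x)))
        + \<epsilon> / Y * (j * (deriv u x / u x) + ps * rs * (E x / Y) - j * ((E x / Y) * ps / p x))) (at x)"
      (is "(_ has_real_derivative ?X) _")
      unfolding \<Theta>_def[abs_def]
      by (intro DERIV_add DERIV_diff DERIV_cmult DERIV_mult de dq dpr dlu ds dlp)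
    moreover have "?X = D x"
    proof -
      have g: "generator a b \<epsilon> u x / u x * (f x * gibbs \<epsilon> x)
         = ((b x / a x) * (deriv u x / u x) + \<epsilon> * (deriv (deriv u) x / u x)) * (p x * r x) * (1 / E x)"
        using a_nonzero[of x] un[of x] unfolding generator_def f gibbs_def E(2)
        by (simp add: field_simps)
      have q: "(deriv (deriv u) x * u x - deriv u x * deriv u x) / (u x * u x) = deriv (deriv u) x / u x - (deriv u x / u x)^2"
        using un[of x] by (simp add: field_simps power2_eq_square)
      have n: "- (generator a b \<epsilon> u x / u x) * (f x * gibbs \<epsilon> x) = - (generator a b \<epsilon> u x / u x * (f x * gibbs \<epsilon> x))" by simp
      show ?thesis unfolding D_def n g q j[of x] E(2) using \<epsilon>
        by (simp add: algebra_simps)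
    qed
    ultimately show ?thesis by simp
  qed
  have le_D: "- (generator a b \<epsilon> u x / u x) * (f x * gibbs \<epsilon> x) \<le> D x" if x: "x \<in> {m k..m (k + 1)}" for x
    unfolding D_def
    using tilted_completes_square[OF p_pos[OF x] r_nonneg[OF x] E(1) refl Y, of x "deriv u x / u x" ps rs] \<epsilon>
    by simp
  have "continuous_on UNIV f"
    unfolding f p_def r_def s_def by (intro continuous_intros continuous_crossing)
  then have "continuous_on UNIV (\<lambda>x. - (generator a b \<epsilon> u x / u x) * (f x * gibbs \<epsilon> x))"
    by (intro continuous_on_mult continuous_on_minus continuous_gibbs
        torus_continuousD(2)[OF torus_continuous_generator_div[OF a_C2 b_C2 u]])
  then have int: "(\<lambda>x. - (generator a b \<epsilon> u x / u x) * (f x * gibbs \<epsilon> x)) integrable_on {m k..m (k + 1)}"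
    by (intro integrable_continuous_interval) (auto intro: continuous_on_subset)
  have "(D has_integral (\<Theta> (m (k + 1)) - \<Theta> (m k))) {m k..m (k + 1)}"
    using m_le[of k "k + 1"] \<Theta>_deriv
    by (intro fundamental_theorem_of_calculus)
       (auto simp: has_real_derivative_iff_has_vector_derivative[symmetric] intro: has_field_derivative_at_within)
  then have "integral {m k..m (k + 1)} (\<lambda>x. - (generator a b \<epsilon> u x / u x) * (f x * gibbs \<epsilon> x)) \<le> \<Theta> (m (k + 1)) - \<Theta> (m k)"
    using le_D by (intro has_integral_le[OF integrable_integral[OF int]]) auto
  also have "\<Theta> (m (k + 1)) - \<Theta> (m k) = \<epsilon> * (exp (- S (m k) / \<epsilon>) * (deriv u (m k) / u (m k)) * \<alpha>
         - exp (- S (m (k + 1)) / \<epsilon>) * (deriv u (m (k + 1)) / u (m (k + 1))) * \<beta>)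
      + \<epsilon> / Y * (\<alpha> * (1 - exp w) + \<beta> * (1 - exp (- w)))
      + \<epsilon> / Y * j * (ln (u (m (k + 1))) - ln (u (m k)) - w)"
  proof -
    have 0: "s (m k) = 0" "s (m (k + 1)) = 1" by (simp_all add: s_def crossing_ends)
    then have 1: "p (m k) = 1" "r (m k) = \<alpha>" "p (m (k + 1)) = exp w" "p (m (k + 1)) * r (m (k + 1)) = \<beta>"
      using ee by (simp_all add: p_def r_def ps_def rs_def)
    have 2: "ps * rs = \<alpha> * (1 - exp w) + \<beta> * (1 - exp (- w))"
    proof -
      have "(W - 1) * (\<beta> * V - \<alpha>) = \<alpha> * (1 - W) + \<beta> * (1 - V)" if "W * V = 1" for V W :: real
        using that by algebra
      from this[OF ee] show ?thesis unfolding ps_def rs_def .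
    qed
    show ?thesis unfolding \<Theta>_def 1(4) unfolding 1(1-3) 0 2 by (simp add: algebra_simps add_divide_distrib)
  qed
  finally show ?thesis .
qed

end

context landscape
begin

section \<open>Recovery measures\<close>

lemma well_width: "m (k + 1) \<le> m k + 1"
  using m_le[of "k + 1" "k + int N"] N_pos m_shift[of k] by simp

text \<open>
  The profile leaves its value at the bottom of a well only as fast as the scale variable moves,
  and up to a constant the Gibbs weight at \<open>x\<close> is at most the inverse of the increment of the scale
  between the bottom and \<open>x\<close>, because \<open>S\<close> is largest at \<open>x\<close> there.
\<close>

lemma crossing_gibbs_le:
  assumes \<epsilon>: "\<epsilon> > 0"
  shows "x \<in> {m k..\<sigma> (k + 1)} \<Longrightarrow> crossing \<epsilon> k x * gibbs \<epsilon> x \<le> 1 / (c\<^sub>0 * saddle_int \<epsilon> k)"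
    and "x \<in> {\<sigma> (k + 1)..m (k + 1)} \<Longrightarrow> (1 - crossing \<epsilon> k x) * gibbs \<epsilon> x \<le> 1 / (c\<^sub>0 * saddle_int \<epsilon> k)"
proof -
  have Y: "saddle_int \<epsilon> k > 0" by (rule saddle_int_pos)
  have main: "d / saddle_int \<epsilon> k * gibbs \<epsilon> x \<le> 1 / (c\<^sub>0 * saddle_int \<epsilon> k)"
    if "d \<le> exp (S x / \<epsilon>)" "0 \<le> d" for d x
  proof -
    have "d * gibbs \<epsilon> x \<le> exp (S x / \<epsilon>) * gibbs \<epsilon> x"
      using that gibbs_pos[of \<epsilon> x] by (intro mult_right_mono) auto
    also have "\<dots> = 1 / a x" by (simp add: gibbs_def exp_minus)
    also have "\<dots> \<le> 1 / c\<^sub>0" using a_ge[of x] c0_pos by (intro divide_left_mono) (auto intro: a_pos)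
    finally have "d * gibbs \<epsilon> x / saddle_int \<epsilon> k \<le> 1 / c\<^sub>0 / saddle_int \<epsilon> k"
      using Y by (intro divide_right_mono) auto
    then show ?thesis by (simp add: mult.commute)
  qed
  have incr: "scale \<epsilon> y - scale \<epsilon> x \<le> C" if "x \<le> y" "y \<le> x + 1" "0 \<le> C" "\<And>z. z \<in> {x..y} \<Longrightarrow> exp (S z / \<epsilon>) \<le> C" for x y C
  proof -
    have "scale \<epsilon> y - scale \<epsilon> x = integral {x..y} (\<lambda>z. exp (S z / \<epsilon>))"
      by (rule integral_antiderivative[symmetric, OF scale_deriv that(1)])
    also have "\<dots> \<le> integral {x..y} (\<lambda>z. C)"
      using continuous_exp_S[of "{x..y}" 1 \<epsilon>] that by (intro integral_le integrable_continuous_interval) auto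
    also have "\<dots> = C * (y - x)" using that by simp
    also have "\<dots> \<le> C * 1" using that by (intro mult_left_mono) auto
    finally show ?thesis by simp
  qed
  show "crossing \<epsilon> k x * gibbs \<epsilon> x \<le> 1 / (c\<^sub>0 * saddle_int \<epsilon> k)" if x: "x \<in> {m k..\<sigma> (k + 1)}"
    unfolding crossing_def
  proof (rule main)
    have "S z \<le> S x" if "z \<in> {m k..x}" for z
      using S_increasing[of k z x] that x by (cases "z = x") auto
    then show "scale \<epsilon> x - scale \<epsilon> (m k) \<le> exp (S x / \<epsilon>)"
      using x \<epsilon> well_width[of k] \<sigma>_less_m[of "k + 1"] by (intro incr) (auto simp: divide_right_mono)
    show "0 \<le> scale \<epsilon> x - scale \<epsilon> (m k)" using x scale_le by auto
  qed
  show "(1 - crossing \<epsilon> k x) * gibbs \<epsilon> x \<le> 1 / (c\<^sub>0 * saddle_int \<epsilon> k)" if x: "x \<in> {\<sigma> (k + 1)..m (k + 1)}"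
  proof -
    have eq: "1 - crossing \<epsilon> k x = (scale \<epsilon> (m (k + 1)) - scale \<epsilon> x) / saddle_int \<epsilon> k"
      using Y by (simp add: crossing_def saddle_int_def field_simps)
    show ?thesis unfolding eq
    proof (rule main)
      have "S z \<le> S x" if "z \<in> {x..m (k + 1)}" for z
        using S_decreasing[of "k + 1" x z] that x by (cases "z = x") auto
      then show "scale \<epsilon> (m (k + 1)) - scale \<epsilon> x \<le> exp (S x / \<epsilon>)"
        using x \<epsilon> well_width[of k] m_less_\<sigma>[of "k"] by (intro incr) (auto simp: divide_right_mono)
      show "0 \<le> scale \<epsilon> (m (k + 1)) - scale \<epsilon> x" using x scale_le by auto
    qed
  qed
qed

text \<open>
  On each half of the edge the tilted density is compared with the Gibbs weight of the nearer well.
  The error is a multiple of the edge rates, hence exponentially small in the application.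
\<close>

lemma tilted_edge_mass:
  fixes g :: "real \<Rightarrow> real"
  assumes \<epsilon>: "\<epsilon> > 0" and ab: "0 \<le> \<alpha>" "0 \<le> \<beta>" and g: "continuous_on UNIV g" "\<And>x. \<bar>g x\<bar> \<le> K"
  shows "\<bar>integral {m k..m (k + 1)} (\<lambda>x. g x * (tilted \<alpha> \<beta> w (crossing \<epsilon> k x) * gibbs \<epsilon> x))
     - (\<alpha> * integral {m k..\<sigma> (k + 1)} (\<lambda>x. g x * gibbs \<epsilon> x) + \<beta> * integral {\<sigma> (k + 1)..m (k + 1)} (\<lambda>x. g x * gibbs \<epsilon> x))\<bar>
     \<le> K / c\<^sub>0 * ((2 * \<alpha> + 2 * \<beta> + \<alpha> * exp w + \<beta> * exp (- w)) / saddle_int \<epsilon> k)"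
proof -
  define f where "f x = tilted \<alpha> \<beta> w (crossing \<epsilon> k x)" for x
  define D where "D = 2 * \<alpha> + 2 * \<beta> + \<alpha> * exp w + \<beta> * exp (- w)"
  define C where "C = K / c\<^sub>0 * (D / saddle_int \<epsilon> k)"
  have D: "0 \<le> D" unfolding D_def using ab by simp
  have K: "0 \<le> K" using g(2)[of 0] by linarith
  have ord: "m k \<le> \<sigma> (k + 1)" "\<sigma> (k + 1) \<le> m (k + 1)"
    using m_less_\<sigma>[of k] \<sigma>_less_m[of "k + 1"] by auto
  have f_cont: "continuous_on A f" for A
    unfolding f_def tilted_def by (intro continuous_intros continuous_crossing)
  have g_cont: "continuous_on A g" for A using g(1) continuous_on_subset by blast
  have bound: "\<bar>integral {l..r} (\<lambda>x. g x * (f x * gibbs \<epsilon> x)) - \<gamma> * integral {l..r} (\<lambda>x. g x * gibbs \<epsilon> x)\<bar> \<le> C * (r - l)"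
    if lr: "l \<le> r" and t: "\<And>x. x \<in> {l..r} \<Longrightarrow> \<exists>t. 0 \<le> t \<and> \<bar>f x - \<gamma>\<bar> \<le> t * D \<and> t * gibbs \<epsilon> x \<le> 1 / (c\<^sub>0 * saddle_int \<epsilon> k)" for l r \<gamma>
  proof -
    have "integral {l..r} (\<lambda>x. g x * (f x * gibbs \<epsilon> x)) - \<gamma> * integral {l..r} (\<lambda>x. g x * gibbs \<epsilon> x)
      = integral {l..r} (\<lambda>x. g x * (f x * gibbs \<epsilon> x) - \<gamma> * (g x * gibbs \<epsilon> x))"
      unfolding integral_mult_right[symmetric]
      by (intro integral_diff[symmetric] integrable_continuous_interval continuous_intros f_cont g_cont continuous_gibbs)
    also have "\<bar>\<dots>\<bar> \<le> C * (r - l)"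
    proof -
      have "norm (g x * (f x * gibbs \<epsilon> x) - \<gamma> * (g x * gibbs \<epsilon> x)) \<le> C" if x: "x \<in> {l..r}" for x
      proof -
        obtain t where t: "0 \<le> t" "\<bar>f x - \<gamma>\<bar> \<le> t * D" "t * gibbs \<epsilon> x \<le> 1 / (c\<^sub>0 * saddle_int \<epsilon> k)"
          using t[OF x] by blast
        have "norm (g x * (f x * gibbs \<epsilon> x) - \<gamma> * (g x * gibbs \<epsilon> x)) = \<bar>g x\<bar> * (\<bar>f x - \<gamma>\<bar> * gibbs \<epsilon> x)"
        proof -
          have "g x * (f x * gibbs \<epsilon> x) - \<gamma> * (g x * gibbs \<epsilon> x) = g x * ((f x - \<gamma>) * gibbs \<epsilon> x)"
            by (simp add: algebra_simps)
          then show ?thesis using gibbs_pos[of \<epsilon> x] by (simp add: abs_mult)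
        qed
        also have "\<dots> \<le> K * ((t * D) * gibbs \<epsilon> x)"
          using g(2)[of x] t(1,2) gibbs_pos[of \<epsilon> x] K D by (intro mult_mono mult_nonneg_nonneg) auto
        also have "\<dots> = K * D * (t * gibbs \<epsilon> x)" by simp
        also have "\<dots> \<le> K * D * (1 / (c\<^sub>0 * saddle_int \<epsilon> k))"
          using t(3) K D by (intro mult_left_mono) auto
        finally show ?thesis by (simp add: C_def mult_ac)
      qed
      from integral_bound[OF lr _ this] show ?thesis
        by (simp add: continuous_intros f_cont g_cont continuous_gibbs)
    qed
    finally show ?thesis .
  qed
  have 1: "\<bar>integral {m k..\<sigma> (k + 1)} (\<lambda>x. g x * (f x * gibbs \<epsilon> x)) - \<alpha> * integral {m k..\<sigma> (k + 1)} (\<lambda>x. g x * gibbs \<epsilon> x)\<bar> \<le> C * (\<sigma> (k + 1) - m k)"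
  proof (rule bound[OF ord(1)])
    fix x assume x: "x \<in> {m k..\<sigma> (k + 1)}"
    then have "x \<in> {m k..m (k + 1)}" using ord by auto
    note cb = crossing_bounds[OF this, of \<epsilon>]
    show "\<exists>t. 0 \<le> t \<and> \<bar>f x - \<alpha>\<bar> \<le> t * D \<and> t * gibbs \<epsilon> x \<le> 1 / (c\<^sub>0 * saddle_int \<epsilon> k)"
      unfolding f_def D_def
      using tilted_near_0[OF ab cb, of w] cb crossing_gibbs_le(1)[OF \<epsilon> x] by blast
  qed
  have 2: "\<bar>integral {\<sigma> (k + 1)..m (k + 1)} (\<lambda>x. g x * (f x * gibbs \<epsilon> x)) - \<beta> * integral {\<sigma> (k + 1)..m (k + 1)} (\<lambda>x. g x * gibbs \<epsilon> x)\<bar> \<le> C * (m (k + 1) - \<sigma> (k + 1))"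
  proof (rule bound[OF ord(2)])
    fix x assume x: "x \<in> {\<sigma> (k + 1)..m (k + 1)}"
    then have "x \<in> {m k..m (k + 1)}" using ord by auto
    note cb = crossing_bounds[OF this, of \<epsilon>]
    show "\<exists>t. 0 \<le> t \<and> \<bar>f x - \<beta>\<bar> \<le> t * D \<and> t * gibbs \<epsilon> x \<le> 1 / (c\<^sub>0 * saddle_int \<epsilon> k)"
      unfolding f_def D_def
      using tilted_near_1[OF ab cb, of w] cb crossing_gibbs_le(2)[OF \<epsilon> x]
      by (intro exI[of _ "1 - crossing \<epsilon> k x"]) auto
  qed
  have "integral {m k..m (k + 1)} (\<lambda>x. g x * (f x * gibbs \<epsilon> x))
      = integral {m k..\<sigma> (k + 1)} (\<lambda>x. g x * (f x * gibbs \<epsilon> x)) + integral {\<sigma> (k + 1)..m (k + 1)} (\<lambda>x. g x * (f x * gibbs \<epsilon> x))"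
    using ord by (intro Henstock_Kurzweil_Integration.integral_combine[symmetric] integrable_continuous_interval continuous_intros f_cont g_cont continuous_gibbs)
  then have "\<bar>integral {m k..m (k + 1)} (\<lambda>x. g x * (f x * gibbs \<epsilon> x))
     - (\<alpha> * integral {m k..\<sigma> (k + 1)} (\<lambda>x. g x * gibbs \<epsilon> x) + \<beta> * integral {\<sigma> (k + 1)..m (k + 1)} (\<lambda>x. g x * gibbs \<epsilon> x))\<bar>
     \<le> C * (\<sigma> (k + 1) - m k) + C * (m (k + 1) - \<sigma> (k + 1))"
    using 1 2 by linarith
  also have "\<dots> = C * (m (k + 1) - m k)" by (simp add: algebra_simps)
  also have "\<dots> \<le> C * 1"
    using well_width[of k] K D saddle_int_pos[of \<epsilon> k] c0_pos unfolding C_def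
    by (intro mult_left_mono mult_nonneg_nonneg divide_nonneg_pos) auto
  finally show ?thesis by (simp add: f_def C_def D_def)
qed

text \<open>
  The weights \<open>\<alpha> k\<close> give well \<open>k\<close> the Gibbs mass \<open>v k\<close>. The tilt is optimal for the chain with the
  rates \<open>\<epsilon> / (well_int * saddle_int)\<close> at this \<open>\<epsilon>\<close>: it makes the current the same on all edges, so
  that the contributions of \<open>ln u\<close> to the edge bounds telescope around the circle. The functional \<open>I\<close>
  is the integral against the measure before normalisation.
\<close>

lemma recovery_measure:
  fixes v :: "int \<Rightarrow> real"
  assumes \<epsilon>: "\<epsilon> > 0" and v: "\<And>k. 0 < v k" and v_shift: "\<And>k. v (k + int N) = v k"
  defines "A \<equiv> \<lambda>k. v k * (\<epsilon> / (well_int \<epsilon> k * saddle_int \<epsilon> k))"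
    and "B \<equiv> \<lambda>k. v (k + 1) * (\<epsilon> / (well_int \<epsilon> (k + 1) * saddle_int \<epsilon> k))"
  shows "\<exists>M w I mass. M \<in> torus_prob \<and> (\<Sum>k\<in>{0..<int N}. w k) = 0 \<and> mass > 0
     \<and> rate_functional a b \<epsilon> M \<le> ereal ((\<Sum>k\<in>{0..<int N}. A k * (1 - exp (w k)) + B k * (1 - exp (- w k))) / mass)
     \<and> (\<forall>g\<in>torus_continuous. (\<integral>x. g x \<partial>M) = I g / mass)
     \<and> mass = I (\<lambda>_. 1)
     \<and> (\<forall>g K. g \<in> torus_continuous \<longrightarrow> (\<forall>x. \<bar>g x\<bar> \<le> K) \<longrightarrow>
          \<bar>I g - (\<Sum>k\<in>{0..<int N}. v k * (integral {\<sigma> k..\<sigma> (k + 1)} (\<lambda>x. g x * gibbs \<epsilon> x) / well_int \<epsilon> k))\<bar>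
            \<le> 3 * K / (c\<^sub>0 * \<epsilon>) * (\<Sum>k\<in>{0..<int N}. A k + B k))"
proof -
  let ?K = "{0..<int N}"
  define \<alpha> where "\<alpha> k = v k / well_int \<epsilon> k" for k
  have \<alpha>_pos: "0 < \<alpha> k" for k using v well_int_pos by (simp add: \<alpha>_def)
  have A: "A k = \<epsilon> * \<alpha> k / saddle_int \<epsilon> k" and B: "B k = \<epsilon> * \<alpha> (k + 1) / saddle_int \<epsilon> k" for k
    by (simp_all add: A_def B_def \<alpha>_def)
  have AB_pos: "0 < A k" "0 < B k" for k
    unfolding A B using \<epsilon> \<alpha>_pos saddle_int_pos by auto
  obtain w J where w0: "(\<Sum>k\<in>?K. w k) = 0" and J: "\<And>k. k \<in> ?K \<Longrightarrow> B k * exp (- w k) - A k * exp (w k) = J"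
    and le: "(\<Sum>k\<in>?K. A k * exp (w k) + B k * exp (- w k)) \<le> (\<Sum>k\<in>?K. A k + B k)"
    using chain_tilt_exists[of ?K A B] AB_pos by auto
  define \<rho> where "\<rho> k x = tilted (\<alpha> k) (\<alpha> (k + 1)) (w k) (crossing \<epsilon> k x) * gibbs \<epsilon> x" for k x
  define I where "I g = (\<Sum>k\<in>?K. integral {m k..m (k + 1)} (\<lambda>x. g x * \<rho> k x))" for g
  define mass where "mass = I (\<lambda>_. 1)"
  have \<rho>_cont: "continuous_on A (\<rho> k)" for A k
    unfolding \<rho>_def tilted_def by (intro continuous_intros continuous_crossing continuous_gibbs)
  have \<rho>_nonneg: "0 \<le> \<rho> k x" if "x \<in> {m k..m (k + 1)}" for k x
    unfolding \<rho>_def using crossing_bounds[OF that] gibbs_pos \<alpha>_pos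
    by (intro mult_nonneg_nonneg tilted_nonneg) (auto intro: less_imp_le)
  have piece_pos: "0 < integral {m k..m (k + 1)} (\<rho> k)" for k
    using m_less[of k "k + 1"] \<alpha>_pos[of k] gibbs_pos[of \<epsilon> "m k"]
    by (intro integral_pos_of_continuous[where z = "m k"] \<rho>_cont \<rho>_nonneg)
       (auto simp: \<rho>_def crossing_ends tilted_def)
  have mass_pos: "0 < mass"
    unfolding mass_def I_def using piece_pos N_pos by (intro sum_pos) auto
  obtain M where M: "M \<in> torus_prob" and M_int: "\<And>g. g \<in> torus_continuous \<Longrightarrow> (\<integral>x. g x \<partial>M) = I g / mass"
    by (rule torus_prob_of_pieces[of ?K m "\<lambda>k. m (k + 1)" \<rho> mass])
       (use \<rho>_cont \<rho>_nonneg mass_pos in \<open>auto simp: mass_def I_def\<close>)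
  have \<alpha>_shift: "\<alpha> (k + int N) = exp (- ((S 0 - S 1) / \<epsilon>)) * \<alpha> k" for k
    by (simp add: \<alpha>_def v_shift well_int_shift exp_minus field_simps)
  have "rate_functional a b \<epsilon> M \<le> ereal ((\<Sum>k\<in>?K. A k * (1 - exp (w k)) + B k * (1 - exp (- w k))) / mass)"
    unfolding rate_functional_def
  proof (rule SUP_least)
    fix u assume "u \<in> {u \<in> torus_C2. \<forall>x. 0 < u x}"
    then have u: "u \<in> torus_C2" "\<And>x. 0 < u x" by auto
    define T where "T k = exp (- S (m k) / \<epsilon>) * (deriv u (m k) / u (m k)) * \<alpha> k" for k
    define L where "L k = ln (u (m k))" for k
    have du: "deriv u (x + 1) = deriv u x" for x
      using torus_C2_deriv_torus_continuous(1)[OF u(1)] torus_continuousD(1) by blast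
    have ex: "exp (- (S (m k) - (S 0 - S 1)) / \<epsilon>) * exp (- ((S 0 - S 1) / \<epsilon>)) = exp (- S (m k) / \<epsilon>)" for k
      unfolding exp_add[symmetric] by (simp add: diff_divide_distrib add_divide_distrib)
    have T_shift: "T (k + int N) = T k" for k
    proof -
      have "T (k + int N) = (exp (- (S (m k) - (S 0 - S 1)) / \<epsilon>) * exp (- ((S 0 - S 1) / \<epsilon>))) * (deriv u (m k) / u (m k)) * \<alpha> k"
        unfolding T_def \<alpha>_shift S_shift_m unfolding m_shift du torus_C2_periodic[OF u(1)] by (simp only: mult_ac)
      then show ?thesis unfolding ex T_def .
    qed
    have L_shift: "L (k + int N) = L k" for k
      by (simp add: L_def m_shift torus_C2_periodic[OF u(1)])
    have "- (\<integral>x. generator a b \<epsilon> u x / u x \<partial>M) = (\<integral>x. - (generator a b \<epsilon> u x / u x) \<partial>M)"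
      by simp
    also have "\<dots> = I (\<lambda>x. - (generator a b \<epsilon> u x / u x)) / mass"
      using torus_continuous_generator_div[OF a_C2 b_C2 u]
      by (intro M_int) (auto simp: torus_continuous_def intro!: continuous_on_minus)
    finally have I_eq: "- (\<integral>x. generator a b \<epsilon> u x / u x \<partial>M) = I (\<lambda>x. - (generator a b \<epsilon> u x / u x)) / mass" .
    have "I (\<lambda>x. - (generator a b \<epsilon> u x / u x))
      \<le> (\<Sum>k\<in>?K. \<epsilon> * (T k - T (k + 1)) + (A k * (1 - exp (w k)) + B k * (1 - exp (- w k))) + J * (L (k + 1) - L k - w k))"
      unfolding I_def
    proof (intro sum_mono)
      fix k assume k: "k \<in> ?K"
      have "J = \<epsilon> / saddle_int \<epsilon> k * (\<alpha> (k + 1) * exp (- w k) - \<alpha> k * exp (w k))"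
        unfolding J[OF k, symmetric] A B by (simp add: right_diff_distrib)
      moreover have "A k * (1 - exp (w k)) + B k * (1 - exp (- w k))
          = \<epsilon> / saddle_int \<epsilon> k * (\<alpha> k * (1 - exp (w k)) + \<alpha> (k + 1) * (1 - exp (- w k)))"
        unfolding A B by (simp add: distrib_left)
      ultimately show "integral {m k..m (k + 1)} (\<lambda>x. - (generator a b \<epsilon> u x / u x) * \<rho> k x)
        \<le> \<epsilon> * (T k - T (k + 1)) + (A k * (1 - exp (w k)) + B k * (1 - exp (- w k))) + J * (L (k + 1) - L k - w k)"
        using edge_bound[OF u \<epsilon> less_imp_le[OF \<alpha>_pos[of k]] less_imp_le[OF \<alpha>_pos[of "k + 1"]], of k "w k"]
        unfolding \<rho>_def T_def L_def by simp
    qed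
    also have "\<dots> = \<epsilon> * ((\<Sum>k\<in>?K. T k) - (\<Sum>k\<in>?K. T (k + 1))) + (\<Sum>k\<in>?K. A k * (1 - exp (w k)) + B k * (1 - exp (- w k)))
         + J * ((\<Sum>k\<in>?K. L (k + 1)) - (\<Sum>k\<in>?K. L k) - (\<Sum>k\<in>?K. w k))"
      by (simp only: sum.distrib sum_subtractf sum_distrib_left[symmetric])
    also have "\<dots> = (\<Sum>k\<in>?K. A k * (1 - exp (w k)) + B k * (1 - exp (- w k)))"
      using sum_shift_periodic[of T, OF T_shift] sum_shift_periodic[of L, OF L_shift] w0 by simp
    finally show "ereal (- (\<integral>x. generator a b \<epsilon> u x / u x \<partial>M)) \<le> ereal ((\<Sum>k\<in>?K. A k * (1 - exp (w k)) + B k * (1 - exp (- w k))) / mass)"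
      unfolding I_eq using mass_pos by (simp add: divide_right_mono)
  qed
  moreover have "\<bar>I g - (\<Sum>k\<in>?K. v k * (integral {\<sigma> k..\<sigma> (k + 1)} (\<lambda>x. g x * gibbs \<epsilon> x) / well_int \<epsilon> k))\<bar>
            \<le> 3 * K / (c\<^sub>0 * \<epsilon>) * (\<Sum>k\<in>?K. A k + B k)"
    if g: "g \<in> torus_continuous" and gK: "\<And>x. \<bar>g x\<bar> \<le> K" for g K
  proof -
    have K: "0 \<le> K" using gK[of 0] by linarith
    define P where "P k = \<alpha> k * integral {m k..\<sigma> (k + 1)} (\<lambda>x. g x * gibbs \<epsilon> x)" for k
    define Q where "Q k = \<alpha> k * integral {\<sigma> k..m k} (\<lambda>x. g x * gibbs \<epsilon> x)" for k
    have Q_shift: "Q (k + int N) = Q k" for k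
      unfolding Q_def \<alpha>_shift m_shift \<sigma>_shift
      by (subst integral_gibbs_shift) (auto simp: torus_continuousD[OF g] exp_minus)
    have PQ: "P k + Q k = v k * (integral {\<sigma> k..\<sigma> (k + 1)} (\<lambda>x. g x * gibbs \<epsilon> x) / well_int \<epsilon> k)" for k
    proof -
      have "integral {\<sigma> k..m k} (\<lambda>x. g x * gibbs \<epsilon> x) + integral {m k..\<sigma> (k + 1)} (\<lambda>x. g x * gibbs \<epsilon> x)
        = integral {\<sigma> k..\<sigma> (k + 1)} (\<lambda>x. g x * gibbs \<epsilon> x)"
        using \<sigma>_less_m[of k] m_less_\<sigma>[of k]
        by (intro Henstock_Kurzweil_Integration.integral_combine integrable_continuous_interval continuous_intros torus_continuousD(2)[OF g] continuous_gibbs) auto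
      from this[symmetric] show ?thesis by (simp add: P_def Q_def \<alpha>_def distrib_left add_divide_distrib)
    qed
    have "(\<Sum>k\<in>?K. v k * (integral {\<sigma> k..\<sigma> (k + 1)} (\<lambda>x. g x * gibbs \<epsilon> x) / well_int \<epsilon> k)) = (\<Sum>k\<in>?K. P k + Q (k + 1))"
      unfolding PQ[symmetric] sum.distrib using sum_shift_periodic[of Q, OF Q_shift] by simp
    then have "\<bar>I g - (\<Sum>k\<in>?K. v k * (integral {\<sigma> k..\<sigma> (k + 1)} (\<lambda>x. g x * gibbs \<epsilon> x) / well_int \<epsilon> k))\<bar>
      = \<bar>\<Sum>k\<in>?K. integral {m k..m (k + 1)} (\<lambda>x. g x * \<rho> k x) - (P k + Q (k + 1))\<bar>"
      by (simp add: I_def sum_subtractf)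
    also have "\<dots> \<le> (\<Sum>k\<in>?K. \<bar>integral {m k..m (k + 1)} (\<lambda>x. g x * \<rho> k x) - (P k + Q (k + 1))\<bar>)"
      by (rule sum_abs)
    also have "\<dots> \<le> (\<Sum>k\<in>?K. K / (c\<^sub>0 * \<epsilon>) * (2 * (A k + B k) + (A k * exp (w k) + B k * exp (- w k))))"
    proof (intro sum_mono)
      fix k
      have "\<bar>integral {m k..m (k + 1)} (\<lambda>x. g x * \<rho> k x) - (P k + Q (k + 1))\<bar>
        \<le> K / c\<^sub>0 * ((2 * \<alpha> k + 2 * \<alpha> (k + 1) + \<alpha> k * exp (w k) + \<alpha> (k + 1) * exp (- w k)) / saddle_int \<epsilon> k)"
        unfolding \<rho>_def P_def Q_def
        by (intro tilted_edge_mass \<epsilon> less_imp_le[OF \<alpha>_pos] torus_continuousD(2)[OF g] gK)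
      also have "\<dots> = K / (c\<^sub>0 * \<epsilon>) * (2 * (A k + B k) + (A k * exp (w k) + B k * exp (- w k)))"
        unfolding A B using \<epsilon> c0_pos saddle_int_pos[of \<epsilon> k] by (simp add: field_simps)
      finally show "\<bar>integral {m k..m (k + 1)} (\<lambda>x. g x * \<rho> k x) - (P k + Q (k + 1))\<bar>
        \<le> K / (c\<^sub>0 * \<epsilon>) * (2 * (A k + B k) + (A k * exp (w k) + B k * exp (- w k)))" .
    qed
    also have "\<dots> = K / (c\<^sub>0 * \<epsilon>) * (2 * (\<Sum>k\<in>?K. A k + B k) + (\<Sum>k\<in>?K. A k * exp (w k) + B k * exp (- w k)))"
      by (simp only: sum_distrib_left[symmetric] sum.distrib)
    also have "\<dots> \<le> K / (c\<^sub>0 * \<epsilon>) * (2 * (\<Sum>k\<in>?K. A k + B k) + (\<Sum>k\<in>?K. A k + B k))"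
      using le K c0_pos \<epsilon> by (intro mult_left_mono add_left_mono) auto
    also have "\<dots> = 3 * K / (c\<^sub>0 * \<epsilon>) * (\<Sum>k\<in>?K. A k + B k)" by simp
    finally show ?thesis .
  qed
  ultimately show ?thesis
    using M w0 mass_pos M_int mass_def by blast
qed

end

section \<open>Convergence of the recovery measures\<close>

lemma sum_int_Suc:
  fixes w :: "int \<Rightarrow> real"
  assumes "0 \<le> k" shows "(\<Sum>i\<in>{0..<k + 1}. w i) = (\<Sum>i\<in>{0..<k}. w i) + w k"
proof -
  have "{0..<k + 1} = insert k {0..<k}" using assms by auto
  then show ?thesis by simp
qed

text \<open>
  A cyclic family of increments with sum zero is the family of increments of \<open>ln H\<close> for a positive
  function \<open>H\<close> on the states.
\<close>

lemma chain_rate_functional_ge_tilt: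
  fixes R :: "int \<Rightarrow> int \<Rightarrow> real" and \<omega> w :: "int \<Rightarrow> real"
  assumes N: "N \<ge> 1" and R: "\<And>k l. R (k + int N) (l + int N) = R k l" and \<omega>: "\<And>k. \<omega> (k + int N) = \<omega> k"
    and w: "(\<Sum>k\<in>{0..<int N}. w k) = 0"
  shows "ereal (\<Sum>k\<in>{0..<int N}. \<omega> k * R k (k + 1) * (1 - exp (w k)) + \<omega> (k + 1) * R (k + 1) k * (1 - exp (- w k)))
    \<le> chain_rate_functional R N \<omega>"
proof -
  let ?K = "{0..<int N}"
  define W where "W k = (\<Sum>i\<in>{0..<k}. w i)" for k
  define H where "H k = exp (W k)" for k
  have up: "W ((k + 1) mod int N) = W k + w k" if "k \<in> ?K" for k
  proof (cases "k + 1 = int N")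
    case True
    then show ?thesis using w sum_int_Suc[of k w] that by (simp add: W_def)
  next
    case False
    then show ?thesis using sum_int_Suc[of k w] that by (simp add: W_def)
  qed
  have down: "W ((k - 1) mod int N) = W k - w ((k - 1) mod int N)" if "k \<in> ?K" for k
  proof -
    have "((k - 1) mod int N + 1) mod int N = k mod int N" by (simp add: mod_simps)
    then show ?thesis using up[of "(k - 1) mod int N"] that N by auto
  qed
  define G where "G k = \<omega> k * R k (k - 1) * (1 - exp (- w ((k - 1) mod int N)))" for k
  have G_shift: "G (k + int N) = G k" for k
  proof -
    have "(k + int N - 1) mod int N = (k - 1) mod int N"
      by (metis add_diff_eq diff_add_eq mod_add_self2)
    moreover have "R (k + int N) (k + int N - 1) = R k (k - 1)"
      using R[of k "k - 1"] by (simp add: algebra_simps)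
    ultimately show ?thesis by (simp add: G_def \<omega>)
  qed
  have "- (chain_generator R N H k / H k * \<omega> k) = \<omega> k * R k (k + 1) * (1 - exp (w k)) + G k" if "k \<in> ?K" for k
  proof -
    have "H ((k + 1) mod int N) = H k * exp (w k)" "H ((k - 1) mod int N) = H k * exp (- w ((k - 1) mod int N))"
      unfolding H_def up[OF that] down[OF that] by (simp_all add: exp_add exp_diff exp_minus divide_inverse)
    then have "chain_generator R N H k = H k * (R k (k + 1) * (exp (w k) - 1) + R k (k - 1) * (exp (- w ((k - 1) mod int N)) - 1))"
      unfolding chain_generator_def by (simp add: algebra_simps)
    moreover have "H k \<noteq> 0" by (simp add: H_def)
    ultimately have eq: "chain_generator R N H k / H k = R k (k + 1) * (exp (w k) - 1) + R k (k - 1) * (exp (- w ((k - 1) mod int N)) - 1)"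
      by simp
    show ?thesis unfolding eq G_def by (simp add: algebra_simps)
  qed
  then have "- (\<Sum>k\<in>?K. chain_generator R N H k / H k * \<omega> k) = (\<Sum>k\<in>?K. \<omega> k * R k (k + 1) * (1 - exp (w k)) + G k)"
    unfolding sum_negf[symmetric] by (intro sum.cong) auto
  also have "\<dots> = (\<Sum>k\<in>?K. \<omega> k * R k (k + 1) * (1 - exp (w k)) + G (k + 1))"
    unfolding sum.distrib using sum_shift_periodic[of G, OF G_shift] by simp
  also have "\<dots> = (\<Sum>k\<in>?K. \<omega> k * R k (k + 1) * (1 - exp (w k)) + \<omega> (k + 1) * R (k + 1) k * (1 - exp (- w k)))"
    by (intro sum.cong refl) (simp add: G_def)
  finally show ?thesis
    unfolding chain_rate_functional_def
    by (intro SUP_upper2[of H]) (auto simp: H_def)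
qed

lemma sing_sets_torus: "x \<in> {0..<1} \<Longrightarrow> {x} \<in> sets torus"
  by (auto simp: torus_def sets_restrict_space image_iff intro!: exI[of _ "{x}"])

lemma space_torus: "space torus = {0..<1}"
  by (simp add: torus_def space_restrict_space)

lemma AE_finite_support_integral:
  fixes g :: "real \<Rightarrow> real"
  assumes \<mu>: "\<mu> \<in> torus_prob" and P: "finite K" "inj_on p K" "\<And>k. k \<in> K \<Longrightarrow> p k \<in> {0..<1}"
    and AE: "AE x in \<mu>. x \<in> p ` K" and g: "g \<in> torus_continuous"
  shows "(\<integral>x. g x \<partial>\<mu>) = (\<Sum>k\<in>K. measure \<mu> {p k} * g (p k))"
proof -
  interpret prob_space \<mu> using \<mu> by (simp add: torus_prob_def)
  have sets: "{p k} \<in> sets \<mu>" if "k \<in> K" for k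
    using \<mu> sing_sets_torus P(3)[OF that] by (simp add: torus_prob_def)
  have "(\<integral>x. g x \<partial>\<mu>) = (\<integral>x. (\<Sum>k\<in>K. g (p k) * indicator {p k} x) \<partial>\<mu>)"
  proof (rule integral_cong_AE)
    show "g \<in> borel_measurable \<mu>" by (rule torus_prob_measurable[OF \<mu> g])
    show "(\<lambda>x. \<Sum>k\<in>K. g (p k) * indicator {p k} x) \<in> borel_measurable \<mu>"
      using sets by (intro borel_measurable_sum borel_measurable_times borel_measurable_const borel_measurable_indicator)
    show "AE x in \<mu>. g x = (\<Sum>k\<in>K. g (p k) * indicator {p k} x)"
      using AE
    proof eventually_elim
      case (elim x)
      then obtain k where k: "k \<in> K" "x = p k" by auto
      have "(\<Sum>j\<in>K. g (p j) * indicator {p j} x) = (\<Sum>j\<in>K. if j = k then g (p k) else 0)"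
        using k P(2) by (intro sum.cong refl) (auto simp: inj_on_def indicator_def)
      then show ?case using k P(1) by simp
    qed
  qed
  also have "\<dots> = (\<Sum>k\<in>K. g (p k) * measure \<mu> {p k})"
    using sets by (subst Bochner_Integration.integral_sum) (auto simp: emeasure_eq_measure)
  finally show ?thesis by (simp add: mult.commute)
qed

lemma is_dirac_sum_AE:
  assumes "is_dirac_sum N p \<omega> \<mu>" and p: "\<And>k. k \<in> {0..<int N} \<Longrightarrow> p k \<in> {0..<1}"
  shows "AE x in \<mu>. x \<in> p ` {0..<int N}"
proof (rule AE_I')
  let ?P = "p ` {0..<int N}"
  have "(\<Union>k\<in>{0..<int N}. {p k}) \<in> sets torus"
    using p by (intro sets.finite_UN sing_sets_torus) auto
  then have "?P \<in> sets torus" by (simp add: UNION_singleton_eq_range)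
  then have A: "space torus - ?P \<in> sets torus" by auto
  have "emeasure \<mu> (space torus - ?P) = (\<Sum>k\<in>{0..<int N}. ennreal (\<omega> k) * emeasure (return torus (p k)) (space torus - ?P))"
    using assms(1) A unfolding is_dirac_sum_def by blast
  also have "\<dots> = 0" using A by (intro sum.neutral ballI) (auto simp: indicator_def)
  finally show "space torus - ?P \<in> null_sets \<mu>"
    using assms(1) A by (simp add: is_dirac_sum_def null_sets_def)
  have "space \<mu> = space torus" using assms(1) unfolding is_dirac_sum_def by (intro sets_eq_imp_space_eq) blast
  then show "{x \<in> space \<mu>. x \<notin> ?P} \<subseteq> space torus - ?P" by auto
qed

lemma is_dirac_sumI:
  assumes \<mu>: "\<mu> \<in> torus_prob" and P: "inj_on p {0..<int N}" "\<And>k. k \<in> {0..<int N} \<Longrightarrow> p k \<in> {0..<1}"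
    and AE: "AE x in \<mu>. x \<in> p ` {0..<int N}"
  shows "prob_vector N (\<lambda>k. measure \<mu> {p k})" "is_dirac_sum N p (\<lambda>k. measure \<mu> {p k}) \<mu>"
proof -
  let ?K = "{0..<int N}"
  interpret prob_space \<mu> using \<mu> by (simp add: torus_prob_def)
  have sets_eq: "sets \<mu> = sets torus" using \<mu> by (simp add: torus_prob_def)
  have emeasure_A: "emeasure \<mu> A = (\<Sum>k\<in>?K. ennreal (measure \<mu> {p k}) * emeasure (return torus (p k)) A)"
    if A: "A \<in> sets torus" for A
  proof -
    have sets: "{p k} \<in> sets \<mu>" if "k \<in> ?K" for k
      using sets_eq sing_sets_torus P(2)[OF that] by simp
    let ?J = "{k \<in> ?K. p k \<in> A}"
    have fin_J: "finite ?J" by (rule finite_subset[of _ ?K]) auto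
    have "emeasure \<mu> A = emeasure \<mu> (\<Union>k\<in>?J. {p k})"
    proof (rule emeasure_eq_AE)
      show "AE x in \<mu>. (x \<in> A) = (x \<in> (\<Union>k\<in>?J. {p k}))"
        using AE by eventually_elim auto
    qed (use A sets_eq sets in auto)
    also have "\<dots> = (\<Sum>k\<in>?J. emeasure \<mu> {p k})"
      using fin_J P(1) sets by (subst sum_emeasure) (auto simp: disjoint_family_on_def inj_on_def)
    also have "\<dots> = (\<Sum>k\<in>?K. if p k \<in> A then emeasure \<mu> {p k} else 0)"
      by (subst sum.inter_filter[symmetric]) auto
    also have "\<dots> = (\<Sum>k\<in>?K. ennreal (measure \<mu> {p k}) * emeasure (return torus (p k)) A)"
      using A by (intro sum.cong refl) (auto simp: emeasure_eq_measure)
    finally show ?thesis .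
  qed
  then show "is_dirac_sum N p (\<lambda>k. measure \<mu> {p k}) \<mu>"
    using sets_eq by (simp add: is_dirac_sum_def)
  have "ennreal 1 = emeasure \<mu> (space torus)"
    using emeasure_space_1 sets_eq_imp_space_eq[OF sets_eq] by simp
  also have "\<dots> = (\<Sum>k\<in>?K. ennreal (measure \<mu> {p k}))"
    unfolding emeasure_A[OF sets.top] emeasure_return[OF sets.top]
    using P(2) by (intro sum.cong refl) (auto simp: space_torus)
  also have "\<dots> = ennreal (\<Sum>k\<in>?K. measure \<mu> {p k})"
    by (rule sum_ennreal) simp
  finally have "(\<Sum>k\<in>?K. measure \<mu> {p k}) = 1"
    by (subst (asm) ennreal_inj) (auto intro: sum_nonneg)
  then show "prob_vector N (\<lambda>k. measure \<mu> {p k})" by (simp add: prob_vector_def)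
qed

lemma exp_neg_inverse_over_tendsto:
  fixes h :: real assumes "h > 0"
  shows "((\<lambda>\<epsilon>. exp (- h / \<epsilon>) / \<epsilon>) \<longlongrightarrow> 0) (at_right 0)"
proof -
  have "filterlim (\<lambda>\<epsilon>. h * inverse \<epsilon>) at_top (at_right 0)"
    using assms by (intro filterlim_tendsto_pos_mult_at_top[OF tendsto_const _ filterlim_inverse_at_top_right])
  from filterlim_compose[OF tendsto_power_div_exp_0[of 1] this]
  have "((\<lambda>\<epsilon>. (h * inverse \<epsilon>) / exp (h * inverse \<epsilon>) / h) \<longlongrightarrow> 0 / h) (at_right 0)"
    using assms by (intro tendsto_intros) auto
  then show ?thesis using assms by (simp add: exp_minus field_simps)
qed

context landscape
begin

lemma inj_on_frac_m: "inj_on (\<lambda>k. frac (m k)) {0..<int N}"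
proof (rule inj_onI)
  fix k l assume kl: "k \<in> {0..<int N}" "l \<in> {0..<int N}" "frac (m k) = frac (m l)"
  have "m i < m j + 1" if "i \<in> {0..<int N}" "j \<in> {0..<int N}" for i j
    using m_less[of i "0 + int N"] m_le[of 0 j] m_shift[of 0] that by auto
  from this[OF kl(1,2)] this[OF kl(2,1)] have "\<bar>m k - m l\<bar> < 1" by (simp add: abs_less_iff)
  moreover have "m k - m l = of_int (\<lfloor>m k\<rfloor> - \<lfloor>m l\<rfloor>)" using kl(3) by (simp add: frac_def)
  moreover have "of_int n = (0::real)" if "\<bar>of_int n :: real\<bar> < 1" for n :: int
    using that by (simp flip: of_int_abs)
  ultimately have "m k = m l" by (metis eq_iff_diff_eq_0)
  then show "k = l" using m_less[of k l] m_less[of l k] by (cases k l rule: linorder_cases) auto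
qed

lemma frac_m_in: "frac (m k) \<in> {0..<1}"
  by (simp add: frac_lt_1)

lemma dirac_sum_integral:
  assumes "\<mu> \<in> torus_prob" "prob_vector N \<omega>" "is_dirac_sum N (\<lambda>k. frac (m k)) \<omega> \<mu>" "g \<in> torus_continuous"
  shows "(\<integral>x. g x \<partial>\<mu>) = (\<Sum>k\<in>{0..<int N}. \<omega> k * g (m k))"
proof -
  have "(\<integral>x. g x \<partial>\<mu>) = (\<Sum>k\<in>{0..<int N}. measure \<mu> {frac (m k)} * g (frac (m k)))"
    using assms frac_m_in by (intro AE_finite_support_integral is_dirac_sum_AE inj_on_frac_m) auto
  also have "\<dots> = (\<Sum>k\<in>{0..<int N}. \<omega> k * g (m k))"
    using dirac_sum_weight[OF assms(2,3) inj_on_frac_m frac_m_in] periodic_frac[of g, OF torus_continuousD(1)[OF assms(4)]]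
    by (intro sum.cong) auto
  finally show ?thesis .
qed

lemma well_concentration:
  assumes "g \<in> torus_continuous"
  shows "((\<lambda>\<epsilon>. integral {\<sigma> k..\<sigma> (k + 1)} (\<lambda>x. g x * gibbs \<epsilon> x) / well_int \<epsilon> k) \<longlongrightarrow> g (m k)) (at_right 0)"
proof -
  have 1: "((\<lambda>\<epsilon>. integral {\<sigma> k..\<sigma> (k + 1)} (\<lambda>x. g x * gibbs \<epsilon> x) * exp (S (m k) / \<epsilon>) / sqrt \<epsilon>) \<longlongrightarrow> g (m k) * well_weight a S m k) (at_right 0)"
    using well_laplace[of "\<lambda>x. g x / a x" k] torus_continuousD(2)[OF assms]
    by (simp add: well_weight_def gibbs_def[abs_def] a_nonzero continuous_intros)
  have "((\<lambda>\<epsilon>. (integral {\<sigma> k..\<sigma> (k + 1)} (\<lambda>x. g x * gibbs \<epsilon> x) * exp (S (m k) / \<epsilon>) / sqrt \<epsilon>)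
      / (well_int \<epsilon> k * exp (S (m k) / \<epsilon>) / sqrt \<epsilon>)) \<longlongrightarrow> g (m k) * well_weight a S m k / well_weight a S m k) (at_right 0)"
    using well_weight_pos[of k] by (intro tendsto_divide 1 well_int_asymp) simp
  then have "((\<lambda>\<epsilon>. (integral {\<sigma> k..\<sigma> (k + 1)} (\<lambda>x. g x * gibbs \<epsilon> x) * exp (S (m k) / \<epsilon>) / sqrt \<epsilon>)
      / (well_int \<epsilon> k * exp (S (m k) / \<epsilon>) / sqrt \<epsilon>)) \<longlongrightarrow> g (m k)) (at_right 0)"
    using well_weight_pos[of k] by simp
  then show ?thesis
    by (rule Lim_transform_eventually) (use eventually_at_right_less[of 0] in eventually_elim, simp)
qed

text \<open>
  Adding \<open>\<epsilon>\<close> to all weights makes them positive, as the tilt requires, without changing the limit. The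
  tilts \<open>w \<epsilon>\<close> may diverge on edges whose limiting rates vanish. Their convergence is
  avoided: the rates at \<open>\<epsilon>\<close> are eventually at least \<open>1 - \<delta>\<close> times the limiting rates, and the excess
  enters with a factor \<open>1 - exp w \<le> 1\<close>. The remaining part is bounded by the chain functional for
  the limiting rates, whatever the tilt.
\<close>

lemma recovery_sequence:
  assumes \<mu>: "\<mu> \<in> torus_prob" and \<omega>: "prob_vector N \<omega>" "is_dirac_sum N (\<lambda>k. frac (m k)) \<omega> \<mu>"
  shows "\<exists>M. (\<forall>\<epsilon>>0. M \<epsilon> \<in> torus_prob) \<and> torus_weak_conv M \<mu> (at_right 0) \<and>
    Limsup (at_right 0) (\<lambda>\<epsilon>. ereal (exp (\<h> / \<epsilon>)) * rate_functional a b \<epsilon> (M \<epsilon>))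
      \<le> chain_rate_functional (jump_rate a S m \<sigma>) N \<omega>"
proof -
  let ?K = "{0..<int N}" and ?R = "jump_rate a S m \<sigma>"
  define \<omega>' where "\<omega>' k = \<omega> (k mod int N)" for k
  have \<omega>'_shift: "\<omega>' (k + int N) = \<omega>' k" for k by (simp add: \<omega>'_def)
  have \<omega>'_eq: "\<omega>' k = \<omega> k" if "k \<in> ?K" for k using that by (simp add: \<omega>'_def)
  have \<omega>'_nonneg: "0 \<le> \<omega>' k" for k
    using \<omega>(1) N_pos by (simp add: \<omega>'_def prob_vector_def)
  have \<omega>'_sum: "(\<Sum>k\<in>?K. \<omega>' k) = 1" using \<omega>(1) \<omega>'_eq by (simp add: prob_vector_def)
  define v where "v \<epsilon> k = (\<omega>' k + \<epsilon>) / (1 + real N * \<epsilon>)" for \<epsilon> k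
  have v_pos: "0 < v \<epsilon> k" if "\<epsilon> > 0" for \<epsilon> k
    unfolding v_def using \<omega>'_nonneg[of k] that by (intro divide_pos_pos add_nonneg_pos add_pos_nonneg) auto
  have v_lim: "((\<lambda>\<epsilon>. v \<epsilon> k) \<longlongrightarrow> \<omega>' k) (at_right 0)" for k
    unfolding v_def by (rule tendsto_eq_intros refl | simp)+
  define A where "A \<epsilon> k = v \<epsilon> k * (\<epsilon> / (well_int \<epsilon> k * saddle_int \<epsilon> k))" for \<epsilon> k
  define B where "B \<epsilon> k = v \<epsilon> (k + 1) * (\<epsilon> / (well_int \<epsilon> (k + 1) * saddle_int \<epsilon> k))" for \<epsilon> k
  define J where "J \<epsilon> g = (\<Sum>k\<in>?K. v \<epsilon> k * (integral {\<sigma> k..\<sigma> (k + 1)} (\<lambda>x. g x * gibbs \<epsilon> x) / well_int \<epsilon> k))" for \<epsilon> g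
  define Q where "Q \<epsilon> M w I mass \<longleftrightarrow> M \<in> torus_prob \<and> (\<Sum>k\<in>?K. w k) = 0 \<and> mass > 0
     \<and> rate_functional a b \<epsilon> M \<le> ereal ((\<Sum>k\<in>?K. A \<epsilon> k * (1 - exp (w k)) + B \<epsilon> k * (1 - exp (- w k))) / mass)
     \<and> (\<forall>g\<in>torus_continuous. (\<integral>x. g x \<partial>M) = I g / mass)
     \<and> mass = I (\<lambda>_. 1)
     \<and> (\<forall>g K. g \<in> torus_continuous \<longrightarrow> (\<forall>x. \<bar>g x\<bar> \<le> K) \<longrightarrow>
          \<bar>I g - J \<epsilon> g\<bar> \<le> 3 * K / (c\<^sub>0 * \<epsilon>) * (\<Sum>k\<in>?K. A \<epsilon> k + B \<epsilon> k))" for \<epsilon> M w I and mass :: real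
  have "\<exists>M w I mass. Q \<epsilon> M w I mass" if "\<epsilon> > 0" for \<epsilon>
    unfolding Q_def A_def B_def J_def
    using that by (intro recovery_measure v_pos) (auto simp: v_def \<omega>'_shift)
  then obtain M w I mass where Q: "\<And>\<epsilon>. \<epsilon> > 0 \<Longrightarrow> Q \<epsilon> (M \<epsilon>) (w \<epsilon>) (I \<epsilon>) (mass \<epsilon>)"
    by metis
  have pos: "eventually (\<lambda>\<epsilon>. 0 < \<epsilon>) (at_right (0::real))" by (rule eventually_at_right_less)

  have A_lim: "((\<lambda>\<epsilon>. exp (\<h> / \<epsilon>) * A \<epsilon> k) \<longlongrightarrow> \<omega>' k * ?R k (k + 1)) (at_right 0)" for k
    using tendsto_mult[OF v_lim[of k] rate_right_limit[of k]] by (simp add: A_def mult_ac)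
  have B_lim: "((\<lambda>\<epsilon>. exp (\<h> / \<epsilon>) * B \<epsilon> k) \<longlongrightarrow> \<omega>' (k + 1) * ?R (k + 1) k) (at_right 0)" for k
    using tendsto_mult[OF v_lim[of "k + 1"] rate_left_limit[of k]] by (simp add: B_def mult_ac)
  have err: "((\<lambda>\<epsilon>. C / (c\<^sub>0 * \<epsilon>) * (\<Sum>k\<in>?K. A \<epsilon> k + B \<epsilon> k)) \<longlongrightarrow> 0) (at_right 0)" for C
  proof -
    have "((\<lambda>\<epsilon>. C / c\<^sub>0 * (exp (- \<h> / \<epsilon>) / \<epsilon>) * (\<Sum>k\<in>?K. exp (\<h> / \<epsilon>) * A \<epsilon> k + exp (\<h> / \<epsilon>) * B \<epsilon> k))
      \<longlongrightarrow> C / c\<^sub>0 * 0 * (\<Sum>k\<in>?K. \<omega>' k * ?R k (k + 1) + \<omega>' (k + 1) * ?R (k + 1) k)) (at_right 0)"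
      by (intro tendsto_intros exp_neg_inverse_over_tendsto min_barrier_pos A_lim B_lim)
    moreover have "C / c\<^sub>0 * (exp (- \<h> / \<epsilon>) / \<epsilon>) * (\<Sum>k\<in>?K. exp (\<h> / \<epsilon>) * A \<epsilon> k + exp (\<h> / \<epsilon>) * B \<epsilon> k)
       = C / (c\<^sub>0 * \<epsilon>) * (\<Sum>k\<in>?K. A \<epsilon> k + B \<epsilon> k)" for \<epsilon>
      by (simp add: distrib_left[symmetric] sum_distrib_left[symmetric] exp_minus)
    ultimately show ?thesis by (simp only: mult_zero_left mult_zero_right)
  qed
  have I_lim: "((\<lambda>\<epsilon>. I \<epsilon> g) \<longlongrightarrow> (\<Sum>k\<in>?K. \<omega>' k * g (m k))) (at_right 0)" if g: "g \<in> torus_continuous" for g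
  proof -
    obtain C where C: "\<And>x. \<bar>g x\<bar> \<le> C" using torus_continuous_bounded[OF g] by blast
    have "((\<lambda>\<epsilon>. I \<epsilon> g - J \<epsilon> g) \<longlongrightarrow> 0) (at_right 0)"
    proof (rule Lim_null_comparison[OF _ err])
      show "\<forall>\<^sub>F \<epsilon> in at_right 0. norm (I \<epsilon> g - J \<epsilon> g) \<le> (3 * C) / (c\<^sub>0 * \<epsilon>) * (\<Sum>k\<in>?K. A \<epsilon> k + B \<epsilon> k)"
        using pos by eventually_elim (use Q g C in \<open>simp add: Q_def\<close>)
    qed
    moreover have "((\<lambda>\<epsilon>. J \<epsilon> g) \<longlongrightarrow> (\<Sum>k\<in>?K. \<omega>' k * g (m k))) (at_right 0)"
      unfolding J_def by (intro tendsto_sum tendsto_mult v_lim well_concentration g)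
    ultimately have "((\<lambda>\<epsilon>. (I \<epsilon> g - J \<epsilon> g) + J \<epsilon> g) \<longlongrightarrow> 0 + (\<Sum>k\<in>?K. \<omega>' k * g (m k))) (at_right 0)"
      by (rule tendsto_add)
    then show ?thesis by simp
  qed
  have one: "(\<lambda>_. 1) \<in> torus_continuous" by (simp add: torus_continuous_def)
  have mass_lim: "(mass \<longlongrightarrow> 1) (at_right 0)"
  proof -
    have "((\<lambda>\<epsilon>. I \<epsilon> (\<lambda>_. 1)) \<longlongrightarrow> 1) (at_right 0)" using I_lim[OF one] \<omega>'_sum by simp
    then show ?thesis
      by (rule Lim_transform_eventually) (use pos in eventually_elim, use Q in \<open>simp add: Q_def\<close>)
  qed
  have "torus_weak_conv M \<mu> (at_right 0)"
    unfolding torus_weak_conv_def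
  proof
    fix g assume g: "g \<in> torus_continuous"
    have "((\<lambda>\<epsilon>. I \<epsilon> g / mass \<epsilon>) \<longlongrightarrow> (\<Sum>k\<in>?K. \<omega>' k * g (m k)) / 1) (at_right 0)"
      by (intro tendsto_divide I_lim g mass_lim) simp
    moreover have "(\<Sum>k\<in>?K. \<omega>' k * g (m k)) / 1 = (\<integral>x. g x \<partial>\<mu>)"
      using dirac_sum_integral[OF \<mu> \<omega> g] \<omega>'_eq by simp
    ultimately show "((\<lambda>\<epsilon>. \<integral>x. g x \<partial>M \<epsilon>) \<longlongrightarrow> (\<integral>x. g x \<partial>\<mu>)) (at_right 0)"
      by (auto elim!: Lim_transform_eventually intro: eventually_mono[OF pos] simp: Q[unfolded Q_def] g)
  qed
  moreover have "Limsup (at_right 0) (\<lambda>\<epsilon>. ereal (exp (\<h> / \<epsilon>)) * rate_functional a b \<epsilon> (M \<epsilon>))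
      \<le> chain_rate_functional ?R N \<omega>"
  proof -
    define A0 where "A0 k = \<omega>' k * ?R k (k + 1)" for k
    define B0 where "B0 k = \<omega>' (k + 1) * ?R (k + 1) k" for k
    have R_nonneg: "0 \<le> ?R k l" for k l
    proof -
      have "0 \<le> well_weight a S m k" using well_weight_pos[of k] by simp
      moreover have "0 \<le> saddle_weight S \<sigma> k l"
        unfolding saddle_weight_def using curvature_\<sigma>[of "max k l"]
        by (intro real_sqrt_ge_zero divide_nonneg_pos) auto
      ultimately show ?thesis by (simp add: jump_rate_def)
    qed
    have AB0: "0 \<le> A0 k" "0 \<le> B0 k" for k by (simp_all add: A0_def B0_def \<omega>'_nonneg R_nonneg)
    have \<omega>\<omega>': "chain_rate_functional ?R N \<omega> = chain_rate_functional ?R N \<omega>'"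
      unfolding chain_rate_functional_def using \<omega>'_eq by simp
    have tilt: "ereal (\<Sum>k\<in>?K. A0 k * (1 - exp (w k)) + B0 k * (1 - exp (- w k))) \<le> chain_rate_functional ?R N \<omega>"
      if "(\<Sum>k\<in>?K. w k) = 0" for w
      unfolding \<omega>\<omega>' A0_def B0_def
      by (intro chain_rate_functional_ge_tilt N_pos jump_rate_shift \<omega>'_shift that)
    show ?thesis
    proof (cases "chain_rate_functional ?R N \<omega>")
      case (real X)
      have X: "(\<Sum>k\<in>?K. A0 k * (1 - exp (w k)) + B0 k * (1 - exp (- w k))) \<le> X" if "(\<Sum>k\<in>?K. w k) = 0" for w
        using tilt[OF that] real by simp
      have "Limsup (at_right 0) (\<lambda>\<epsilon>. ereal (exp (\<h> / \<epsilon>)) * rate_functional a b \<epsilon> (M \<epsilon>)) \<le> ereal X + ereal e"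
        if e: "e > 0" for e
      proof -
        define T where "T = (\<Sum>k\<in>?K. A0 k + B0 k)"
        have T: "0 \<le> T" unfolding T_def using AB0 by (intro sum_nonneg) auto
        have X0: "0 \<le> X" using X[of "\<lambda>_. 0"] by simp
        define \<delta> where "\<delta> = min (1/2) (e / (2 * (T + 1)))"
        have \<delta>: "0 < \<delta>" "\<delta> < 1" "\<delta> * T < e"
        proof -
          show "0 < \<delta>" "\<delta> < 1" using e T by (auto simp: \<delta>_def)
          have "\<delta> * T \<le> e / (2 * (T + 1)) * T" unfolding \<delta>_def using T by (intro mult_right_mono) auto
          also have "\<dots> < e" using e T by (simp add: field_simps add_nonneg_pos)
          finally show "\<delta> * T < e" .
        qed
        define Ah where "Ah \<epsilon> k = exp (\<h> / \<epsilon>) * A \<epsilon> k" for \<epsilon> k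
        define Bh where "Bh \<epsilon> k = exp (\<h> / \<epsilon>) * B \<epsilon> k" for \<epsilon> k
        define U where "U \<epsilon> = ((1 - \<delta>) * X + (\<Sum>k\<in>?K. (Ah \<epsilon> k - (1 - \<delta>) * A0 k) + (Bh \<epsilon> k - (1 - \<delta>) * B0 k))) / mass \<epsilon>" for \<epsilon>
        have "(U \<longlongrightarrow> ((1 - \<delta>) * X + (\<Sum>k\<in>?K. (A0 k - (1 - \<delta>) * A0 k) + (B0 k - (1 - \<delta>) * B0 k))) / 1) (at_right 0)"
          unfolding U_def Ah_def Bh_def A0_def B0_def by (intro tendsto_intros A_lim B_lim mass_lim) simp
        also have "((1 - \<delta>) * X + (\<Sum>k\<in>?K. (A0 k - (1 - \<delta>) * A0 k) + (B0 k - (1 - \<delta>) * B0 k))) / 1 = (1 - \<delta>) * X + \<delta> * T"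
          by (simp add: T_def sum_distrib_left algebra_simps)
        finally have U_lim: "(U \<longlongrightarrow> (1 - \<delta>) * X + \<delta> * T) (at_right 0)" .
        have "(1 - \<delta>) * X + \<delta> * T < X + e"
        proof -
          have "0 \<le> \<delta> * X" using \<delta> X0 by simp
          then show ?thesis using \<delta>(3) unfolding left_diff_distrib by linarith
        qed
        from order_tendstoD(2)[OF U_lim this]
        have "eventually (\<lambda>\<epsilon>. U \<epsilon> < X + e) (at_right 0)" .
        moreover have lower: "eventually (\<lambda>\<epsilon>. \<forall>k\<in>?K. (1 - \<delta>) * f k \<le> fh \<epsilon> k) (at_right 0)"
          if "\<And>k. 0 \<le> f k" "\<And>k. ((\<lambda>\<epsilon>. fh \<epsilon> k) \<longlongrightarrow> f k) (at_right 0)" "\<And>\<epsilon> k. \<epsilon> > 0 \<Longrightarrow> 0 \<le> fh \<epsilon> k" for f :: "int \<Rightarrow> real" and fh :: "real \<Rightarrow> int \<Rightarrow> real"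
        proof (rule eventually_ball_finite)
          show "\<forall>k\<in>?K. \<forall>\<^sub>F \<epsilon> in at_right 0. (1 - \<delta>) * f k \<le> fh \<epsilon> k"
          proof
            fix k
            show "\<forall>\<^sub>F \<epsilon> in at_right 0. (1 - \<delta>) * f k \<le> fh \<epsilon> k"
            proof (cases "f k = 0")
              case True
              show ?thesis using pos by eventually_elim (use True that(3) in simp)
            next
              case False
              then have "(1 - \<delta>) * f k < f k" using that(1)[of k] \<delta> by (simp add: algebra_simps)
              from order_tendstoD(1)[OF that(2) this] show ?thesis by eventually_elim simp
            qed
          qed
        qed simp
        have AB_nonneg: "0 \<le> A \<epsilon> k" "0 \<le> B \<epsilon> k" if "\<epsilon> > 0" for \<epsilon> k
          unfolding A_def B_def using v_pos[OF that] well_int_pos saddle_int_pos that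
          by (intro mult_nonneg_nonneg divide_nonneg_pos mult_pos_pos; simp add: less_imp_le)+
        have "eventually (\<lambda>\<epsilon>. \<forall>k\<in>?K. (1 - \<delta>) * A0 k \<le> Ah \<epsilon> k) (at_right 0)"
          using AB_nonneg A_lim by (intro lower AB0) (auto simp: Ah_def A0_def)
        moreover have "eventually (\<lambda>\<epsilon>. \<forall>k\<in>?K. (1 - \<delta>) * B0 k \<le> Bh \<epsilon> k) (at_right 0)"
          using AB_nonneg B_lim by (intro lower AB0) (auto simp: Bh_def B0_def)
        ultimately have "eventually (\<lambda>\<epsilon>. ereal (exp (\<h> / \<epsilon>)) * rate_functional a b \<epsilon> (M \<epsilon>) \<le> ereal (X + e)) (at_right 0)"
          using pos
        proof eventually_elim
          case (elim \<epsilon>)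
          note q = Q[OF elim(4), unfolded Q_def]
          have "ereal (exp (\<h> / \<epsilon>)) * rate_functional a b \<epsilon> (M \<epsilon>)
            \<le> ereal (exp (\<h> / \<epsilon>)) * ereal ((\<Sum>k\<in>?K. A \<epsilon> k * (1 - exp (w \<epsilon> k)) + B \<epsilon> k * (1 - exp (- w \<epsilon> k))) / mass \<epsilon>)"
            using q by (intro ereal_mult_left_mono) auto
          also have "\<dots> = ereal ((\<Sum>k\<in>?K. Ah \<epsilon> k * (1 - exp (w \<epsilon> k)) + Bh \<epsilon> k * (1 - exp (- w \<epsilon> k))) / mass \<epsilon>)"
            by (simp add: Ah_def Bh_def sum_distrib_left algebra_simps)
          also have "\<dots> \<le> ereal (U \<epsilon>)"
          proof -
            have "(\<Sum>k\<in>?K. Ah \<epsilon> k * (1 - exp (w \<epsilon> k)) + Bh \<epsilon> k * (1 - exp (- w \<epsilon> k)))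
              \<le> (\<Sum>k\<in>?K. (1 - \<delta>) * (A0 k * (1 - exp (w \<epsilon> k)) + B0 k * (1 - exp (- w \<epsilon> k)))
                   + ((Ah \<epsilon> k - (1 - \<delta>) * A0 k) + (Bh \<epsilon> k - (1 - \<delta>) * B0 k)))"
            proof (intro sum_mono)
              fix k assume k: "k \<in> ?K"
              have "0 \<le> (Ah \<epsilon> k - (1 - \<delta>) * A0 k) * exp (w \<epsilon> k)" "0 \<le> (Bh \<epsilon> k - (1 - \<delta>) * B0 k) * exp (- w \<epsilon> k)"
                using elim(2,3) k by (auto intro!: mult_nonneg_nonneg)
              then show "Ah \<epsilon> k * (1 - exp (w \<epsilon> k)) + Bh \<epsilon> k * (1 - exp (- w \<epsilon> k)) \<le> (1 - \<delta>) * (A0 k * (1 - exp (w \<epsilon> k)) + B0 k * (1 - exp (- w \<epsilon> k)))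
                   + ((Ah \<epsilon> k - (1 - \<delta>) * A0 k) + (Bh \<epsilon> k - (1 - \<delta>) * B0 k))"
                by (simp add: algebra_simps)
            qed
            also have "\<dots> = (1 - \<delta>) * (\<Sum>k\<in>?K. A0 k * (1 - exp (w \<epsilon> k)) + B0 k * (1 - exp (- w \<epsilon> k)))
                 + (\<Sum>k\<in>?K. (Ah \<epsilon> k - (1 - \<delta>) * A0 k) + (Bh \<epsilon> k - (1 - \<delta>) * B0 k))"
              by (subst sum.distrib) (simp only: sum_distrib_left)
            also have "\<dots> \<le> (1 - \<delta>) * X + (\<Sum>k\<in>?K. (Ah \<epsilon> k - (1 - \<delta>) * A0 k) + (Bh \<epsilon> k - (1 - \<delta>) * B0 k))"
              using X[of "w \<epsilon>"] q \<delta> by (intro add_right_mono mult_left_mono) auto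
            finally show ?thesis unfolding U_def using q by (simp add: divide_right_mono)
          qed
          also have "\<dots> \<le> ereal (X + e)" using elim(1) by simp
          finally show ?case .
        qed
        then show ?thesis by (intro Limsup_bounded) auto
      qed
      then show ?thesis unfolding real by (rule ereal_le_epsilon2[rule_format, rotated]) 
    next
      case MInf
      then show ?thesis using tilt[of "\<lambda>_. 0"] by simp
    qed simp
  qed
  moreover have "\<forall>\<epsilon>>0. M \<epsilon> \<in> torus_prob" using Q by (simp add: Q_def)
  ultimately show ?thesis by blast
qed

end

section \<open>Test functions that detect mass away from the minima\<close>

lemma has_real_derivative_pos_part_power:
  "((\<lambda>y::real. max 0 y ^ Suc (Suc n)) has_real_derivative real (Suc (Suc n)) * max 0 y ^ Suc n) (at y)"
proof (cases y "0::real" rule: linorder_cases)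
  case less
  have "((\<lambda>y::real. 0) has_real_derivative 0) (at y)" by simp
  then have "((\<lambda>y::real. max 0 y ^ Suc (Suc n)) has_real_derivative 0) (at y)"
    by (rule has_field_derivative_transform_within_open[of _ _ _ "{..<0}"]) (use less in auto)
  then show ?thesis using less by simp
next
  case greater
  have "((\<lambda>y::real. y ^ Suc (Suc n)) has_real_derivative real (Suc (Suc n)) * y ^ Suc n) (at y)"
    using DERIV_pow[of "Suc (Suc n)" y] by simp
  then have "((\<lambda>y::real. max 0 y ^ Suc (Suc n)) has_real_derivative real (Suc (Suc n)) * y ^ Suc n) (at y)"
    by (rule has_field_derivative_transform_within_open[of _ _ _ "{0<..}"]) (use greater in auto)
  then show ?thesis using greater by (simp add: max_def)
next
  case equal
  have "((\<lambda>h::real. max 0 h ^ Suc (Suc n) / h) \<longlongrightarrow> 0) (at 0)"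
  proof (rule Lim_null_comparison)
    show "\<forall>\<^sub>F h::real in at 0. norm (max 0 h ^ Suc (Suc n) / h) \<le> \<bar>h\<bar> ^ Suc n"
    proof (rule always_eventually, rule allI)
      fix h :: real
      show "norm (max 0 h ^ Suc (Suc n) / h) \<le> \<bar>h\<bar> ^ Suc n" by (cases "h > 0") (simp_all add: max_absorb1 max_absorb2 not_less mult_nonpos_nonneg)
    qed
    show "((\<lambda>h::real. \<bar>h\<bar> ^ Suc n) \<longlongrightarrow> 0) (at 0)"
      by (rule tendsto_eq_intros refl | simp)+
  qed
  then show ?thesis using equal by (simp add: has_field_derivative_iff)
qed

lemma log_test_function:
  fixes \<phi> v v' :: "real \<Rightarrow> real"
  assumes "\<And>x. \<phi> (x + 1) = \<phi> x" and \<phi>: "\<And>x. (\<phi> has_real_derivative v x) (at x)"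
    and v: "\<And>x. (v has_real_derivative v' x) (at x)" and v': "continuous_on UNIV v'"
  shows "(\<lambda>x. exp (\<phi> x)) \<in> torus_C2"
    and "generator a b \<epsilon> (\<lambda>x. exp (\<phi> x)) x / exp (\<phi> x) = b x * v x + \<epsilon> * a x * (v' x + (v x)^2)"
proof -
  have cont: "continuous_on UNIV \<phi>" "continuous_on UNIV v"
    using \<phi> v by (intro continuous_at_imp_continuous_on ballI; metis DERIV_isCont)+
  have 1: "((\<lambda>x. exp (\<phi> x)) has_real_derivative v x * exp (\<phi> x)) (at x)" for x
    using \<phi> by (auto intro!: derivative_eq_intros)
  have 2: "((\<lambda>x. v x * exp (\<phi> x)) has_real_derivative (v' x + (v x)^2) * exp (\<phi> x)) (at x)" for x
    using \<phi>[of x] v[of x] by (auto intro!: derivative_eq_intros simp: algebra_simps power2_eq_square)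
  have 3: "continuous_on UNIV (\<lambda>x. (v' x + (v x)^2) * exp (\<phi> x))"
    by (intro continuous_intros cont v')
  have per: "exp (\<phi> (x + 1)) = exp (\<phi> x)" for x by (simp add: assms(1))
  note C = torus_C2I[where f = "\<lambda>x. exp (\<phi> x)", OF per 1 2 3]
  show "(\<lambda>x. exp (\<phi> x)) \<in> torus_C2" by (rule C(1))
  show "generator a b \<epsilon> (\<lambda>x. exp (\<phi> x)) x / exp (\<phi> x) = b x * v x + \<epsilon> * a x * (v' x + (v x)^2)"
    unfolding generator_def C(3) unfolding C(2) by (simp add: field_simps)
qed

lemma cos_gt_imp_near_int:
  fixes z \<delta> :: real
  assumes "cos (2 * pi * z) > cos (2 * pi * \<delta>)" "0 < \<delta>" "\<delta> < 1/2"
  obtains n :: int where "\<bar>z - of_int n\<bar> < \<delta>"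
proof -
  define n where "n = round z"
  define y where "y = z - of_int n"
  have y: "\<bar>y\<bar> \<le> 1/2" using of_int_round_abs_le[of z] by (simp add: y_def n_def abs_minus_commute)
  have "cos (2 * pi * z) = cos (2 * pi * y + 2 * pi * of_int n)" by (simp add: y_def algebra_simps)
  also have "\<dots> = cos (2 * pi * y)"
    by (simp add: cos_add cos_int_2pin sin_int_2pin)
  also have "\<dots> = cos (2 * pi * \<bar>y\<bar>)" by (cases "y \<ge> 0") auto
  finally have "cos (2 * pi * \<bar>y\<bar>) > cos (2 * pi * \<delta>)" using assms by simp
  moreover have "2 * pi * \<bar>y\<bar> \<le> pi" using y by simp
  ultimately have "2 * pi * \<bar>y\<bar> < 2 * pi * \<delta>"
    using assms by (subst (asm) cos_mono_less_eq) auto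
  then show ?thesis using that by (simp add: y_def)
qed

lemma linear_minus_quadratic_le:
  fixes X Y p \<epsilon> :: real
  assumes "Y > 0" "\<epsilon> > 0"
  shows "X * p - Y / \<epsilon> * p^2 \<le> \<epsilon> * (X^2 / (4 * Y))"
proof -
  have "\<epsilon> * (X^2 / (4 * Y)) - (X * p - Y / \<epsilon> * p^2) = Y / \<epsilon> * (p - \<epsilon> * X / (2 * Y))^2"
    using assms by (simp add: field_simps power2_eq_square)
  also have "\<dots> \<ge> 0" using assms by simp
  finally show ?thesis by simp
qed

lemma antiderivative_period_pos:
  fixes F f :: "real \<Rightarrow> real"
  assumes F: "\<And>x. (F has_real_derivative f x) (at x)" and f: "\<And>x. 0 \<le> f x" "\<And>x. f (x + 1) = f x"
    and lr: "l < r" "r \<le> l + 1" "\<And>x. l < x \<Longrightarrow> x < r \<Longrightarrow> 0 < f x"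
  shows "F 0 < F 1" "F (x + 1) = F x + (F 1 - F 0)"
proof -
  have "((\<lambda>x. F (x + 1) - F x) has_real_derivative 0) (at x)" for x
  proof -
    have "((\<lambda>x. F (x + 1)) has_real_derivative f (x + 1)) (at x)"
      using F[of "x + 1"] DERIV_shift by blast
    then show ?thesis by (auto intro!: derivative_eq_intros F simp: f)
  qed
  then have const: "F (x + 1) - F x = F (0 + 1) - F 0" for x
    using DERIV_isconst_all[of "\<lambda>x. F (x + 1) - F x" x 0] by blast
  then show "F (x + 1) = F x + (F 1 - F 0)" using const[of x] unfolding add_0 by linarith
  have "F l < F r"
    using lr F by (intro DERIV_pos_imp_increasing_open[OF lr(1)])
      (blast, meson DERIV_isCont continuous_at_imp_continuous_on)
  also have "F r \<le> F (l + 1)" using F f by (intro DERIV_nonneg_imp_nondecreasing[OF lr(2)]) blast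
  finally show "F 0 < F 1" using const[of l] by simp
qed

context landscape
begin

text \<open>
  A fixed \<open>u = exp \<phi>\<close> detects the drift: \<open>\<phi>'\<close> is opposite to \<open>b\<close>, with weights on the two signs
  that make \<open>\<phi>\<close> periodic.
\<close>

lemma drift_test:
  obtains g C where "g \<in> torus_continuous" "\<And>x. 0 \<le> g x" "\<And>x. b x \<noteq> 0 \<Longrightarrow> 0 < g x"
    "\<And>\<epsilon> M. \<epsilon> > 0 \<Longrightarrow> M \<in> torus_prob \<Longrightarrow> ereal ((\<integral>x. g x \<partial>M) - C * \<epsilon>) \<le> rate_functional a b \<epsilon> M
"
proof -
  define bp where "bp x = max 0 (b x)" for x
  define bn where "bn x = max 0 (- b x)" for x
  have b_per: "b (x + 1) = b x" for x by (rule torus_C2_periodic[OF b_C2])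
  have b_cont: "continuous_on A b" for A by (rule torus_C2_continuous[OF b_C2])
  have cont: "continuous_on A (\<lambda>x. bp x ^ n)" "continuous_on A (\<lambda>x. bn x ^ n)" for A n
    unfolding bp_def bn_def by (intro continuous_intros b_cont)+
  obtain F1 where F1: "\<And>x. (F1 has_real_derivative bp x ^ 2) (at x)"
    using antiderivative_exists[OF cont(1)] by metis
  obtain F2 where F2: "\<And>x. (F2 has_real_derivative bn x ^ 2) (at x)"
    using antiderivative_exists[OF cont(2)] by metis
  have per1: "F1 0 < F1 1" "F1 (x + 1) = F1 x + (F1 1 - F1 0)" for x
    using b_pos[of 0] \<sigma>_less_m[of 0] m_less_\<sigma>[of 0] \<sigma>_le[of 1 "0 + int N"] \<sigma>_shift[of 0] N_pos
    by (intro antiderivative_period_pos[OF F1, of "\<sigma> 0" "m 0"]; force simp: bp_def b_per)+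
  have per2: "F2 0 < F2 1" "F2 (x + 1) = F2 x + (F2 1 - F2 0)" for x
    using b_neg[of 0] \<sigma>_less_m[of 1] m_less_\<sigma>[of 0] m_le[of 1 "0 + int N"] m_shift[of 0] N_pos
    by (intro antiderivative_period_pos[OF F2, of "m 0" "\<sigma> 1"]; force simp: bn_def b_per)+
  define p where "p = F2 1 - F2 0"
  define q where "q = F1 1 - F1 0"
  have pq: "0 < p" "0 < q" using per1 per2 by (auto simp: p_def q_def)
  define \<phi> where "\<phi> x = q * F2 x - p * F1 x" for x
  define v where "v x = q * bn x ^ 2 - p * bp x ^ 2" for x
  define v' where "v' x = q * (2 * bn x * - deriv b x) - p * (2 * bp x * deriv b x)" for x
  have \<phi>_per: "\<phi> (x + 1) = \<phi> x" for x
    unfolding \<phi>_def per1(2) per2(2) p_def q_def by (simp add: algebra_simps)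
  have \<phi>_deriv: "(\<phi> has_real_derivative v x) (at x)" for x
    unfolding \<phi>_def[abs_def] v_def by (intro derivative_intros DERIV_cmult F1 F2)
  have dsq: "((\<lambda>y::real. max 0 y ^ 2) has_real_derivative 2 * max 0 y) (at y)" for y
    using has_real_derivative_pos_part_power[of 0 y] by (simp add: numeral_2_eq_2)
  have v_deriv: "(v has_real_derivative v' x) (at x)" for x
  proof -
    have "((\<lambda>x. max 0 (b x) ^ 2) has_real_derivative (2 * max 0 (b x)) * deriv b x) (at x)"
      by (rule DERIV_chain2[OF dsq torus_C2_deriv[OF b_C2]])
    moreover have "((\<lambda>x. max 0 (- b x) ^ 2) has_real_derivative (2 * max 0 (- b x)) * (- deriv b x)) (at x)"
      by (rule DERIV_chain2[OF dsq DERIV_minus[OF torus_C2_deriv[OF b_C2]]])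
    ultimately show ?thesis
      unfolding v_def[abs_def] v'_def bp_def bn_def by (intro DERIV_diff DERIV_cmult)
  qed
  have v'_cont: "continuous_on UNIV v'"
    unfolding v'_def bp_def bn_def by (intro continuous_intros b_cont torus_C2_continuous_deriv[OF b_C2])
  note test = log_test_function[OF \<phi>_per \<phi>_deriv v_deriv v'_cont]
  define g where "g x = - (b x * v x)" for x
  have g_eq: "g x = p * bp x ^ 3 + q * bn x ^ 3" for x
    by (cases "b x \<ge> 0") (auto simp: g_def v_def bp_def bn_def max_def power2_eq_square power3_eq_cube)
  have db_per: "deriv b (x + 1) = deriv b x" for x
    by (rule torus_continuousD(1)[OF torus_C2_deriv_torus_continuous(1)[OF b_C2]])
  have "(\<lambda>x. a x * (v' x + (v x)^2)) \<in> torus_continuous"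
  proof (rule torus_continuousI)
    show "continuous_on UNIV (\<lambda>x. a x * (v' x + (v x)^2))"
      unfolding v_def by (intro continuous_intros v'_cont cont)
  qed (simp add: v_def v'_def bp_def bn_def b_per db_per torus_C2_periodic[OF a_C2])
  then obtain C where C: "\<And>x. \<bar>a x * (v' x + (v x)^2)\<bar> \<le> C"
    using torus_continuous_bounded by blast
  show ?thesis
  proof
    show g: "g \<in> torus_continuous"
      unfolding g_eq[abs_def] by (intro torus_continuousI continuous_intros cont) (simp add: bp_def bn_def b_per)
    show "0 \<le> g x" for x unfolding g_eq using pq by (simp add: bp_def bn_def)
    show "0 < g x" if "b x \<noteq> 0" for x
    proof (cases "b x > 0")
      case True
      then have "0 < bp x" "0 \<le> bn x" by (auto simp: bp_def bn_def)
      then show ?thesis unfolding g_eq using pq by (intro add_pos_nonneg) auto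
    next
      case False
      then have "0 \<le> bp x" "0 < bn x" using that by (auto simp: bp_def bn_def)
      then show ?thesis unfolding g_eq using pq by (intro add_nonneg_pos) auto
    qed
    show "ereal ((\<integral>x. g x \<partial>M) - C * \<epsilon>) \<le> rate_functional a b \<epsilon> M" if "\<epsilon> > 0" "M \<in> torus_prob" for \<epsilon> M
    proof (rule rate_functional_ge[OF a_C2 b_C2 test(1) _ that(2) g])
      fix x
      have "\<epsilon> * (a x * (v' x + (v x)^2)) \<le> \<epsilon> * C" using C[of x] that by (intro mult_left_mono) auto
      then show "generator a b \<epsilon> (\<lambda>x. exp (\<phi> x)) x / exp (\<phi> x) \<le> C * \<epsilon> - g x"
        unfolding test(2) g_def by (simp add: mult_ac)
    qed simp
  qed
qed

text \<open>
  Near a maximum of \<open>S\<close> the drift vanishes and a fixed test function sees nothing. On the scale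
  \<open>sqrt \<epsilon>\<close> the diffusion is an unstable Ornstein--Uhlenbeck process, and \<open>exp (\<kappa> P\<^sup>3 / \<epsilon>)\<close>, which
  decreases away from the maximum like a Gaussian, decays under it at a rate independent of \<open>\<epsilon>\<close>.
\<close>

lemma saddle_test:
  obtains g C where "g \<in> torus_continuous" "\<And>x. 0 \<le> g x" "0 < g (\<sigma> k)"
    "\<And>\<epsilon> M. \<epsilon> > 0 \<Longrightarrow> M \<in> torus_prob \<Longrightarrow> ereal ((\<integral>x. g x \<partial>M) - C * \<epsilon>) \<le> rate_functional a b \<epsilon> M"
proof -
  define D where "D = deriv b (\<sigma> k)"
  have D: "D > 0" unfolding D_def by (rule b_\<sigma>)
  obtain r0 where r0: "r0 > 0" "\<And>z. z \<noteq> 0 \<Longrightarrow> \<bar>z\<bar> < r0 \<Longrightarrow> D / 2 < b (\<sigma> k + z) / z"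
  proof -
    have "((\<lambda>z. (b (\<sigma> k + z) - b (\<sigma> k)) / z) \<longlongrightarrow> D) (at 0)"
      using torus_C2_deriv[OF b_C2, of "\<sigma> k"] by (simp add: DERIV_def D_def)
    then have "eventually (\<lambda>z. D / 2 < (b (\<sigma> k + z) - b (\<sigma> k)) / z) (at 0)"
      using D by (intro order_tendstoD(1)) auto
    then show ?thesis using that unfolding eventually_at by (auto simp: b_\<sigma> dist_real_def)
  qed
  define r where "r = min (r0 / 2) (1 / 8)"
  have r: "0 < r" "r < 1/4" "r < r0" using r0(1) by (auto simp: r_def)
  define c where "c = cos (2 * pi * r)"
  have c: "0 < c" "c < 1"
  proof -
    show "0 < c" unfolding c_def using r by (intro cos_gt_zero) auto
    have "cos (2 * pi * r) < cos 0" using r by (intro cos_monotone_0_pi) auto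
    then show "c < 1" by (simp add: c_def)
  qed
  define sn where "sn x = sin (2 * pi * (x - \<sigma> k))" for x
  define cs where "cs x = cos (2 * pi * (x - \<sigma> k))" for x
  define P where "P x = max 0 (cs x - c)" for x
  define \<theta> where "\<theta> = D / (4 * pi)"
  have \<theta>: "0 < \<theta>" using D by (simp add: \<theta>_def)
  obtain A where A: "\<And>x. \<bar>a x\<bar> \<le> A" "0 < A"
    using torus_continuous_bounded[OF torus_C2_imp_continuous[OF a_C2]] by blast
  \<comment> \<open>so small that the quadratic term of \<open>L u / u\<close> takes at most half of the drift term\<close>
  define \<kappa> where "\<kappa> = \<theta> / (12 * pi * A)"
  have \<kappa>: "0 < \<kappa>" using \<theta> A by (simp add: \<kappa>_def)
  have per: "sn (x + 1) = sn x" "cs (x + 1) = cs x" for x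
  proof -
    have "2 * pi * (x + 1 - \<sigma> k) = 2 * pi * (x - \<sigma> k) + 2 * pi" by (simp add: algebra_simps)
    then show "sn (x + 1) = sn x" "cs (x + 1) = cs x" by (simp_all add: sn_def cs_def)
  qed
  have P_per: "P (x + 1) = P x" for x by (simp add: P_def per)
  have cont: "continuous_on B sn" "continuous_on B cs" "continuous_on B P" for B
    unfolding P_def sn_def cs_def by (intro continuous_intros)+
  have dsn: "(sn has_real_derivative 2 * pi * cs x) (at x)"
    and dcs: "(cs has_real_derivative - (2 * pi * sn x)) (at x)" for x
    unfolding sn_def[abs_def] cs_def[abs_def] by (auto intro!: derivative_eq_intros)
  have P1: "0 \<le> P x" "P x \<le> 1" for x
    using c cos_le_one[of "2 * pi * (x - \<sigma> k)"] unfolding P_def cs_def by linarith+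
  \<comment> \<open>\<open>P\<close> is supported near the translates of \<open>\<sigma> k\<close>, where \<open>b\<close> has the sign of the displacement\<close>
  have core: "\<theta> * sn x ^ 2 \<le> b x * sn x \<and> c \<le> cs x" if "P x > 0" for x
  proof -
    have gt: "cos (2 * pi * (x - \<sigma> k)) > cos (2 * pi * r)"
      using that by (auto simp: P_def cs_def c_def max_def split: if_splits)
    obtain n :: int where n: "\<bar>x - \<sigma> k - of_int n\<bar> < r"
      using cos_gt_imp_near_int[OF gt] r by auto
    define z where "z = x - \<sigma> k - of_int n"
    have bz: "b x = b (\<sigma> k + z)"
      using periodic_of_int[of b "\<sigma> k + z" n, OF torus_C2_periodic[OF b_C2]] by (simp add: z_def)
    have "sin (2 * pi * (x - \<sigma> k)) = sin (2 * pi * z + 2 * pi * of_int n)" by (simp add: z_def algebra_simps)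
    also have "\<dots> = sin (2 * pi * z)" by (simp add: sin_add cos_int_2pin sin_int_2pin)
    finally have snz: "sn x = sin (2 * pi * z)" by (simp add: sn_def)
    have z: "\<bar>z\<bar> < r" using n by (simp add: z_def)
    have "\<theta> * sn x ^ 2 \<le> b x * sn x"
    proof (cases z "0::real" rule: linorder_cases)
      case equal then show ?thesis by (simp add: snz)
    next
      case greater
      have s0: "0 \<le> sn x" unfolding snz using greater z r by (intro sin_ge_zero) auto
      have "sn x \<le> 2 * pi * z" unfolding snz using greater by (intro sin_x_le_x) auto
      then have "\<theta> * sn x \<le> D / 2 * z" using D by (simp add: \<theta>_def field_simps)
      also have "\<dots> \<le> b x" using r0(2)[of z] greater z r by (simp add: bz field_simps)
      finally show ?thesis using s0 by (simp add: power2_eq_square mult_right_mono flip: mult.assoc)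
    next
      case less
      define y where "y = - z"
      have y: "0 < y" "y < r" and sy: "- sn x = sin (2 * pi * y)"
        using less z by (auto simp: y_def snz)
      have s0: "0 \<le> - sn x" unfolding sy using y r by (intro sin_ge_zero) auto
      have "- sn x \<le> 2 * pi * y" unfolding sy using y by (intro sin_x_le_x) auto
      then have "- sn x \<le> - (2 * pi * z)" by (simp add: y_def)
      then have "\<theta> * - sn x \<le> D / 2 * - z" using D by (simp add: \<theta>_def field_simps)
      also have "\<dots> \<le> - b x" using r0(2)[of z] less z r by (simp add: bz field_simps)
      finally have "(\<theta> * - sn x) * - sn x \<le> - b x * - sn x" using s0 by (intro mult_right_mono) auto
      then show ?thesis by (simp add: power2_eq_square mult.assoc)
    qed
    moreover have "c \<le> cs x" using gt by (simp add: c_def cs_def)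
    ultimately show ?thesis by simp
  qed
  define g where "g x = 12 * pi^2 * \<kappa> * c\<^sub>0 * c * P x ^ 2" for x
  define X where "X = 24 * pi^2 * \<kappa> * A"
  define Y where "Y = 3 * pi * \<theta> * \<kappa>"
  define C where "C = X^2 / (4 * Y)"
  have Y: "Y > 0" using \<theta> \<kappa> by (simp add: Y_def)
  have C0: "0 \<le> C" unfolding C_def using Y by simp
  show ?thesis
  proof
    show g: "g \<in> torus_continuous"
      unfolding g_def[abs_def] by (intro torus_continuousI continuous_intros cont) (simp add: P_per)
    show "0 \<le> g x" for x using \<kappa> c c0_pos by (simp add: g_def)
    show "0 < g (\<sigma> k)" using \<kappa> c c0_pos by (simp add: g_def P_def cs_def)
    show "ereal ((\<integral>x. g x \<partial>M) - C * \<epsilon>) \<le> rate_functional a b \<epsilon> M" if \<epsilon>: "\<epsilon> > 0" and M: "M \<in> torus_prob" for \<epsilon> M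
    proof -
      define \<phi> where "\<phi> x = \<kappa> / \<epsilon> * P x ^ 3" for x
      define v where "v x = \<kappa> / \<epsilon> * (3 * P x ^ 2 * - (2 * pi * sn x))" for x
      define v' where "v' x = \<kappa> / \<epsilon> * (6 * P x * (2 * pi * sn x)^2 - 3 * P x ^ 2 * (4 * pi^2 * cs x))" for x
      have "((\<lambda>x. cs x - c) has_real_derivative - (2 * pi * sn x)) (at x)" for x
        by (auto intro!: derivative_eq_intros dcs)
      from DERIV_chain2[OF has_real_derivative_pos_part_power this]
      have dP: "((\<lambda>x. P x ^ Suc (Suc n)) has_real_derivative (real (Suc (Suc n)) * P x ^ Suc n) * - (2 * pi * sn x)) (at x)" for x n
        unfolding P_def .
      have dP3: "((\<lambda>x. P x ^ 3) has_real_derivative 3 * P x ^ 2 * - (2 * pi * sn x)) (at x)"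
        and dP2: "((\<lambda>x. P x ^ 2) has_real_derivative 2 * P x * - (2 * pi * sn x)) (at x)" for x
        using dP[of 1 x] dP[of 0 x] by (simp_all add: numeral_2_eq_2 numeral_3_eq_3)
      have \<phi>: "(\<phi> has_real_derivative v x) (at x)" for x
        unfolding \<phi>_def[abs_def] v_def by (intro DERIV_cmult dP3)
      have v: "(v has_real_derivative v' x) (at x)" for x
      proof -
        have "(v has_real_derivative \<kappa> / \<epsilon> * ((3 * (2 * P x * - (2 * pi * sn x))) * - (2 * pi * sn x)
            + - (2 * pi * (2 * pi * cs x)) * (3 * P x ^ 2))) (at x)"
          unfolding v_def[abs_def] by (intro DERIV_cmult DERIV_mult DERIV_minus dP2 dsn)
        moreover have "(3 * (2 * P x * - (2 * pi * sn x))) * - (2 * pi * sn x) + - (2 * pi * (2 * pi * cs x)) * (3 * P x ^ 2)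
          = 6 * P x * (2 * pi * sn x)^2 - 3 * P x ^ 2 * (4 * pi^2 * cs x)"
          by (simp add: algebra_simps power2_eq_square)
        ultimately show ?thesis unfolding v'_def by metis
      qed
      have v'_cont: "continuous_on UNIV v'" unfolding v'_def by (intro continuous_intros cont)
      have \<phi>_per: "\<phi> (x + 1) = \<phi> x" for x by (simp add: \<phi>_def P_per)
      note test = log_test_function[OF \<phi>_per \<phi> v v'_cont]
      show ?thesis
      proof (rule rate_functional_ge[OF a_C2 b_C2 test(1) _ M g])
        fix x
        show "generator a b \<epsilon> (\<lambda>x. exp (\<phi> x)) x / exp (\<phi> x) \<le> C * \<epsilon> - g x"
        proof (cases "P x > 0")
          case False
          then have "P x = 0" using P1[of x] by simp
          then show ?thesis unfolding test(2) using C0 \<epsilon> by (simp add: v_def v'_def g_def)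
        next
          case True
          note co = core[OF True]
          have aA: "a x \<le> A" using A(1)[of x] by simp
          have eq: "b x * v x + \<epsilon> * a x * (v' x + (v x)^2)
            = - ((6 * pi * \<kappa> / \<epsilon> * P x ^ 2) * (b x * sn x))
              + 36 * pi^2 * \<kappa>^2 / \<epsilon> * (a x * (P x ^ 2 * P x ^ 2 * sn x ^ 2))
              + 24 * pi^2 * \<kappa> * (a x * (P x * sn x ^ 2)) - 12 * pi^2 * \<kappa> * (a x * (P x ^ 2 * cs x))"
            unfolding v_def v'_def using \<epsilon> by (simp add: field_simps power2_eq_square)
          have 1: "(6 * pi * \<kappa> / \<epsilon> * P x ^ 2) * (\<theta> * sn x ^ 2) \<le> (6 * pi * \<kappa> / \<epsilon> * P x ^ 2) * (b x * sn x)"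
            using co \<kappa> \<epsilon> by (intro mult_left_mono) auto
          have "P x ^ 2 * P x ^ 2 \<le> P x ^ 2 * 1" using P1[of x] by (intro mult_left_mono) (auto simp: power_le_one)
          then have "P x ^ 2 * P x ^ 2 * sn x ^ 2 \<le> P x ^ 2 * sn x ^ 2" by (intro mult_right_mono) auto
          then have "a x * (P x ^ 2 * P x ^ 2 * sn x ^ 2) \<le> A * (P x ^ 2 * sn x ^ 2)"
            by (rule mult_mono[OF aA]) (use A(2) in auto)
          then have 2: "36 * pi^2 * \<kappa>^2 / \<epsilon> * (a x * (P x ^ 2 * P x ^ 2 * sn x ^ 2)) \<le> 36 * pi^2 * \<kappa>^2 / \<epsilon> * (A * (P x ^ 2 * sn x ^ 2))"
            using \<epsilon> by (intro mult_left_mono) auto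
          have 3: "24 * pi^2 * \<kappa> * (a x * (P x * sn x ^ 2)) \<le> 24 * pi^2 * \<kappa> * (A * (P x * sn x ^ 2))"
            using aA \<kappa> P1[of x] by (intro mult_left_mono mult_right_mono) auto
          have "c\<^sub>0 * (P x ^ 2 * c) \<le> a x * (P x ^ 2 * cs x)"
            using co a_ge[of x] c0_pos c by (intro mult_mono) auto
          then have 4: "g x \<le> 12 * pi^2 * \<kappa> * (a x * (P x ^ 2 * cs x))"
            using \<kappa> mult_left_mono[of "c\<^sub>0 * (P x ^ 2 * c)" "a x * (P x ^ 2 * cs x)" "12 * pi^2 * \<kappa>"]
            by (simp add: g_def mult_ac)
          have "36 * pi^2 * \<kappa>^2 / \<epsilon> * (A * (P x ^ 2 * sn x ^ 2)) = (36 * pi^2 * \<kappa> * A) * (\<kappa> / \<epsilon> * (P x ^ 2 * sn x ^ 2))"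
            by (simp add: power2_eq_square)
          also have "36 * pi^2 * \<kappa> * A = 3 * pi * \<theta>"
            using A by (simp add: \<kappa>_def power2_eq_square)
          finally have 5: "36 * pi^2 * \<kappa>^2 / \<epsilon> * (A * (P x ^ 2 * sn x ^ 2)) = 3 * pi * \<theta> * (\<kappa> / \<epsilon> * (P x ^ 2 * sn x ^ 2))" .
          have "b x * v x + \<epsilon> * a x * (v' x + (v x)^2)
            \<le> - ((6 * pi * \<kappa> / \<epsilon> * P x ^ 2) * (\<theta> * sn x ^ 2)) + 3 * pi * \<theta> * (\<kappa> / \<epsilon> * (P x ^ 2 * sn x ^ 2))
              + 24 * pi^2 * \<kappa> * (A * (P x * sn x ^ 2)) - g x"
            unfolding eq using 1 2 3 4 unfolding 5
            by (intro diff_mono add_mono le_imp_neg_le)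
          also have "\<dots> = sn x ^ 2 * (X * P x - Y / \<epsilon> * P x ^ 2) - g x"
            using \<epsilon> by (simp add: X_def Y_def field_simps)
          also have "sn x ^ 2 * (X * P x - Y / \<epsilon> * P x ^ 2) \<le> sn x ^ 2 * (\<epsilon> * C)"
            unfolding C_def by (intro mult_left_mono linear_minus_quadratic_le Y \<epsilon>) simp
          also have "sn x ^ 2 * (\<epsilon> * C) \<le> 1 * (\<epsilon> * C)"
            using C0 \<epsilon> by (intro mult_right_mono) (auto simp: sn_def abs_square_le_1)
          finally show ?thesis unfolding test(2) by (simp add: mult.commute)
        qed
      qed simp
    qed
  qed
qed

text \<open>
  A lower bound on \<open>I\<^sub>\<epsilon>\<close> that does not vanish with \<open>\<epsilon>\<close> is enough, because the prefactor
  \<open>exp (\<h> / \<epsilon>)\<close> diverges.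
\<close>

lemma Liminf_infinity_of_test:
  assumes \<mu>: "\<mu> \<in> torus_prob" and M: "\<And>\<epsilon>. \<epsilon> > 0 \<Longrightarrow> M \<epsilon> \<in> torus_prob" and conv: "torus_weak_conv M \<mu> (at_right 0)"
    and g: "g \<in> torus_continuous" "0 < (\<integral>x. g x \<partial>\<mu>)"
    and ge: "\<And>\<epsilon> M. \<epsilon> > 0 \<Longrightarrow> M \<in> torus_prob \<Longrightarrow> ereal ((\<integral>x. g x \<partial>M) - C * \<epsilon>) \<le> rate_functional a b \<epsilon> M"
  shows "Liminf (at_right 0) (\<lambda>\<epsilon>. ereal (exp (\<h> / \<epsilon>)) * rate_functional a b \<epsilon> (M \<epsilon>)) = \<infinity>"
proof -
  define \<gamma> where "\<gamma> = (\<integral>x. g x \<partial>\<mu>)"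
  have \<gamma>: "\<gamma> > 0" using g by (simp add: \<gamma>_def)
  have "((\<lambda>\<epsilon>. (\<integral>x. g x \<partial>M \<epsilon>) - C * \<epsilon>) \<longlongrightarrow> \<gamma> - C * 0) (at_right 0)"
    using conv g(1) by (intro tendsto_intros) (auto simp: torus_weak_conv_def \<gamma>_def)
  then have ev: "eventually (\<lambda>\<epsilon>. \<gamma> / 2 < (\<integral>x. g x \<partial>M \<epsilon>) - C * \<epsilon>) (at_right 0)"
    using \<gamma> by (intro order_tendstoD(1)) auto
  have "filterlim (\<lambda>\<epsilon>. \<h> * inverse \<epsilon>) at_top (at_right 0)"
    using min_barrier_pos by (intro filterlim_tendsto_pos_mult_at_top[OF tendsto_const _ filterlim_inverse_at_top_right])
  from filterlim_compose[OF exp_at_top this]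
  have "filterlim (\<lambda>\<epsilon>. exp (\<h> / \<epsilon>)) at_top (at_right 0)"
    by (simp only: divide_inverse)
  from filterlim_tendsto_pos_mult_at_top[OF tendsto_const _ this, of "\<gamma> / 2"]
  have "filterlim (\<lambda>\<epsilon>. \<gamma> / 2 * exp (\<h> / \<epsilon>)) at_top (at_right 0)"
    using \<gamma> by simp
  then have "((\<lambda>\<epsilon>. ereal (\<gamma> / 2 * exp (\<h> / \<epsilon>))) \<longlongrightarrow> \<infinity>) (at_right 0)"
    by (auto simp: tendsto_PInfty filterlim_at_top_dense)
  then have "\<infinity> = Liminf (at_right 0) (\<lambda>\<epsilon>. ereal (\<gamma> / 2 * exp (\<h> / \<epsilon>)))"
    by (intro lim_imp_Liminf[symmetric]) auto
  also have "\<dots> \<le> Liminf (at_right 0) (\<lambda>\<epsilon>. ereal (exp (\<h> / \<epsilon>)) * rate_functional a b \<epsilon> (M \<epsilon>))"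
  proof (rule Liminf_mono)
    show "\<forall>\<^sub>F \<epsilon> in at_right 0. ereal (\<gamma> / 2 * exp (\<h> / \<epsilon>)) \<le> ereal (exp (\<h> / \<epsilon>)) * rate_functional a b \<epsilon> (M \<epsilon>)"
      using ev eventually_at_right_less[of 0]
    proof eventually_elim
      case (elim \<epsilon>)
      have "ereal (\<gamma> / 2) \<le> ereal ((\<integral>x. g x \<partial>M \<epsilon>) - C * \<epsilon>)" using elim by simp
      also have "\<dots> \<le> rate_functional a b \<epsilon> (M \<epsilon>)" using elim M by (intro ge) auto
      finally have "ereal (exp (\<h> / \<epsilon>)) * ereal (\<gamma> / 2) \<le> ereal (exp (\<h> / \<epsilon>)) * rate_functional a b \<epsilon> (M \<epsilon>)"
        by (intro ereal_mult_left_mono) auto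
      then show ?case by (simp add: mult.commute)
    qed
  qed
  finally show ?thesis by (simp add: top.extremum_uniqueI)
qed

lemma frac_m_mod: "frac (m k) \<in> (\<lambda>k. frac (m k)) ` {0..<int N}"
  and frac_\<sigma>_mod: "frac (\<sigma> k) \<in> (\<lambda>k. frac (\<sigma> k)) ` {0..<int N}"
proof -
  have "frac (m (k mod int N)) = frac (m k)" "frac (\<sigma> (k mod int N)) = frac (\<sigma> k)"
    by (rule int_periodic_mod, simp add: m_shift \<sigma>_shift frac_1_eq)+
  then show "frac (m k) \<in> (\<lambda>k. frac (m k)) ` {0..<int N}" "frac (\<sigma> k) \<in> (\<lambda>k. frac (\<sigma> k)) ` {0..<int N}"
    using N_pos by (auto intro!: image_eqI[of _ _ "k mod int N"])
qed

text \<open>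
  If the lower limit is finite, the two kinds of test functions show that \<open>\<mu>\<close> charges neither the set
  \<open>b \<noteq> 0\<close> nor the maxima of \<open>S\<close>; only the minima remain.
\<close>

lemma Liminf_infinity_unless_dirac_sum:
  assumes \<mu>: "\<mu> \<in> torus_prob" and M: "\<And>\<epsilon>. \<epsilon> > 0 \<Longrightarrow> M \<epsilon> \<in> torus_prob" and conv: "torus_weak_conv M \<mu> (at_right 0)"
    and no_dirac: "\<not> (\<exists>\<omega>. prob_vector N \<omega> \<and> is_dirac_sum N (\<lambda>k. frac (m k)) \<omega> \<mu>)"
  shows "Liminf (at_right 0) (\<lambda>\<epsilon>. ereal (exp (\<h> / \<epsilon>)) * rate_functional a b \<epsilon> (M \<epsilon>)) = \<infinity>"
proof (rule ccontr)
  assume fin: "\<not> ?thesis"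
  interpret prob_space \<mu> using \<mu> by (simp add: torus_prob_def)
  have zero: "AE x in \<mu>. g x = 0"
    if g: "g \<in> torus_continuous" "\<And>x. 0 \<le> g x"
      and ge: "\<And>\<epsilon> M. \<epsilon> > 0 \<Longrightarrow> M \<in> torus_prob \<Longrightarrow> ereal ((\<integral>x. g x \<partial>M) - C * \<epsilon>) \<le> rate_functional a b \<epsilon> M" for g C
  proof -
    have "\<not> 0 < (\<integral>x. g x \<partial>\<mu>)"
      using Liminf_infinity_of_test[OF \<mu> M conv g(1) _ ge] fin by blast
    moreover have "0 \<le> (\<integral>x. g x \<partial>\<mu>)" using g(2) by simp
    ultimately have "(\<integral>x. g x \<partial>\<mu>) = 0" by simp
    then show ?thesis
      using integral_nonneg_eq_0_iff_AE[OF torus_prob_integrable[OF \<mu> g(1)]] g(2) by simp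
  qed
  obtain g0 C0 where g0: "g0 \<in> torus_continuous" "\<And>x. 0 \<le> g0 x" "\<And>x. b x \<noteq> 0 \<Longrightarrow> 0 < g0 x"
    "\<And>\<epsilon> M. \<epsilon> > 0 \<Longrightarrow> M \<in> torus_prob \<Longrightarrow> ereal ((\<integral>x. g0 x \<partial>M) - C0 * \<epsilon>) \<le> rate_functional a b \<epsilon> M"
    using drift_test by blast
  have "AE x in \<mu>. g0 x = 0" by (rule zero[OF g0(1,2)]) (rule g0(4))
  then have "AE x in \<mu>. b x = 0" by eventually_elim (use g0(3) in force)
  moreover have "AE x in \<mu>. \<forall>k\<in>{0..<int N}. x \<noteq> frac (\<sigma> k)"
  proof (rule AE_finite_allI)
    fix k assume "k \<in> {0..<int N}"
    obtain g C where g: "g \<in> torus_continuous" "\<And>x. 0 \<le> g x" "0 < g (\<sigma> k)"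
      "\<And>\<epsilon> M. \<epsilon> > 0 \<Longrightarrow> M \<in> torus_prob \<Longrightarrow> ereal ((\<integral>x. g x \<partial>M) - C * \<epsilon>) \<le> rate_functional a b \<epsilon> M"
      using saddle_test by blast
    have "g (frac (\<sigma> k)) \<noteq> 0" using periodic_frac[of g, OF torus_continuousD(1)[OF g(1)]] g(3) by simp
    then show "AE x in \<mu>. x \<noteq> frac (\<sigma> k)"
    proof -
      have "AE x in \<mu>. g x = 0" by (rule zero[OF g(1,2)]) (rule g(4))
      then show ?thesis by eventually_elim (use \<open>g (frac (\<sigma> k)) \<noteq> 0\<close> in auto)
    qed
  qed simp
  moreover have "AE x in \<mu>. x \<in> {0..<1}"
    using \<mu> sets_eq_imp_space_eq[of \<mu> torus] space_torus by (intro AE_I2) (auto simp: torus_prob_def)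
  ultimately have "AE x in \<mu>. x \<in> (\<lambda>k. frac (m k)) ` {0..<int N}"
  proof eventually_elim
    case (elim x)
    then have fx: "frac x = x" by (simp add: frac_eq)
    show ?case
    proof (rule zero_cases[OF elim(1)])
      fix j assume "x = m j"
      then show ?thesis using frac_m_mod[of j] fx by simp
    next
      fix j assume "x = \<sigma> j"
      then show ?thesis using frac_\<sigma>_mod[of j] fx elim(2) by auto
    qed
  qed
  from is_dirac_sumI[OF \<mu> inj_on_frac_m frac_m_in this] show False using no_dirac by blast
qed

end

section \<open>Test functions attached to the wells\<close>

context landscape
begin

text \<open>
  The cosine makes the bump periodic, with support in the \<open>\<delta>\<close>-neighbourhoods of the translates of
  \<open>m k\<close>.
\<close>

definition bump :: "real \<Rightarrow> int \<Rightarrow> real \<Rightarrow> real" where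
  "bump \<delta> k x = max 0 ((cos (2 * pi * (x - m k)) - cos (2 * pi * \<delta>)) / (1 - cos (2 * pi * \<delta>)))"

definition bump_mass :: "real \<Rightarrow> real \<Rightarrow> int \<Rightarrow> real" where
  "bump_mass \<delta> \<epsilon> k = integral {\<sigma> k..\<sigma> (k + 1)} (\<lambda>x. bump \<delta> k x * gibbs \<epsilon> x)"

text \<open>
  On the interval between two maxima the cutoff rises from \<open>0\<close> to \<open>1\<close> inside the bump at \<open>m k\<close>. Its
  derivative is a bump times the Gibbs weight, which is the form that the generator turns into a
  multiple of the bump: a function with derivative \<open>exp (S / \<epsilon>) * cutoff\<close> has \<open>L u\<close> proportional to it.
\<close>

definition cutoff :: "real \<Rightarrow> real \<Rightarrow> int \<Rightarrow> real \<Rightarrow> real" where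
  "cutoff \<delta> \<epsilon> k x = integral {\<sigma> k..x} (\<lambda>x. bump \<delta> k x * gibbs \<epsilon> x) / bump_mass \<delta> \<epsilon> k"

definition rise :: "real \<Rightarrow> real \<Rightarrow> int \<Rightarrow> real \<Rightarrow> real" where
  "rise \<delta> \<epsilon> k x = integral {\<sigma> k..x} (\<lambda>x. exp (S x / \<epsilon>) * cutoff \<delta> \<epsilon> k x)"

definition fall :: "real \<Rightarrow> real \<Rightarrow> int \<Rightarrow> real \<Rightarrow> real" where
  "fall \<delta> \<epsilon> k x = integral {x..\<sigma> (k + 1)} (\<lambda>x. exp (S x / \<epsilon>) * (1 - cutoff \<delta> \<epsilon> k x))"

text \<open>
  The total increase across the maximum \<open>\<sigma> (k + 1)\<close> of a function whose derivative is
  \<open>exp (S / \<epsilon>)\<close> between the two neighbouring bumps and is cut off inside them: a mollified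
  \<open>saddle_int\<close>, up to a negligible error.
\<close>

definition resistance :: "real \<Rightarrow> real \<Rightarrow> int \<Rightarrow> real" where
  "resistance \<delta> \<epsilon> k = rise \<delta> \<epsilon> k (\<sigma> (k + 1)) + fall \<delta> \<epsilon> (k + 1) (\<sigma> (k + 1))"

text \<open>
  The last two conditions let the saddle far from each end of the bump still dominate it; the near
  one does so by monotonicity.
\<close>

definition well_radius :: "real \<Rightarrow> bool" where
  "well_radius \<delta> \<longleftrightarrow> 0 < \<delta> \<and> \<delta> < 1/2 \<and> (\<forall>k. \<sigma> k < m k - \<delta> \<and> m k + \<delta> < \<sigma> (k + 1) \<and>
     S (m k - \<delta>) < S (\<sigma> (k + 1)) \<and> S (m k + \<delta>) < S (\<sigma> k))"

lemma well_radius_exists: "\<exists>\<delta>. well_radius \<delta>"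
proof -
  define Q where "Q \<delta> k \<longleftrightarrow> \<sigma> k < m k - \<delta> \<and> m k + \<delta> < \<sigma> (k + 1) \<and>
     S (m k - \<delta>) < S (\<sigma> (k + 1)) \<and> S (m k + \<delta>) < S (\<sigma> k)" for \<delta> k
  have S_lim: "(S \<longlongrightarrow> S x) (at x)" for x
    using continuous_S[of UNIV] by (simp add: continuous_on_def)
  have "eventually (\<lambda>\<delta>. Q \<delta> k) (at_right 0)" for k
  proof -
    have l: "((\<lambda>\<delta>. m k - \<delta>) \<longlongrightarrow> m k) (at_right 0)" "((\<lambda>\<delta>. m k + \<delta>) \<longlongrightarrow> m k) (at_right 0)"
      by (rule tendsto_eq_intros refl | simp)+
    have isc: "isCont S (m k)" using S_lim by (simp add: isCont_def)
    have "S (m k) < S (\<sigma> (k + 1))" "S (m k) < S (\<sigma> k)"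
      using S_well[of "\<sigma> (k + 1)" k] S_well[of "\<sigma> k" k] \<sigma>_less_m[of k] m_less_\<sigma>[of k] by auto
    then show ?thesis
      unfolding Q_def using \<sigma>_less_m[of k] m_less_\<sigma>[of k]
      by (intro eventually_conj order_tendstoD(1)[OF l(1)] order_tendstoD(2)[OF l(2)]
          order_tendstoD(2)[OF isCont_tendsto_compose[OF isc l(1)]] order_tendstoD(2)[OF isCont_tendsto_compose[OF isc l(2)]])
  qed
  then have "eventually (\<lambda>\<delta>. \<forall>k\<in>{0..<int N}. Q \<delta> k) (at_right 0)"
    by (intro eventually_ball_finite) auto
  moreover have "eventually (\<lambda>\<delta>. \<delta> < (1/2::real)) (at_right 0)"
    by (rule order_tendstoD(2)[OF tendsto_ident_at]) simp
  ultimately have "eventually (\<lambda>\<delta>. 0 < \<delta> \<and> \<delta> < 1/2 \<and> (\<forall>k\<in>{0..<int N}. Q \<delta> k)) (at_right 0)"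
    using eventually_at_right_less[of 0] by eventually_elim auto
  then obtain \<delta> where \<delta>: "0 < \<delta>" "\<delta> < 1/2" "\<And>k. k \<in> {0..<int N} \<Longrightarrow> Q \<delta> k"
    using eventually_happens[of _ "at_right (0::real)"] by (metis (no_types, lifting) trivial_limit_at_right_real)
  have "Q \<delta> (k + int N) = Q \<delta> k" for k
  proof -
    have e: "m k + 1 - \<delta> = (m k - \<delta>) + 1" "m k + 1 + \<delta> = (m k + \<delta>) + 1" "k + int N + 1 = (k + 1) + int N" by simp_all
    show ?thesis unfolding Q_def e(3) m_shift \<sigma>_shift e(1,2) S_shift by simp
  qed
  then have "Q \<delta> (k mod int N) = Q \<delta> k" for k by (rule int_periodic_mod)
  then have "Q \<delta> k" for k using \<delta>(3)[of "k mod int N"] N_pos by simp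
  then show ?thesis using \<delta> unfolding well_radius_def Q_def by blast
qed

lemma exp_S_continuous: "continuous_on A (\<lambda>x. exp (S x / \<epsilon>))"
  using continuous_exp_S[of A 1 \<epsilon>] by simp

lemma continuous_bump: "continuous_on A (bump \<delta> k)"
proof (cases "cos (2 * pi * \<delta>) = 1")
  case False
  then show ?thesis unfolding bump_def[abs_def] by (intro continuous_intros) auto
qed (simp add: bump_def[abs_def])

lemma bump_periodic: "bump \<delta> k (x + 1) = bump \<delta> k x" and bump_shift: "bump \<delta> (k + int N) x = bump \<delta> k x"
proof -
  have "2 * pi * (x + 1 - m k) = 2 * pi * (x - m k) + 2 * pi" "2 * pi * (x - m (k + int N)) = 2 * pi * (x - m k) - 2 * pi"
    by (simp_all add: algebra_simps m_shift)
  then show "bump \<delta> k (x + 1) = bump \<delta> k x" "bump \<delta> (k + int N) x = bump \<delta> k x"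
    unfolding bump_def by (simp_all add: cos_diff)
qed

lemma m_add_int: "m (k + n * int N) = m k + of_int n"
proof -
  have "m (k + int n * int N) = m k + real n" for k n
  proof (induction n)
    case (Suc n)
    have e: "k + int (Suc n) * int N = (k + int n * int N) + int N" by (simp add: algebra_simps)
    show ?case unfolding e m_shift Suc by simp
  qed simp
  note * = this
  show ?thesis
  proof (cases "0 \<le> n")
    case True then show ?thesis using *[of k "nat n"] by simp
  next
    case False then show ?thesis using *[of "k + n * int N" "nat (- n)"] by simp
  qed
qed

context
  fixes \<delta> \<epsilon> :: real
  assumes \<delta>: "well_radius \<delta>" and \<epsilon>: "\<epsilon> > 0"
begin

lemma radius: "0 < \<delta>" "\<delta> < 1/2" "\<sigma> k < m k - \<delta>" "m k + \<delta> < \<sigma> (k + 1)"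
    "S (m k - \<delta>) < S (\<sigma> (k + 1))" "S (m k + \<delta>) < S (\<sigma> k)"
  using \<delta> unfolding well_radius_def by auto

lemma cos_radius: "cos (2 * pi * \<delta>) < 1"
proof -
  have "cos (2 * pi * \<delta>) < cos 0" using radius(1,2) by (intro cos_monotone_0_pi) auto
  then show ?thesis by simp
qed

lemma bump_bounds: "0 \<le> bump \<delta> k x" "bump \<delta> k x \<le> 1"
  using cos_radius cos_le_one[of "2 * pi * (x - m k)"] by (auto simp: bump_def divide_le_eq)

lemma bump_at_min: "bump \<delta> k (m k) = 1"
  using cos_radius by (simp add: bump_def)

lemma bump_support:
  assumes x: "x \<in> {\<sigma> k..\<sigma> (k + 1)}" and "bump \<delta> j x \<noteq> 0"
  shows "\<bar>x - m k\<bar> < \<delta>" "j mod int N = k mod int N"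
proof -
  have "cos (2 * pi * (x - m j)) > cos (2 * pi * \<delta>)"
    using assms(2) cos_radius by (auto simp: bump_def max_def zero_le_divide_iff split: if_splits)
  then obtain n :: int where n: "\<bar>x - m j - of_int n\<bar> < \<delta>"
    using cos_gt_imp_near_int radius(1,2) by blast
  define i where "i = j + n * int N"
  have i: "\<bar>x - m i\<bar> < \<delta>" using n by (simp add: i_def m_add_int algebra_simps)
  have "i = k"
  proof (rule ccontr)
    assume "i \<noteq> k"
    then consider "i + 1 \<le> k" | "k + 1 \<le> i" by linarith
    then show False
      using i radius(3,4)[of i] x \<sigma>_le[of "i + 1" k] \<sigma>_le[of "k + 1" i] by cases (auto simp: abs_less_iff)
  qed
  then show "\<bar>x - m k\<bar> < \<delta>" "j mod int N = k mod int N" using i by (auto simp: i_def)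
qed

lemma continuous_bump_gibbs: "continuous_on A (\<lambda>x. bump \<delta> k x * gibbs \<epsilon> x)"
  by (intro continuous_intros continuous_bump continuous_gibbs)

lemma bump_gibbs_nonneg: "0 \<le> bump \<delta> k x * gibbs \<epsilon> x"
  using bump_bounds gibbs_pos[of \<epsilon> x] by simp

lemma bump_mass_pos: "0 < bump_mass \<delta> \<epsilon> k"
  unfolding bump_mass_def
  using \<sigma>_less_m[of k] m_less_\<sigma>[of k] bump_at_min[of k] gibbs_pos[of \<epsilon> "m k"]
  by (intro integral_pos_of_continuous[where z = "m k"] continuous_bump_gibbs bump_gibbs_nonneg) auto

lemma cutoff_deriv:
  assumes "x \<in> {\<sigma> k..\<sigma> (k + 1)}"
  shows "(cutoff \<delta> \<epsilon> k has_real_derivative bump \<delta> k x * gibbs \<epsilon> x / bump_mass \<delta> \<epsilon> k) (at x within {\<sigma> k..\<sigma> (k + 1)})"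
  unfolding cutoff_def[abs_def]
  by (intro DERIV_cdivide integral_has_real_derivative[OF continuous_bump_gibbs] assms)

lemma cutoff_continuous: "continuous_on {\<sigma> k..\<sigma> (k + 1)} (cutoff \<delta> \<epsilon> k)"
  by (rule DERIV_continuous_on) (rule cutoff_deriv)

lemma cutoff_mono:
  assumes "\<sigma> k \<le> x" "x \<le> y" "y \<le> \<sigma> (k + 1)" shows "cutoff \<delta> \<epsilon> k x \<le> cutoff \<delta> \<epsilon> k y"
proof -
  have "integral {\<sigma> k..x} (\<lambda>x. bump \<delta> k x * gibbs \<epsilon> x) \<le> integral {\<sigma> k..y} (\<lambda>x. bump \<delta> k x * gibbs \<epsilon> x)"
    using assms by (intro integral_subset_le integrable_continuous_interval continuous_bump_gibbs) (auto intro: bump_gibbs_nonneg)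
  then show ?thesis unfolding cutoff_def using bump_mass_pos[of k] by (simp add: divide_right_mono)
qed

lemma cutoff_left: assumes "\<sigma> k \<le> x" "x \<le> m k - \<delta>" shows "cutoff \<delta> \<epsilon> k x = 0"
proof -
  have "integral {\<sigma> k..x} (\<lambda>x. bump \<delta> k x * gibbs \<epsilon> x) = integral {\<sigma> k..x} (\<lambda>x. 0)"
  proof (rule integral_cong)
    fix z assume z: "z \<in> {\<sigma> k..x}"
    then have "\<not> \<bar>z - m k\<bar> < \<delta>" using assms by auto
    moreover have "z \<in> {\<sigma> k..\<sigma> (k + 1)}" using z assms radius(1) radius(4)[of k] by auto
    ultimately show "bump \<delta> k z * gibbs \<epsilon> z = 0" using bump_support(1) by fastforce
  qed
  then show ?thesis by (simp add: cutoff_def)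
qed

lemma cutoff_right: assumes "m k + \<delta> \<le> x" "x \<le> \<sigma> (k + 1)" shows "cutoff \<delta> \<epsilon> k x = 1"
proof -
  have "integral {x..\<sigma> (k + 1)} (\<lambda>x. bump \<delta> k x * gibbs \<epsilon> x) = integral {x..\<sigma> (k + 1)} (\<lambda>x. 0)"
  proof (rule integral_cong)
    fix z assume z: "z \<in> {x..\<sigma> (k + 1)}"
    then have "\<not> \<bar>z - m k\<bar> < \<delta>" using assms by auto
    moreover have "z \<in> {\<sigma> k..\<sigma> (k + 1)}" using z assms radius(1) radius(3)[of k] by auto
    ultimately show "bump \<delta> k z * gibbs \<epsilon> z = 0" using bump_support(1) by fastforce
  qed
  moreover have "integral {\<sigma> k..x} (\<lambda>x. bump \<delta> k x * gibbs \<epsilon> x) + integral {x..\<sigma> (k + 1)} (\<lambda>x. bump \<delta> k x * gibbs \<epsilon> x)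
      = bump_mass \<delta> \<epsilon> k"
    unfolding bump_mass_def using assms radius(1) radius(3)[of k]
    by (intro Henstock_Kurzweil_Integration.integral_combine integrable_continuous_interval continuous_bump_gibbs) auto
  ultimately show ?thesis using bump_mass_pos[of k] by (simp add: cutoff_def)
qed

lemma cutoff_bounds: assumes "x \<in> {\<sigma> k..\<sigma> (k + 1)}" shows "0 \<le> cutoff \<delta> \<epsilon> k x" "cutoff \<delta> \<epsilon> k x \<le> 1"
  using cutoff_mono[of k "\<sigma> k" x] cutoff_mono[of k x "\<sigma> (k + 1)"] cutoff_left[of k "\<sigma> k"] cutoff_right[of k "\<sigma> (k + 1)"]
    radius(1) radius(3-6)[of k] assms by auto

lemma rise_integrand:
  shows rise_integrand_continuous: "continuous_on {\<sigma> k..\<sigma> (k + 1)} (\<lambda>x. exp (S x / \<epsilon>) * cutoff \<delta> \<epsilon> k x)"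
    and fall_integrand_continuous: "continuous_on {\<sigma> k..\<sigma> (k + 1)} (\<lambda>x. exp (S x / \<epsilon>) * (1 - cutoff \<delta> \<epsilon> k x))"
  by (intro continuous_intros cutoff_continuous exp_S_continuous)+

lemma integrand_integrable:
  assumes "\<sigma> k \<le> x" "y \<le> \<sigma> (k + 1)"
  shows rise_integrable: "(\<lambda>x. exp (S x / \<epsilon>) * cutoff \<delta> \<epsilon> k x) integrable_on {x..y}"
    and fall_integrable: "(\<lambda>x. exp (S x / \<epsilon>) * (1 - cutoff \<delta> \<epsilon> k x)) integrable_on {x..y}"
  using assms
  by (intro integrable_continuous_interval continuous_on_subset[OF rise_integrand_continuous[of k]]
      continuous_on_subset[OF fall_integrand_continuous[of k]]; auto)+

lemma rise_mono: assumes "\<sigma> k \<le> x" "x \<le> y" "y \<le> \<sigma> (k + 1)" shows "rise \<delta> \<epsilon> k x \<le> rise \<delta> \<epsilon> k y"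
  unfolding rise_def using assms cutoff_bounds(1)
  by (intro integral_subset_le rise_integrable) auto

lemma fall_mono: assumes "\<sigma> k \<le> x" "x \<le> y" "y \<le> \<sigma> (k + 1)" shows "fall \<delta> \<epsilon> k y \<le> fall \<delta> \<epsilon> k x"
  unfolding fall_def using assms cutoff_bounds(2)
  by (intro integral_subset_le fall_integrable) auto

lemma rise_start: "rise \<delta> \<epsilon> k (\<sigma> k) = 0" and fall_end: "fall \<delta> \<epsilon> k (\<sigma> (k + 1)) = 0"
  by (simp_all add: rise_def fall_def)

definition "bump_gap k = scale \<epsilon> (m k + \<delta>) - scale \<epsilon> (m k - \<delta>)"

lemma integral_exp_S: "l \<le> r \<Longrightarrow> integral {l..r} (\<lambda>x. exp (S x / \<epsilon>)) = scale \<epsilon> r - scale \<epsilon> l"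
  by (rule integral_antiderivative[OF scale_deriv])

lemma rise_left: assumes "\<sigma> k \<le> x" "x \<le> m k + \<delta>" shows "rise \<delta> \<epsilon> k x \<le> bump_gap k"
proof -
  have "rise \<delta> \<epsilon> k x \<le> rise \<delta> \<epsilon> k (m k + \<delta>)" using assms radius(1) radius(3-6)[of k] by (intro rise_mono) auto
  also have "\<dots> = integral {\<sigma> k..m k - \<delta>} (\<lambda>x. exp (S x / \<epsilon>) * cutoff \<delta> \<epsilon> k x)
      + integral {m k - \<delta>..m k + \<delta>} (\<lambda>x. exp (S x / \<epsilon>) * cutoff \<delta> \<epsilon> k x)"
    unfolding rise_def using radius(1) radius(3-6)[of k]
    by (intro Henstock_Kurzweil_Integration.integral_combine[symmetric] rise_integrable) auto
  also have "integral {\<sigma> k..m k - \<delta>} (\<lambda>x. exp (S x / \<epsilon>) * cutoff \<delta> \<epsilon> k x) = integral {\<sigma> k..m k - \<delta>} (\<lambda>x. 0)"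
    by (intro integral_cong) (simp add: cutoff_left)
  also have "integral {m k - \<delta>..m k + \<delta>} (\<lambda>x. exp (S x / \<epsilon>) * cutoff \<delta> \<epsilon> k x)
      \<le> integral {m k - \<delta>..m k + \<delta>} (\<lambda>x. exp (S x / \<epsilon>))"
    using radius(1) radius(3-6)[of k] cutoff_bounds(2)[of _ k]
    by (intro integral_le rise_integrable integrable_continuous_interval exp_S_continuous) auto
  also have "\<dots> = bump_gap k" unfolding bump_gap_def using radius(1) by (intro integral_exp_S) auto
  finally show ?thesis by simp
qed

lemma fall_right: assumes "m k - \<delta> \<le> x" "x \<le> \<sigma> (k + 1)" shows "fall \<delta> \<epsilon> k x \<le> bump_gap k"
proof -
  have "fall \<delta> \<epsilon> k x \<le> fall \<delta> \<epsilon> k (m k - \<delta>)" using assms radius(1) radius(3-6)[of k] by (intro fall_mono) auto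
  also have "\<dots> = integral {m k - \<delta>..m k + \<delta>} (\<lambda>x. exp (S x / \<epsilon>) * (1 - cutoff \<delta> \<epsilon> k x))
      + integral {m k + \<delta>..\<sigma> (k + 1)} (\<lambda>x. exp (S x / \<epsilon>) * (1 - cutoff \<delta> \<epsilon> k x))"
    unfolding fall_def using radius(1) radius(3-6)[of k]
    by (intro Henstock_Kurzweil_Integration.integral_combine[symmetric] fall_integrable) auto
  also have "integral {m k + \<delta>..\<sigma> (k + 1)} (\<lambda>x. exp (S x / \<epsilon>) * (1 - cutoff \<delta> \<epsilon> k x)) = integral {m k + \<delta>..\<sigma> (k + 1)} (\<lambda>x. 0)"
    by (intro integral_cong) (simp add: cutoff_right)
  also have "integral {m k - \<delta>..m k + \<delta>} (\<lambda>x. exp (S x / \<epsilon>) * (1 - cutoff \<delta> \<epsilon> k x))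
      \<le> integral {m k - \<delta>..m k + \<delta>} (\<lambda>x. exp (S x / \<epsilon>))"
    using radius(1) radius(3-6)[of k] cutoff_bounds(1)[of _ k]
    by (intro integral_le fall_integrable integrable_continuous_interval exp_S_continuous) auto
  also have "integral {m k - \<delta>..m k + \<delta>} (\<lambda>x. exp (S x / \<epsilon>)) = bump_gap k"
    unfolding bump_gap_def using radius(1) by (intro integral_exp_S) auto
  finally show ?thesis by simp
qed

lemma rise_total: "\<bar>rise \<delta> \<epsilon> k (\<sigma> (k + 1)) - (scale \<epsilon> (\<sigma> (k + 1)) - scale \<epsilon> (m k))\<bar> \<le> bump_gap k"
proof -
  have "rise \<delta> \<epsilon> k (\<sigma> (k + 1)) = rise \<delta> \<epsilon> k (m k + \<delta>) + integral {m k + \<delta>..\<sigma> (k + 1)} (\<lambda>x. exp (S x / \<epsilon>) * cutoff \<delta> \<epsilon> k x)"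
    unfolding rise_def using radius(1) radius(3-6)[of k]
    by (intro Henstock_Kurzweil_Integration.integral_combine[symmetric] rise_integrable) auto
  also have "integral {m k + \<delta>..\<sigma> (k + 1)} (\<lambda>x. exp (S x / \<epsilon>) * cutoff \<delta> \<epsilon> k x) = integral {m k + \<delta>..\<sigma> (k + 1)} (\<lambda>x. exp (S x / \<epsilon>))"
    by (intro integral_cong) (simp add: cutoff_right)
  also have "\<dots> = scale \<epsilon> (\<sigma> (k + 1)) - scale \<epsilon> (m k + \<delta>)" using radius(4)[of k] by (intro integral_exp_S) auto
  finally have eq: "rise \<delta> \<epsilon> k (\<sigma> (k + 1)) = rise \<delta> \<epsilon> k (m k + \<delta>) + (scale \<epsilon> (\<sigma> (k + 1)) - scale \<epsilon> (m k + \<delta>))" .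
  have "0 \<le> rise \<delta> \<epsilon> k (m k + \<delta>)" "rise \<delta> \<epsilon> k (m k + \<delta>) \<le> bump_gap k"
    using rise_mono[of k "\<sigma> k" "m k + \<delta>"] rise_start[of k] radius(1) radius(3-6)[of k] rise_left[of k "m k + \<delta>"] by auto
  moreover have "scale \<epsilon> (m k - \<delta>) \<le> scale \<epsilon> (m k)" "scale \<epsilon> (m k) \<le> scale \<epsilon> (m k + \<delta>)"
    using radius(1) by (auto intro: scale_le)
  ultimately show ?thesis unfolding eq bump_gap_def by linarith
qed

lemma fall_total: "\<bar>fall \<delta> \<epsilon> k (\<sigma> k) - (scale \<epsilon> (m k) - scale \<epsilon> (\<sigma> k))\<bar> \<le> bump_gap k"
proof -
  have "fall \<delta> \<epsilon> k (\<sigma> k) = integral {\<sigma> k..m k - \<delta>} (\<lambda>x. exp (S x / \<epsilon>) * (1 - cutoff \<delta> \<epsilon> k x)) + fall \<delta> \<epsilon> k (m k - \<delta>)"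
    unfolding fall_def using radius(1) radius(3-6)[of k]
    by (intro Henstock_Kurzweil_Integration.integral_combine[symmetric] fall_integrable) auto
  also have "integral {\<sigma> k..m k - \<delta>} (\<lambda>x. exp (S x / \<epsilon>) * (1 - cutoff \<delta> \<epsilon> k x)) = integral {\<sigma> k..m k - \<delta>} (\<lambda>x. exp (S x / \<epsilon>))"
    by (intro integral_cong) (simp add: cutoff_left)
  also have "\<dots> = scale \<epsilon> (m k - \<delta>) - scale \<epsilon> (\<sigma> k)" using radius(3)[of k] by (intro integral_exp_S) auto
  finally have eq: "fall \<delta> \<epsilon> k (\<sigma> k) = (scale \<epsilon> (m k - \<delta>) - scale \<epsilon> (\<sigma> k)) + fall \<delta> \<epsilon> k (m k - \<delta>)" .
  have "0 \<le> fall \<delta> \<epsilon> k (m k - \<delta>)" "fall \<delta> \<epsilon> k (m k - \<delta>) \<le> bump_gap k"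
    using fall_mono[of k "m k - \<delta>" "\<sigma> (k + 1)"] fall_end[of k] radius(1) radius(3-6)[of k] fall_right[of k "m k - \<delta>"] by auto
  moreover have "scale \<epsilon> (m k - \<delta>) \<le> scale \<epsilon> (m k)" "scale \<epsilon> (m k) \<le> scale \<epsilon> (m k + \<delta>)"
    using radius(1) by (auto intro: scale_le)
  ultimately show ?thesis unfolding eq bump_gap_def by linarith
qed

lemma rise_fall_bounds:
  assumes "x \<in> {\<sigma> k..\<sigma> (k + 1)}"
  shows "0 \<le> rise \<delta> \<epsilon> k x" "rise \<delta> \<epsilon> k x \<le> rise \<delta> \<epsilon> k (\<sigma> (k + 1))"
    "0 \<le> fall \<delta> \<epsilon> k x" "fall \<delta> \<epsilon> k x \<le> fall \<delta> \<epsilon> k (\<sigma> k)"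
  using rise_mono[of k "\<sigma> k" x] rise_mono[of k x "\<sigma> (k + 1)"] fall_mono[of k x "\<sigma> (k + 1)"] fall_mono[of k "\<sigma> k" x]
    rise_start[of k] fall_end[of k] assms by auto

lemma resistance_ge:
  shows "rise \<delta> \<epsilon> k (\<sigma> (k + 1)) \<le> resistance \<delta> \<epsilon> k" "fall \<delta> \<epsilon> (k + 1) (\<sigma> (k + 1)) \<le> resistance \<delta> \<epsilon> k"
    and resistance_pos: "0 < resistance \<delta> \<epsilon> k"
proof -
  have r: "0 \<le> rise \<delta> \<epsilon> k (\<sigma> (k + 1))" using rise_fall_bounds(1)[of "\<sigma> (k + 1)" k] \<sigma>_le[of k "k + 1"] by simp
  have f: "0 \<le> fall \<delta> \<epsilon> (k + 1) (\<sigma> (k + 1))" using rise_fall_bounds(3)[of "\<sigma> (k + 1)" "k + 1"] \<sigma>_le[of "k + 1" "k + 1 + 1"] by simp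
  show "rise \<delta> \<epsilon> k (\<sigma> (k + 1)) \<le> resistance \<delta> \<epsilon> k" "fall \<delta> \<epsilon> (k + 1) (\<sigma> (k + 1)) \<le> resistance \<delta> \<epsilon> k"
    using r f by (auto simp: resistance_def)
  have "scale \<epsilon> (m k + \<delta>) < scale \<epsilon> (\<sigma> (k + 1))" by (rule scale_less[OF radius(4)])
  moreover have "integral {m k + \<delta>..\<sigma> (k + 1)} (\<lambda>x. exp (S x / \<epsilon>) * cutoff \<delta> \<epsilon> k x) = integral {m k + \<delta>..\<sigma> (k + 1)} (\<lambda>x. exp (S x / \<epsilon>))"
    by (intro integral_cong) (simp add: cutoff_right)
  moreover have "rise \<delta> \<epsilon> k (\<sigma> (k + 1)) = rise \<delta> \<epsilon> k (m k + \<delta>) + integral {m k + \<delta>..\<sigma> (k + 1)} (\<lambda>x. exp (S x / \<epsilon>) * cutoff \<delta> \<epsilon> k x)"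
    unfolding rise_def using radius(1) radius(3-6)[of k]
    by (intro Henstock_Kurzweil_Integration.integral_combine[symmetric] rise_integrable) auto
  moreover have "integral {m k + \<delta>..\<sigma> (k + 1)} (\<lambda>x. exp (S x / \<epsilon>)) = scale \<epsilon> (\<sigma> (k + 1)) - scale \<epsilon> (m k + \<delta>)"
    using radius(4)[of k] by (intro integral_exp_S) auto
  moreover have "0 \<le> rise \<delta> \<epsilon> k (m k + \<delta>)" using rise_fall_bounds(1)[of "m k + \<delta>" k] radius(1) radius(3-6)[of k] by simp
  ultimately have "0 < rise \<delta> \<epsilon> k (\<sigma> (k + 1))" by linarith
  then show "0 < resistance \<delta> \<epsilon> k" using f by (simp add: resistance_def)
qed

lemma resistance_close: "\<bar>resistance \<delta> \<epsilon> k - saddle_int \<epsilon> k\<bar> \<le> bump_gap k + bump_gap (k + 1)"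
  using rise_total[of k] fall_total[of "k + 1"] unfolding resistance_def saddle_int_def by linarith

lemma shifted:
  shows bump_mass_shift: "bump_mass \<delta> \<epsilon> (k + int N) = exp ((S 0 - S 1) / \<epsilon>) * bump_mass \<delta> \<epsilon> k"
    and resistance_shift: "resistance \<delta> \<epsilon> (k + int N) = exp (- ((S 0 - S 1) / \<epsilon>)) * resistance \<delta> \<epsilon> k"
    and fall_shift: "fall \<delta> \<epsilon> (k + int N) (\<sigma> (k + int N)) = exp (- ((S 0 - S 1) / \<epsilon>)) * fall \<delta> \<epsilon> k (\<sigma> k)"
proof -
  have k1: "\<sigma> (k + int N + 1) = \<sigma> (k + 1) + 1" for k using \<sigma>_shift[of "k + 1"] by (simp add: algebra_simps)
  have bump_shift': "bump \<delta> (k + int N) = bump \<delta> k" for k using bump_shift by blast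
  have mass: "bump_mass \<delta> \<epsilon> (k + int N) = exp ((S 0 - S 1) / \<epsilon>) * bump_mass \<delta> \<epsilon> k" for k
    unfolding bump_mass_def \<sigma>_shift k1 bump_shift' by (rule integral_gibbs_shift) (rule bump_periodic)
  then show "bump_mass \<delta> \<epsilon> (k + int N) = exp ((S 0 - S 1) / \<epsilon>) * bump_mass \<delta> \<epsilon> k" .
  have cut: "cutoff \<delta> \<epsilon> (k + int N) (x + 1) = cutoff \<delta> \<epsilon> k x" for k x
  proof -
    have "integral {\<sigma> k + 1..x + 1} (\<lambda>x. bump \<delta> k x * gibbs \<epsilon> x) = exp ((S 0 - S 1) / \<epsilon>) * integral {\<sigma> k..x} (\<lambda>x. bump \<delta> k x * gibbs \<epsilon> x)"
      by (rule integral_gibbs_shift) (rule bump_periodic)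
    then show ?thesis unfolding cutoff_def mass \<sigma>_shift bump_shift' by simp
  qed
  have ex: "exp (S (x + 1) / \<epsilon>) = exp (- ((S 0 - S 1) / \<epsilon>)) * exp (S x / \<epsilon>)" for x
    unfolding S_shift exp_add[symmetric] by (simp add: diff_divide_distrib)
  have rise: "rise \<delta> \<epsilon> (k + int N) (\<sigma> (k + int N + 1)) = exp (- ((S 0 - S 1) / \<epsilon>)) * rise \<delta> \<epsilon> k (\<sigma> (k + 1))" for k
  proof -
    have "rise \<delta> \<epsilon> (k + int N) (\<sigma> (k + int N + 1)) = integral {\<sigma> k..\<sigma> (k + 1)} (\<lambda>x. exp (S (x + 1) / \<epsilon>) * cutoff \<delta> \<epsilon> (k + int N) (x + 1))"
      unfolding rise_def \<sigma>_shift k1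
      using integral_shift_real_ivl[of "\<sigma> k + 1" 1 "\<sigma> (k + 1) + 1" "\<lambda>x. exp (S x / \<epsilon>) * cutoff \<delta> \<epsilon> (k + int N) x"] by simp
    then show ?thesis unfolding ex cut mult.assoc by (simp add: rise_def)
  qed
  have fall: "fall \<delta> \<epsilon> (k + int N) (\<sigma> (k + int N)) = exp (- ((S 0 - S 1) / \<epsilon>)) * fall \<delta> \<epsilon> k (\<sigma> k)" for k
  proof -
    have "fall \<delta> \<epsilon> (k + int N) (\<sigma> (k + int N)) = integral {\<sigma> k..\<sigma> (k + 1)} (\<lambda>x. exp (S (x + 1) / \<epsilon>) * (1 - cutoff \<delta> \<epsilon> (k + int N) (x + 1)))"
      unfolding fall_def \<sigma>_shift k1
      using integral_shift_real_ivl[of "\<sigma> k + 1" 1 "\<sigma> (k + 1) + 1" "\<lambda>x. exp (S x / \<epsilon>) * (1 - cutoff \<delta> \<epsilon> (k + int N) x)"] by simp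
    then show ?thesis unfolding ex cut mult.assoc by (simp add: fall_def)
  qed
  then show "fall \<delta> \<epsilon> (k + int N) (\<sigma> (k + int N)) = exp (- ((S 0 - S 1) / \<epsilon>)) * fall \<delta> \<epsilon> k (\<sigma> k)" .
  have e: "k + int N + 1 = (k + 1) + int N" by simp
  have "fall \<delta> \<epsilon> (k + int N + 1) (\<sigma> (k + int N + 1)) = exp (- ((S 0 - S 1) / \<epsilon>)) * fall \<delta> \<epsilon> (k + 1) (\<sigma> (k + 1))"
    unfolding e by (rule fall)
  then show "resistance \<delta> \<epsilon> (k + int N) = exp (- ((S 0 - S 1) / \<epsilon>)) * resistance \<delta> \<epsilon> k"
    unfolding resistance_def rise by (simp add: distrib_left)
qed

definition current :: "(int \<Rightarrow> real) \<Rightarrow> int \<Rightarrow> real" where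
  "current H k = (H (k + 1) - H k) / resistance \<delta> \<epsilon> k"

text \<open>
  The derivative of \<open>u\<close> is \<open>exp (S / \<epsilon>) \<kappa>\<close>, where \<open>\<kappa>\<close> equals the current \<open>c k\<close> between the bumps at
  \<open>m k\<close> and \<open>m (k + 1)\<close> and passes from \<open>c (k - 1)\<close> to \<open>c k\<close> inside the bump at \<open>m k\<close>. Since
  \<open>c k * resistance k = H (k + 1) - H k\<close>, the increments of \<open>u\<close> add up to zero over a period. Both \<open>\<kappa>\<close> and
  \<open>u\<close> are global antiderivatives, so that smoothness needs no gluing; periodicity follows from their
  values at the maxima.
\<close>

lemma well_test_function:
  fixes H :: "int \<Rightarrow> real"
  assumes H: "\<And>k. H (k + int N) = H k"
  obtains u where "u \<in> torus_C2"
    and "\<And>x. generator a b \<epsilon> u x = (\<Sum>j\<in>{0..<int N}. \<epsilon> * (current H j - current H (j - 1)) / bump_mass \<delta> \<epsilon> j * bump \<delta> j x)"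
    and "\<And>k x. x \<in> {\<sigma> k..\<sigma> (k + 1)} \<Longrightarrow> u x = H k + current H k * rise \<delta> \<epsilon> k x - current H (k - 1) * fall \<delta> \<epsilon> k x"
proof -
  let ?K = "{0..<int N}" and ?\<beta> = "(S 0 - S 1) / \<epsilon>"
  define c where "c = current H"
  define d where "d k = (c k - c (k - 1)) / bump_mass \<delta> \<epsilon> k" for k
  have c_shift: "c (k + int N) = exp ?\<beta> * c k" for k
  proof -
    have e: "k + int N + 1 = (k + 1) + int N" by simp
    show ?thesis unfolding c_def current_def e resistance_shift H
      by (simp add: exp_minus field_simps)
  qed
  have d_shift: "d (k + int N) = d k" for k
  proof -
    have e: "k + int N - 1 = (k - 1) + int N" by simp
    show ?thesis unfolding d_def e bump_mass_shift c_shift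
      by (simp add: right_diff_distrib[symmetric])
  qed
  define g where "g x = (\<Sum>j\<in>?K. d j * bump \<delta> j x)" for x
  have g_cont: "continuous_on A g" for A
    unfolding g_def by (intro continuous_intros continuous_bump)
  have g_per: "g (x + 1) = g x" for x by (simp add: g_def bump_periodic)
  have g_local: "g x = d k * bump \<delta> k x" if x: "x \<in> {\<sigma> k..\<sigma> (k + 1)}" for k x
  proof -
    have "g x = (\<Sum>j\<in>?K. if j = k mod int N then d k * bump \<delta> k x else 0)"
      unfolding g_def
    proof (intro sum.cong refl)
      fix j assume j: "j \<in> ?K"
      have "d (k mod int N) * bump \<delta> (k mod int N) x = d k * bump \<delta> k x"
        by (rule int_periodic_mod[where F = "\<lambda>k. d k * bump \<delta> k x"]) (simp add: d_shift bump_shift)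
      moreover have "bump \<delta> j x = 0" if "j \<noteq> k mod int N"
        using bump_support(2)[OF x, of j] that j by auto
      ultimately show "d j * bump \<delta> j x = (if j = k mod int N then d k * bump \<delta> k x else 0)" by auto
    qed
    then show ?thesis using N_pos by simp
  qed
  obtain \<kappa>0 where \<kappa>0: "\<And>x. (\<kappa>0 has_real_derivative g x * gibbs \<epsilon> x) (at x)"
    using antiderivative_exists[of "\<lambda>x. g x * gibbs \<epsilon> x"] g_cont continuous_gibbs by (metis continuous_on_mult)
  define \<kappa> where "\<kappa> x = \<kappa>0 x - \<kappa>0 (\<sigma> 0) + c (-1)" for x
  have \<kappa>: "(\<kappa> has_real_derivative g x * gibbs \<epsilon> x) (at x)" for x
    unfolding \<kappa>_def[abs_def] by (auto intro!: derivative_eq_intros \<kappa>0)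
  have \<kappa>_cont: "continuous_on A \<kappa>" for A
    by (meson DERIV_isCont \<kappa> continuous_at_imp_continuous_on)
  have \<kappa>_diff: "\<kappa> x = \<kappa> (\<sigma> k) + (c k - c (k - 1)) * cutoff \<delta> \<epsilon> k x" if x: "x \<in> {\<sigma> k..\<sigma> (k + 1)}" for k x
  proof -
    have "\<kappa> x - \<kappa> (\<sigma> k) = integral {\<sigma> k..x} (\<lambda>x. g x * gibbs \<epsilon> x)"
      using x by (intro integral_antiderivative[symmetric] \<kappa>) auto
    also have "\<dots> = integral {\<sigma> k..x} (\<lambda>x. d k * (bump \<delta> k x * gibbs \<epsilon> x))"
      using x by (intro integral_cong) (simp add: g_local)
    also have "\<dots> = (c k - c (k - 1)) * cutoff \<delta> \<epsilon> k x"
      by (simp add: d_def cutoff_def)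
    finally show ?thesis by simp
  qed
  have cut1: "cutoff \<delta> \<epsilon> k (\<sigma> (k + 1)) = 1" for k using cutoff_right[of k "\<sigma> (k + 1)"] radius(4)[of k] by simp
  have \<kappa>_\<sigma>: "\<kappa> (\<sigma> k) = c (k - 1)" for k
  proof -
    have step: "\<kappa> (\<sigma> (k + 1)) = \<kappa> (\<sigma> k) + (c k - c (k - 1))" for k
      using \<kappa>_diff[of "\<sigma> (k + 1)" k] \<sigma>_le[of k "k + 1"] cut1 by simp
    show ?thesis
    proof (induction k rule: int_induct[where k = 0])
      case base show ?case by (simp add: \<kappa>_def)
    next
      case (step1 i) then show ?case using step[of i] by simp
    next
      case (step2 i) then show ?case using step[of "i - 1"] by simp
    qed
  qed
  have \<kappa>_shift: "\<kappa> (x + 1) = exp ?\<beta> * \<kappa> x" for x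
  proof -
    have "((\<lambda>x. \<kappa> (x + 1) - exp ?\<beta> * \<kappa> x) has_real_derivative 0) (at x)" for x
    proof -
      have "((\<lambda>x. \<kappa> (x + 1)) has_real_derivative g (x + 1) * gibbs \<epsilon> (x + 1)) (at x)"
        using \<kappa>[of "x + 1"] DERIV_shift by blast
      then show ?thesis
        by (auto intro!: derivative_eq_intros \<kappa> simp: g_per gibbs_shift)
    qed
    then have "\<kappa> (x + 1) - exp ?\<beta> * \<kappa> x = \<kappa> (\<sigma> 0 + 1) - exp ?\<beta> * \<kappa> (\<sigma> 0)"
      using DERIV_isconst_all[of "\<lambda>x. \<kappa> (x + 1) - exp ?\<beta> * \<kappa> x" x "\<sigma> 0"] by blast
    also have "\<dots> = 0"
      using \<sigma>_shift[of 0] \<kappa>_\<sigma>[of "0 + int N"] \<kappa>_\<sigma>[of 0] c_shift[of "-1"] by (simp add: add.commute)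
    finally show ?thesis by simp
  qed
  obtain u0 where u0: "\<And>x. (u0 has_real_derivative exp (S x / \<epsilon>) * \<kappa> x) (at x)"
    using antiderivative_exists[of "\<lambda>x. exp (S x / \<epsilon>) * \<kappa> x"] exp_S_continuous \<kappa>_cont by (metis continuous_on_mult)
  \<comment> \<open>the value at \<open>\<sigma> k\<close>, where \<open>u\<close> has covered only a part of the step from \<open>H (k - 1)\<close> to \<open>H k\<close>\<close>
  define U where "U k = H k - c (k - 1) * fall \<delta> \<epsilon> k (\<sigma> k)" for k
  define u where "u x = u0 x - u0 (\<sigma> 0) + U 0" for x
  have u: "(u has_real_derivative exp (S x / \<epsilon>) * \<kappa> x) (at x)" for x
    unfolding u_def[abs_def] by (auto intro!: derivative_eq_intros u0)
  have u_diff: "u x = u (\<sigma> k) + c k * rise \<delta> \<epsilon> k x + c (k - 1) * (fall \<delta> \<epsilon> k (\<sigma> k) - fall \<delta> \<epsilon> k x)"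
    if x: "x \<in> {\<sigma> k..\<sigma> (k + 1)}" for k x
  proof -
    have "u x - u (\<sigma> k) = integral {\<sigma> k..x} (\<lambda>x. exp (S x / \<epsilon>) * \<kappa> x)"
      using x by (intro integral_antiderivative[symmetric] u) auto
    also have "\<dots> = integral {\<sigma> k..x} (\<lambda>x. c k * (exp (S x / \<epsilon>) * cutoff \<delta> \<epsilon> k x) + c (k - 1) * (exp (S x / \<epsilon>) * (1 - cutoff \<delta> \<epsilon> k x)))"
    proof (rule integral_cong)
      fix z assume "z \<in> {\<sigma> k..x}"
      then have "z \<in> {\<sigma> k..\<sigma> (k + 1)}" using x by auto
      then have \<kappa>_z: "\<kappa> z = c (k - 1) + (c k - c (k - 1)) * cutoff \<delta> \<epsilon> k z"
        using \<kappa>_diff \<kappa>_\<sigma> by simp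
      show "exp (S z / \<epsilon>) * \<kappa> z = c k * (exp (S z / \<epsilon>) * cutoff \<delta> \<epsilon> k z) + c (k - 1) * (exp (S z / \<epsilon>) * (1 - cutoff \<delta> \<epsilon> k z))"
        unfolding \<kappa>_z by (simp add: algebra_simps)
    qed
    also have "\<dots> = c k * rise \<delta> \<epsilon> k x + c (k - 1) * integral {\<sigma> k..x} (\<lambda>x. exp (S x / \<epsilon>) * (1 - cutoff \<delta> \<epsilon> k x))"
      using x unfolding rise_def
      by (subst integral_add) (auto intro!: rise_integrable fall_integrable integrable_on_mult_right)
    also have "integral {\<sigma> k..x} (\<lambda>x. exp (S x / \<epsilon>) * (1 - cutoff \<delta> \<epsilon> k x)) + fall \<delta> \<epsilon> k x = fall \<delta> \<epsilon> k (\<sigma> k)"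
      unfolding fall_def using x
      by (intro Henstock_Kurzweil_Integration.integral_combine fall_integrable) auto
    then have "integral {\<sigma> k..x} (\<lambda>x. exp (S x / \<epsilon>) * (1 - cutoff \<delta> \<epsilon> k x)) = fall \<delta> \<epsilon> k (\<sigma> k) - fall \<delta> \<epsilon> k x" by simp
    finally show ?thesis by simp
  qed
  have jump: "c k * resistance \<delta> \<epsilon> k = H (k + 1) - H k" for k
    using resistance_pos[of k] by (simp add: c_def current_def)
  have u_\<sigma>: "u (\<sigma> k) = U k" for k
  proof -
    have step: "u (\<sigma> (k + 1)) - u (\<sigma> k) = U (k + 1) - U k" for k
      using u_diff[of "\<sigma> (k + 1)" k] \<sigma>_le[of k "k + 1"] fall_end[of k] jump[of k]
      by (simp add: U_def resistance_def algebra_simps)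
    show ?thesis
    proof (induction k rule: int_induct[where k = 0])
      case base show ?case by (simp add: u_def)
    next
      case (step1 i) then show ?case using step[of i] by simp
    next
      case (step2 i) then show ?case using step[of "i - 1"] by simp
    qed
  qed
  have ex: "exp (S (x + 1) / \<epsilon>) * exp ?\<beta> = exp (S x / \<epsilon>)" for x
    unfolding S_shift exp_add[symmetric] by (simp add: diff_divide_distrib)
  have u_per: "u (x + 1) = u x" for x
  proof -
    have "((\<lambda>x. u (x + 1) - u x) has_real_derivative 0) (at x)" for x
    proof -
      have "((\<lambda>x. u (x + 1)) has_real_derivative exp (S (x + 1) / \<epsilon>) * \<kappa> (x + 1)) (at x)"
        using u[of "x + 1"] DERIV_shift by blast
      moreover have "exp (S (x + 1) / \<epsilon>) * \<kappa> (x + 1) = exp (S x / \<epsilon>) * \<kappa> x"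
        unfolding \<kappa>_shift using ex[of x] by (metis mult.assoc)
      ultimately show ?thesis by (auto intro!: derivative_eq_intros u)
    qed
    then have "u (x + 1) - u x = u (\<sigma> 0 + 1) - u (\<sigma> 0)"
      using DERIV_isconst_all[of "\<lambda>x. u (x + 1) - u x" x "\<sigma> 0"] by blast
    also have "\<dots> = U (0 + int N) - U 0"
      using \<sigma>_shift[of 0] u_\<sigma>[of "0 + int N"] u_\<sigma>[of 0] by simp
    also have "\<dots> = 0"
      unfolding U_def fall_shift using c_shift[of "0 - 1"] H[of 0]
      by (simp add: exp_minus add.commute)
    finally show ?thesis by simp
  qed
  define u2 where "u2 x = (- (b x / a x) / \<epsilon> * exp (S x / \<epsilon>)) * \<kappa> x + (g x * gibbs \<epsilon> x) * exp (S x / \<epsilon>)" for x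
  have u2: "((\<lambda>x. exp (S x / \<epsilon>) * \<kappa> x) has_real_derivative u2 x) (at x)" for x
    unfolding u2_def using \<epsilon>
    by (intro DERIV_mult \<kappa>) (auto intro!: derivative_eq_intros S_deriv)
  have u2_cont: "continuous_on UNIV u2"
    unfolding u2_def[abs_def] using \<epsilon> continuous_drift
    by (intro continuous_on_add continuous_on_mult continuous_on_divide continuous_on_minus continuous_on_const
        exp_S_continuous \<kappa>_cont g_cont continuous_gibbs) (auto simp: a_nonzero continuous_a torus_C2_continuous[OF b_C2])
  note C2 = torus_C2I[OF u_per u u2 u2_cont]
  have gen: "generator a b \<epsilon> u x = \<epsilon> * g x" for x
  proof -
    have e: "exp (- S x / \<epsilon>) * exp (S x / \<epsilon>) = 1" by (simp add: exp_minus)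
    have "a x * u2 x = - (b x / \<epsilon> * exp (S x / \<epsilon>) * \<kappa> x) + g x * (exp (- S x / \<epsilon>) * exp (S x / \<epsilon>))"
      using a_nonzero[of x] \<epsilon> by (simp add: u2_def gibbs_def field_simps)
    then show ?thesis
      unfolding generator_def C2(3) unfolding C2(2) e using \<epsilon> by (simp add: mult.assoc) (simp add: algebra_simps)
  qed
  show ?thesis
  proof
    show "u \<in> torus_C2" by (rule C2(1))
    show "generator a b \<epsilon> u x = (\<Sum>j\<in>?K. \<epsilon> * (current H j - current H (j - 1)) / bump_mass \<delta> \<epsilon> j * bump \<delta> j x)" for x
      unfolding gen g_def d_def c_def by (simp add: sum_distrib_left mult.assoc)
    show "u x = H k + current H k * rise \<delta> \<epsilon> k x - current H (k - 1) * fall \<delta> \<epsilon> k x" if "x \<in> {\<sigma> k..\<sigma> (k + 1)}" for k x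
      using u_diff[OF that] u_\<sigma>[of k] by (simp add: U_def c_def algebra_simps)
  qed
qed

end

end

section \<open>Lower bound at sums of point masses\<close>

lemma exp_neg_inverse_over_sqrt_tendsto:
  fixes d :: real assumes "d > 0"
  shows "((\<lambda>\<epsilon>. exp (- d / \<epsilon>) / sqrt \<epsilon>) \<longlongrightarrow> 0) (at_right 0)"
proof (rule Lim_null_comparison[OF _ exp_neg_inverse_over_tendsto[OF assms]])
  have "eventually (\<lambda>\<epsilon>. \<epsilon> < (1::real)) (at_right 0)"
    by (rule order_tendstoD(2)[OF tendsto_ident_at]) simp
  then show "\<forall>\<^sub>F \<epsilon> in at_right 0. norm (exp (- d / \<epsilon>) / sqrt \<epsilon>) \<le> exp (- d / \<epsilon>) / \<epsilon>"
    using eventually_at_right_less[of 0]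
  proof eventually_elim
    case (elim \<epsilon>)
    have "\<epsilon> \<le> sqrt \<epsilon>" using elim by (intro real_le_rsqrt) (simp add: power2_eq_square mult_le_one)
    then show ?case using elim by (simp add: divide_left_mono)
  qed
qed

text \<open>
  In the application \<open>s\<close> and \<open>t\<close> are the fractions of the steps towards the two neighbouring wells.
  At every point one of them is negligible, at the bottom of the well both are.
\<close>

lemma interpolation_bounds:
  fixes h h1 h2 s t \<tau> lo hi :: real
  assumes h: "0 < lo" "lo \<le> h" "lo \<le> h1" "lo \<le> h2" "h \<le> hi" "h1 \<le> hi" "h2 \<le> hi"
    and st: "0 \<le> s" "s \<le> 1" "0 \<le> t" "t \<le> 1"
  defines "u \<equiv> h + (h1 - h) * s + (h2 - h) * t"
  shows "s \<le> \<tau> \<or> t \<le> \<tau> \<Longrightarrow> lo - hi * \<tau> \<le> u"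
    and "s \<le> \<tau> \<Longrightarrow> t \<le> \<tau> \<Longrightarrow> \<bar>u - h\<bar> \<le> 2 * hi * \<tau>"
proof -
  have *: "lo - hi * \<tau> \<le> h + (x - h) * s + (y - h) * t"
    if "s \<le> \<tau>" "0 \<le> s" "0 \<le> t" "t \<le> 1" "lo \<le> x" "x \<le> hi" "lo \<le> y" for s t x y
  proof -
    have "lo * (1 - t) \<le> h * (1 - t)" "lo * t \<le> y * t" using that h by (intro mult_right_mono; simp)+
    then have 1: "lo \<le> h + (y - h) * t" by (simp add: algebra_simps)
    have "- hi * s \<le> (x - h) * s" using that h by (intro mult_right_mono) auto
    moreover have "hi * s \<le> hi * \<tau>" using that h by (intro mult_left_mono) auto
    ultimately show ?thesis using 1 by simp
  qed
  show "lo - hi * \<tau> \<le> u" if "s \<le> \<tau> \<or> t \<le> \<tau>"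
    using that *[of s t h1 h2] *[of t s h2 h1] st h unfolding u_def by (auto simp: add_ac)
  show "\<bar>u - h\<bar> \<le> 2 * hi * \<tau>" if "s \<le> \<tau>" "t \<le> \<tau>"
  proof -
    have "\<bar>(h1 - h) * s\<bar> \<le> hi * \<tau>" "\<bar>(h2 - h) * t\<bar> \<le> hi * \<tau>"
      unfolding abs_mult using h st that by (intro mult_mono; simp)+
    then show ?thesis unfolding u_def by linarith
  qed
qed

context landscape
begin

lemma bump_gap_negligible:
  assumes \<delta>: "well_radius \<delta>" and s: "S (m k - \<delta>) < s" "S (m k + \<delta>) < s"
  shows "((\<lambda>\<epsilon>. bump_gap \<delta> \<epsilon> k * exp (- s / \<epsilon>) / sqrt \<epsilon>) \<longlongrightarrow> 0) (at_right 0)"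
proof -
  define B where "B = max (S (m k - \<delta>)) (S (m k + \<delta>))"
  have d: "s - B > 0" using s by (simp add: B_def)
  have d0: "\<delta> > 0" using \<delta> by (simp add: well_radius_def)
  have SB: "S z \<le> B" if z: "z \<in> {m k - \<delta>..m k + \<delta>}" for z
  proof -
    have r: "\<sigma> k < m k - \<delta>" "m k + \<delta> < \<sigma> (k + 1)" using \<delta> by (auto simp: well_radius_def)
    show ?thesis
    proof (cases "z \<le> m k")
      case True
      then have "S z \<le> S (m k - \<delta>)" using S_decreasing[of k "m k - \<delta>" z] z r by (cases "z = m k - \<delta>") auto
      then show ?thesis by (simp add: B_def)
    next
      case False
      then have "S z \<le> S (m k + \<delta>)" using S_increasing[of k z "m k + \<delta>"] z r by (cases "z = m k + \<delta>") auto
      then show ?thesis by (simp add: B_def)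
    qed
  qed
  show ?thesis
  proof (rule Lim_null_comparison)
    show "((\<lambda>\<epsilon>. 2 * \<delta> * (exp (- (s - B) / \<epsilon>) / sqrt \<epsilon>)) \<longlongrightarrow> 0) (at_right 0)"
      using tendsto_mult_right_zero[OF exp_neg_inverse_over_sqrt_tendsto[OF d]] by simp
    show "\<forall>\<^sub>F \<epsilon> in at_right 0. norm (bump_gap \<delta> \<epsilon> k * exp (- s / \<epsilon>) / sqrt \<epsilon>) \<le> 2 * \<delta> * (exp (- (s - B) / \<epsilon>) / sqrt \<epsilon>)"
      using eventually_at_right_less[of 0]
    proof eventually_elim
      case (elim \<epsilon>)
      have gap: "bump_gap \<delta> \<epsilon> k = integral {m k - \<delta>..m k + \<delta>} (\<lambda>x. exp (S x / \<epsilon>))"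
        unfolding bump_gap_def[OF \<delta> elim] using d0 by (intro integral_exp_S[OF \<delta> elim, symmetric]) simp
      have "bump_gap \<delta> \<epsilon> k \<le> integral {m k - \<delta>..m k + \<delta>} (\<lambda>x. exp (B / \<epsilon>))"
        unfolding gap using SB elim
        by (intro integral_le integrable_continuous_interval exp_S_continuous continuous_on_const) (auto simp: divide_right_mono)
      also have "\<dots> = 2 * \<delta> * exp (B / \<epsilon>)" using d0 by simp
      finally have le: "bump_gap \<delta> \<epsilon> k \<le> 2 * \<delta> * exp (B / \<epsilon>)" .
      have "0 \<le> bump_gap \<delta> \<epsilon> k"
        unfolding gap by (intro integral_nonneg integrable_continuous_interval exp_S_continuous) simp
      then have "norm (bump_gap \<delta> \<epsilon> k * exp (- s / \<epsilon>) / sqrt \<epsilon>) = bump_gap \<delta> \<epsilon> k * exp (- s / \<epsilon>) / sqrt \<epsilon>"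
        using elim by simp
      also have "\<dots> \<le> 2 * \<delta> * exp (B / \<epsilon>) * exp (- s / \<epsilon>) / sqrt \<epsilon>"
        using le elim by (intro divide_right_mono mult_right_mono) auto
      also have "\<dots> = 2 * \<delta> * (exp (- (s - B) / \<epsilon>) / sqrt \<epsilon>)"
        by (simp add: exp_add[symmetric] mult.assoc diff_divide_distrib)
      finally show ?case .
    qed
  qed
qed

lemma well_radius_saddles:
  assumes \<delta>: "well_radius \<delta>"
  shows "S (m k - \<delta>) < S (\<sigma> k)" "S (m k + \<delta>) < S (\<sigma> k)"
    "S (m k - \<delta>) < S (\<sigma> (k + 1))" "S (m k + \<delta>) < S (\<sigma> (k + 1))"
proof -
  have r: "0 < \<delta>" "\<sigma> k < m k - \<delta>" "m k + \<delta> < \<sigma> (k + 1)" "S (m k - \<delta>) < S (\<sigma> (k + 1))" "S (m k + \<delta>) < S (\<sigma> k)"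
    using \<delta> by (auto simp: well_radius_def)
  show "S (m k - \<delta>) < S (\<sigma> k)" "S (m k + \<delta>) < S (\<sigma> k)"
    "S (m k - \<delta>) < S (\<sigma> (k + 1))" "S (m k + \<delta>) < S (\<sigma> (k + 1))"
    using r S_decreasing[of k "\<sigma> k" "m k - \<delta>"] S_increasing[of k "m k + \<delta>" "\<sigma> (k + 1)"] by auto
qed

lemma resistance_asymp:
  assumes \<delta>: "well_radius \<delta>"
  shows "((\<lambda>\<epsilon>. resistance \<delta> \<epsilon> k * exp (- S (\<sigma> (k + 1)) / \<epsilon>) / sqrt \<epsilon>)
     \<longlongrightarrow> sqrt (2 * pi / - deriv (deriv S) (\<sigma> (k + 1)))) (at_right 0)"
proof -
  let ?w = "\<lambda>\<epsilon>. exp (- S (\<sigma> (k + 1)) / \<epsilon>) / sqrt \<epsilon>"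
  have "((\<lambda>\<epsilon>. (resistance \<delta> \<epsilon> k - saddle_int \<epsilon> k) * ?w \<epsilon>) \<longlongrightarrow> 0) (at_right 0)"
  proof (rule Lim_null_comparison)
    have "((\<lambda>\<epsilon>. bump_gap \<delta> \<epsilon> k * exp (- S (\<sigma> (k + 1)) / \<epsilon>) / sqrt \<epsilon> + bump_gap \<delta> \<epsilon> (k + 1) * exp (- S (\<sigma> (k + 1)) / \<epsilon>) / sqrt \<epsilon>)
        \<longlongrightarrow> 0 + 0) (at_right 0)"
      using well_radius_saddles[OF \<delta>] by (intro tendsto_add bump_gap_negligible \<delta>)
    then show "((\<lambda>\<epsilon>. (bump_gap \<delta> \<epsilon> k + bump_gap \<delta> \<epsilon> (k + 1)) * ?w \<epsilon>) \<longlongrightarrow> 0) (at_right 0)"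
      by (simp add: distrib_right add_divide_distrib)
    show "\<forall>\<^sub>F \<epsilon> in at_right 0. norm ((resistance \<delta> \<epsilon> k - saddle_int \<epsilon> k) * ?w \<epsilon>) \<le> (bump_gap \<delta> \<epsilon> k + bump_gap \<delta> \<epsilon> (k + 1)) * ?w \<epsilon>"
      using eventually_at_right_less[of 0]
    proof eventually_elim
      case (elim \<epsilon>)
      have "norm ((resistance \<delta> \<epsilon> k - saddle_int \<epsilon> k) * ?w \<epsilon>) = \<bar>resistance \<delta> \<epsilon> k - saddle_int \<epsilon> k\<bar> * ?w \<epsilon>"
        using elim by (simp add: abs_mult)
      also have "\<dots> \<le> (bump_gap \<delta> \<epsilon> k + bump_gap \<delta> \<epsilon> (k + 1)) * ?w \<epsilon>"
        using resistance_close[OF \<delta> elim] elim by (intro mult_right_mono) auto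
      finally show ?case .
    qed
  qed
  from tendsto_add[OF saddle_int_asymp[of k] this] show ?thesis
    by (simp add: algebra_simps diff_divide_distrib)
qed

lemma bump_mass_asymp:
  assumes \<delta>: "well_radius \<delta>"
  shows "((\<lambda>\<epsilon>. bump_mass \<delta> \<epsilon> k * exp (S (m k) / \<epsilon>) / sqrt \<epsilon>) \<longlongrightarrow> well_weight a S m k) (at_right 0)"
proof -
  have "bump \<delta> k (m k) = 1" by (rule bump_at_min[OF \<delta>, of 1]) simp
  then show ?thesis
    using well_laplace[of "\<lambda>x. bump \<delta> k x * (1 / a x)" k]
    by (simp add: well_weight_def bump_mass_def gibbs_def[abs_def] a_nonzero continuous_intros continuous_bump)
qed

lemma test_rate_limits:
  assumes \<delta>: "well_radius \<delta>"
  shows "((\<lambda>\<epsilon>. exp (\<h> / \<epsilon>) * (\<epsilon> / (bump_mass \<delta> \<epsilon> k * resistance \<delta> \<epsilon> k))) \<longlongrightarrow> jump_rate a S m \<sigma> k (k + 1)) (at_right 0)"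
    and "((\<lambda>\<epsilon>. exp (\<h> / \<epsilon>) * (\<epsilon> / (bump_mass \<delta> \<epsilon> k * resistance \<delta> \<epsilon> (k - 1)))) \<longlongrightarrow> jump_rate a S m \<sigma> k (k - 1)) (at_right 0)"
proof -
  show "((\<lambda>\<epsilon>. exp (\<h> / \<epsilon>) * (\<epsilon> / (bump_mass \<delta> \<epsilon> k * resistance \<delta> \<epsilon> k))) \<longlongrightarrow> jump_rate a S m \<sigma> k (k + 1)) (at_right 0)"
    unfolding jump_rate_right using curvature_\<sigma>[of "k + 1"]
    by (intro arrhenius_limit bump_mass_asymp resistance_asymp \<delta> well_weight_pos barrier_right_ge)
       (simp add: divide_pos_neg)
  have "((\<lambda>\<epsilon>. exp (\<h> / \<epsilon>) * (\<epsilon> / (bump_mass \<delta> \<epsilon> (k - 1 + 1) * resistance \<delta> \<epsilon> (k - 1)))) \<longlongrightarrow> jump_rate a S m \<sigma> (k - 1 + 1) (k - 1)) (at_right 0)"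
    unfolding jump_rate_left using curvature_\<sigma>[of "k - 1 + 1"] barrier_left_ge[of "k - 1 + 1"]
    by (intro arrhenius_limit bump_mass_asymp resistance_asymp \<delta> well_weight_pos) (simp_all add: divide_pos_neg)
  then show "((\<lambda>\<epsilon>. exp (\<h> / \<epsilon>) * (\<epsilon> / (bump_mass \<delta> \<epsilon> k * resistance \<delta> \<epsilon> (k - 1)))) \<longlongrightarrow> jump_rate a S m \<sigma> k (k - 1)) (at_right 0)"
    by simp
qed

lemma bump_gap_ratio:
  assumes \<delta>: "well_radius \<delta>"
  shows "((\<lambda>\<epsilon>. bump_gap \<delta> \<epsilon> k / resistance \<delta> \<epsilon> k) \<longlongrightarrow> 0) (at_right 0)"
    and "((\<lambda>\<epsilon>. bump_gap \<delta> \<epsilon> k / resistance \<delta> \<epsilon> (k - 1)) \<longlongrightarrow> 0) (at_right 0)"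
proof -
  have *: "((\<lambda>\<epsilon>. bump_gap \<delta> \<epsilon> k / resistance \<delta> \<epsilon> i) \<longlongrightarrow> 0) (at_right 0)"
    if "S (m k - \<delta>) < S (\<sigma> (i + 1))" "S (m k + \<delta>) < S (\<sigma> (i + 1))" for i
  proof -
    have "((\<lambda>\<epsilon>. (bump_gap \<delta> \<epsilon> k * exp (- S (\<sigma> (i + 1)) / \<epsilon>) / sqrt \<epsilon>) / (resistance \<delta> \<epsilon> i * exp (- S (\<sigma> (i + 1)) / \<epsilon>) / sqrt \<epsilon>))
      \<longlongrightarrow> 0 / sqrt (2 * pi / - deriv (deriv S) (\<sigma> (i + 1)))) (at_right 0)"
      using curvature_\<sigma>[of "i + 1"]
      by (intro tendsto_divide bump_gap_negligible resistance_asymp \<delta> that) auto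
    then have "((\<lambda>\<epsilon>. (bump_gap \<delta> \<epsilon> k * exp (- S (\<sigma> (i + 1)) / \<epsilon>) / sqrt \<epsilon>) / (resistance \<delta> \<epsilon> i * exp (- S (\<sigma> (i + 1)) / \<epsilon>) / sqrt \<epsilon>))
      \<longlongrightarrow> 0) (at_right 0)" by simp
    then show ?thesis
      by (rule Lim_transform_eventually) (use eventually_at_right_less[of 0] in eventually_elim, simp)
  qed
  show "((\<lambda>\<epsilon>. bump_gap \<delta> \<epsilon> k / resistance \<delta> \<epsilon> k) \<longlongrightarrow> 0) (at_right 0)"
    using well_radius_saddles[OF \<delta>] by (intro *)
  show "((\<lambda>\<epsilon>. bump_gap \<delta> \<epsilon> k / resistance \<delta> \<epsilon> (k - 1)) \<longlongrightarrow> 0) (at_right 0)"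
    using well_radius_saddles[OF \<delta>] by (intro *) auto
qed

text \<open>
  On the bump \<open>u\<close> is close to \<open>H k\<close>, because the scale increases much less across the bump than
  across either adjacent maximum; outside the bumps both \<open>L u\<close> and
  the limit vanish.
\<close>

lemma well_test_uniform:
  fixes H :: "int \<Rightarrow> real"
  assumes \<delta>: "well_radius \<delta>" and H: "\<And>k. H (k + int N) = H k" "\<And>k. 0 < H k" and \<eta>: "\<eta> > 0"
  defines "G \<equiv> \<lambda>k. jump_rate a S m \<sigma> k (k + 1) * (H (k + 1) - H k) + jump_rate a S m \<sigma> k (k - 1) * (H (k - 1) - H k)"
  shows "\<forall>\<^sub>F \<epsilon> in at_right 0. \<exists>u\<in>torus_C2. (\<forall>x. 0 < u x) \<and>
    (\<forall>x. \<bar>exp (\<h> / \<epsilon>) * (generator a b \<epsilon> u x / u x) - (\<Sum>j\<in>{0..<int N}. G j / H j * bump \<delta> j x)\<bar> \<le> \<eta>)"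
proof -
  let ?K = "{0..<int N}"
  have K: "finite (H ` ?K)" "H ` ?K \<noteq> {}" using N_pos by auto
  have H_in: "H k \<in> H ` ?K" for k
    using int_periodic_mod[of H, OF H(1)] N_pos by (intro image_eqI[of _ _ "k mod int N"]) auto
  define lo where "lo = Min (H ` ?K)"
  define hi where "hi = Max (H ` ?K)"
  have lo: "lo \<le> H k" and hi: "H k \<le> hi" for k
    unfolding lo_def hi_def using K(1) H_in by (auto intro: Min_le Max_ge)
  have lo_pos: "0 < lo" unfolding lo_def using K H(2) by (subst Min_gr_iff) auto
  have hi_pos: "0 < hi" using lo[of 0] hi[of 0] lo_pos by linarith
  define Gh where "Gh \<epsilon> k = exp (\<h> / \<epsilon>) * (\<epsilon> * (current \<delta> \<epsilon> H k - current \<delta> \<epsilon> H (k - 1)) / bump_mass \<delta> \<epsilon> k)" for \<epsilon> k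
  define \<tau> where "\<tau> \<epsilon> k = bump_gap \<delta> \<epsilon> k / resistance \<delta> \<epsilon> k + bump_gap \<delta> \<epsilon> k / resistance \<delta> \<epsilon> (k - 1)" for \<epsilon> k
  define e where "e \<epsilon> k = 2 * \<bar>Gh \<epsilon> k - G k\<bar> / lo + \<bar>G k\<bar> * (2 * hi * \<tau> \<epsilon> k) * 2 / lo^2" for \<epsilon> k
  have Gh_lim: "((\<lambda>\<epsilon>. Gh \<epsilon> k) \<longlongrightarrow> G k) (at_right 0)" for k
  proof -
    have "((\<lambda>\<epsilon>. exp (\<h> / \<epsilon>) * (\<epsilon> / (bump_mass \<delta> \<epsilon> k * resistance \<delta> \<epsilon> k)) * (H (k + 1) - H k)
        + exp (\<h> / \<epsilon>) * (\<epsilon> / (bump_mass \<delta> \<epsilon> k * resistance \<delta> \<epsilon> (k - 1))) * (H (k - 1) - H k)) \<longlongrightarrow> G k) (at_right 0)"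
      unfolding G_def by (intro tendsto_intros test_rate_limits \<delta>)
    then show ?thesis
    proof (rule Lim_transform_eventually)
      show "\<forall>\<^sub>F \<epsilon> in at_right 0. exp (\<h> / \<epsilon>) * (\<epsilon> / (bump_mass \<delta> \<epsilon> k * resistance \<delta> \<epsilon> k)) * (H (k + 1) - H k)
        + exp (\<h> / \<epsilon>) * (\<epsilon> / (bump_mass \<delta> \<epsilon> k * resistance \<delta> \<epsilon> (k - 1))) * (H (k - 1) - H k) = Gh \<epsilon> k"
        using eventually_at_right_less[of 0]
      proof eventually_elim
        case (elim \<epsilon>)
        show ?case unfolding Gh_def current_def[OF \<delta> elim]
          using resistance_pos[OF \<delta> elim, of k] resistance_pos[OF \<delta> elim, of "k - 1"] bump_mass_pos[OF \<delta> elim, of k]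
          by (simp add: field_simps)
      qed
    qed
  qed
  have \<tau>_lim: "((\<lambda>\<epsilon>. \<tau> \<epsilon> k) \<longlongrightarrow> 0) (at_right 0)" for k
    unfolding \<tau>_def using tendsto_add[OF bump_gap_ratio[OF \<delta>, of k]] by simp
  have "((\<lambda>\<epsilon>. e \<epsilon> k) \<longlongrightarrow> 2 * \<bar>G k - G k\<bar> / lo + \<bar>G k\<bar> * (2 * hi * 0) * 2 / lo^2) (at_right 0)" for k
    unfolding e_def using lo_pos by (intro tendsto_intros Gh_lim \<tau>_lim) auto
  then have "((\<lambda>\<epsilon>. e \<epsilon> k) \<longlongrightarrow> 0) (at_right 0)" for k by simp
  from order_tendstoD(2)[OF this \<eta>] have e_ev: "\<forall>\<^sub>F \<epsilon> in at_right 0. \<forall>k\<in>?K. e \<epsilon> k < \<eta>"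
    by (intro eventually_ball_finite) auto
  have "((\<lambda>\<epsilon>. 2 * hi * \<tau> \<epsilon> k) \<longlongrightarrow> 0) (at_right 0)" for k
    using tendsto_mult_right_zero[OF \<tau>_lim] by blast
  from order_tendstoD(2)[OF this, of "lo / 2"] have \<tau>_ev: "\<forall>\<^sub>F \<epsilon> in at_right 0. \<forall>k\<in>?K. 2 * hi * \<tau> \<epsilon> k < lo / 2"
    using lo_pos by (intro eventually_ball_finite) auto
  show ?thesis
    using e_ev \<tau>_ev eventually_at_right_less[of 0]
  proof eventually_elim
    case (elim \<epsilon>)
    note \<epsilon> = elim(3)
    obtain u where u: "u \<in> torus_C2"
      "\<And>x. generator a b \<epsilon> u x = (\<Sum>j\<in>?K. \<epsilon> * (current \<delta> \<epsilon> H j - current \<delta> \<epsilon> H (j - 1)) / bump_mass \<delta> \<epsilon> j * bump \<delta> j x)"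
      "\<And>k x. x \<in> {\<sigma> k..\<sigma> (k + 1)} \<Longrightarrow> u x = H k + current \<delta> \<epsilon> H k * rise \<delta> \<epsilon> k x - current \<delta> \<epsilon> H (k - 1) * fall \<delta> \<epsilon> k x"
      using well_test_function[where H = H, OF \<delta> \<epsilon> H(1)] by blast
    define F where "F x = (\<Sum>j\<in>?K. G j / H j * bump \<delta> j x)" for x
    have local: "0 < u x \<and> \<bar>exp (\<h> / \<epsilon>) * (generator a b \<epsilon> u x / u x) - F x\<bar> \<le> \<eta>"
      if k: "k \<in> ?K" and x: "x \<in> {\<sigma> k..\<sigma> (k + 1)}" for k x
    proof -
      define s where "s = rise \<delta> \<epsilon> k x / resistance \<delta> \<epsilon> k"
      define t where "t = fall \<delta> \<epsilon> k x / resistance \<delta> \<epsilon> (k - 1)"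
      have res: "0 < resistance \<delta> \<epsilon> k" "0 < resistance \<delta> \<epsilon> (k - 1)" by (rule resistance_pos[OF \<delta> \<epsilon>])+
      have st: "0 \<le> s" "s \<le> 1" "0 \<le> t" "t \<le> 1"
        using rise_fall_bounds[OF \<delta> \<epsilon> x] resistance_ge(1)[OF \<delta> \<epsilon>, of k] resistance_ge(2)[OF \<delta> \<epsilon>, of "k - 1"] res
        by (simp_all add: s_def t_def divide_le_eq_1_pos)
      have ux: "u x = H k + (H (k + 1) - H k) * s + (H (k - 1) - H k) * t"
        unfolding u(3)[OF x] current_def[OF \<delta> \<epsilon>] s_def t_def by (simp add: algebra_simps diff_divide_distrib)
      have d0: "0 < \<delta>" using \<delta> by (simp add: well_radius_def)
      have gap: "0 \<le> bump_gap \<delta> \<epsilon> k"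
        unfolding bump_gap_def[OF \<delta> \<epsilon>] using d0 scale_le[of "m k - \<delta>" "m k + \<delta>" \<epsilon>] by simp
      have s_le: "s \<le> \<tau> \<epsilon> k" if "x \<le> m k + \<delta>"
      proof -
        have "s \<le> bump_gap \<delta> \<epsilon> k / resistance \<delta> \<epsilon> k"
          unfolding s_def using rise_left[OF \<delta> \<epsilon>, of k x] that x res by (intro divide_right_mono) auto
        also have "\<dots> \<le> \<tau> \<epsilon> k" using gap res by (simp add: \<tau>_def)
        finally show ?thesis .
      qed
      have t_le: "t \<le> \<tau> \<epsilon> k" if "m k - \<delta> \<le> x"
      proof -
        have "t \<le> bump_gap \<delta> \<epsilon> k / resistance \<delta> \<epsilon> (k - 1)"
          unfolding t_def using fall_right[OF \<delta> \<epsilon>, of k x] that x res by (intro divide_right_mono) auto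
        also have "\<dots> \<le> \<tau> \<epsilon> k" using gap res by (simp add: \<tau>_def)
        finally show ?thesis .
      qed
      note ib = interpolation_bounds[where h = "H k" and ?h1.0 = "H (k + 1)" and ?h2.0 = "H (k - 1)" and \<tau> = "\<tau> \<epsilon> k",
          OF lo_pos lo lo lo hi hi hi st, folded ux]
      have \<tau>_nonneg: "0 \<le> \<tau> \<epsilon> k" using gap res by (simp add: \<tau>_def)
      have "lo - hi * \<tau> \<epsilon> k \<le> u x"
        using s_le t_le d0 by (intro ib(1)) (cases "x \<le> m k", auto)
      moreover have "2 * hi * \<tau> \<epsilon> k < lo / 2" using elim(2) k by blast
      moreover have "0 \<le> hi * \<tau> \<epsilon> k" using hi_pos \<tau>_nonneg by simp
      ultimately have u_ge: "lo / 2 \<le> u x" by linarith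
      have u_pos: "0 < u x" using u_ge lo_pos by linarith
      have only_k: "(\<Sum>j\<in>?K. f j * bump \<delta> j x) = f k * bump \<delta> k x" for f
      proof -
        have "(\<Sum>j\<in>?K. f j * bump \<delta> j x) = (\<Sum>j\<in>?K. if j = k then f k * bump \<delta> k x else 0)"
          using bump_support(2)[OF \<delta> \<epsilon> x] k by (intro sum.cong refl) fastforce
        then show ?thesis using k by simp
      qed
      have gen: "exp (\<h> / \<epsilon>) * (generator a b \<epsilon> u x / u x) - F x = bump \<delta> k x * (Gh \<epsilon> k / u x - G k / H k)"
        unfolding u(2) F_def only_k Gh_def by (simp add: algebra_simps)
      have "\<bar>bump \<delta> k x * (Gh \<epsilon> k / u x - G k / H k)\<bar> \<le> \<eta>"
      proof (cases "bump \<delta> k x = 0")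
        case False
        have near: "\<bar>x - m k\<bar> < \<delta>" by (rule bump_support(1)[OF \<delta> \<epsilon> x False])
        have dist: "\<bar>u x - H k\<bar> \<le> 2 * hi * \<tau> \<epsilon> k" using near by (intro ib(2) s_le t_le) auto
        have eq: "Gh \<epsilon> k / u x - G k / H k = (Gh \<epsilon> k - G k) / u x + G k * (H k - u x) / (u x * H k)"
          using u_pos H(2)[of k] by (simp add: field_simps)
        have "\<bar>(Gh \<epsilon> k - G k) / u x\<bar> \<le> \<bar>Gh \<epsilon> k - G k\<bar> / (lo / 2)"
          unfolding abs_divide using u_ge lo_pos by (intro divide_left_mono) auto
        then have 1: "\<bar>(Gh \<epsilon> k - G k) / u x\<bar> \<le> 2 * \<bar>Gh \<epsilon> k - G k\<bar> / lo" by (simp add: mult.commute)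
        have "\<bar>G k * (H k - u x) / (u x * H k)\<bar> \<le> \<bar>G k\<bar> * (2 * hi * \<tau> \<epsilon> k) / (lo / 2 * lo)"
          unfolding abs_divide abs_mult using dist u_ge lo_pos lo[of k] u_pos hi_pos \<tau>_nonneg
          by (intro frac_le mult_mono mult_nonneg_nonneg mult_pos_pos) auto
        also have "\<dots> = \<bar>G k\<bar> * (2 * hi * \<tau> \<epsilon> k) * 2 / lo^2" by (simp add: power2_eq_square)
        finally have "\<bar>Gh \<epsilon> k / u x - G k / H k\<bar> \<le> e \<epsilon> k"
          unfolding eq e_def using 1 by linarith
        also have "\<dots> \<le> \<eta>" using elim(1) k by (simp add: less_imp_le)
        finally have le: "\<bar>Gh \<epsilon> k / u x - G k / H k\<bar> \<le> \<eta>" .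
        have "\<bar>bump \<delta> k x * (Gh \<epsilon> k / u x - G k / H k)\<bar> \<le> 1 * \<eta>"
          unfolding abs_mult using bump_bounds[OF \<delta> \<epsilon>, of k x] le by (intro mult_mono) auto
        then show ?thesis by simp
      qed (use \<eta> in simp)
      then show ?thesis using u_pos gen by simp
    qed
    have "0 < u x \<and> \<bar>exp (\<h> / \<epsilon>) * (generator a b \<epsilon> u x / u x) - F x\<bar> \<le> \<eta>" for x
    proof -
      define n where "n = \<lfloor>x - \<sigma> 0\<rfloor>"
      define y where "y = x - of_int n"
      have "\<sigma> 0 \<le> y" "y < \<sigma> 0 + 1" unfolding y_def n_def by linarith+
      then obtain k where k: "k \<in> ?K" "\<sigma> k \<le> y" "y < \<sigma> (k + 1)" by (rule cover_period)
      have "0 < u y \<and> \<bar>exp (\<h> / \<epsilon>) * (generator a b \<epsilon> u y / u y) - F y\<bar> \<le> \<eta>"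
        using k by (intro local) auto
      moreover have "u (y + of_int n) = u y" by (rule periodic_of_int) (rule torus_C2_periodic[OF u(1)])
      moreover have "bump \<delta> j (y + of_int n) = bump \<delta> j y" for j by (rule periodic_of_int) (rule bump_periodic)
      moreover have "x = y + of_int n" by (simp add: y_def)
      ultimately show ?thesis by (simp add: u(2) F_def)
    qed
    then show ?case using u(1) unfolding F_def by blast
  qed
qed

lemma Liminf_ge_chain:
  assumes \<mu>: "\<mu> \<in> torus_prob" and M: "\<And>\<epsilon>. \<epsilon> > 0 \<Longrightarrow> M \<epsilon> \<in> torus_prob" and conv: "torus_weak_conv M \<mu> (at_right 0)"
    and \<omega>: "prob_vector N \<omega>" "is_dirac_sum N (\<lambda>k. frac (m k)) \<omega> \<mu>"
  shows "chain_rate_functional (jump_rate a S m \<sigma>) N \<omega>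
    \<le> Liminf (at_right 0) (\<lambda>\<epsilon>. ereal (exp (\<h> / \<epsilon>)) * rate_functional a b \<epsilon> (M \<epsilon>))"
  unfolding chain_rate_functional_def
proof (rule SUP_least)
  let ?K = "{0..<int N}" and ?R = "jump_rate a S m \<sigma>"
  fix H0 :: "int \<Rightarrow> real" assume "H0 \<in> {H. \<forall>k\<in>?K. 0 < H k}"
  then have H0: "\<And>k. k \<in> ?K \<Longrightarrow> 0 < H0 k" by blast
  obtain \<delta> where \<delta>: "well_radius \<delta>" using well_radius_exists by blast
  define H where "H k = H0 (k mod int N)" for k
  have H: "H (k + int N) = H k" "0 < H k" for k
    using H0 N_pos by (simp_all add: H_def)
  have H_eq: "H k = H0 k" if "k \<in> ?K" for k using that by (simp add: H_def)
  define G where "G k = ?R k (k + 1) * (H (k + 1) - H k) + ?R k (k - 1) * (H (k - 1) - H k)" for k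
  define F where "F x = (\<Sum>j\<in>?K. G j / H j * bump \<delta> j x)" for x
  have F: "F \<in> torus_continuous"
    unfolding F_def[abs_def]
    by (intro torus_continuousI continuous_intros continuous_bump) (simp add: bump_periodic)
  have F_m: "F (m k) = G k / H k" if k: "k \<in> ?K" for k
  proof -
    have "F (m k) = (\<Sum>j\<in>?K. if j = k then G k / H k else 0)"
      unfolding F_def
    proof (intro sum.cong refl)
      fix j assume j: "j \<in> ?K"
      have "bump \<delta> k (m k) = 1" by (rule bump_at_min[OF \<delta>, of 1]) simp
      moreover have "bump \<delta> j (m k) = 0" if "j \<noteq> k"
        using bump_support(2)[OF \<delta> zero_less_one, of "m k" k j] \<sigma>_less_m[of k] m_less_\<sigma>[of k] that j k by fastforce
      ultimately show "G j / H j * bump \<delta> j (m k) = (if j = k then G k / H k else 0)" by auto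
    qed
    then show ?thesis using k by simp
  qed
  have "- (\<Sum>k\<in>?K. chain_generator ?R N H0 k / H0 k * \<omega> k) = - (\<Sum>k\<in>?K. \<omega> k * F (m k))"
  proof -
    have "chain_generator ?R N H0 k / H0 k * \<omega> k = \<omega> k * F (m k)" if k: "k \<in> ?K" for k
    proof -
      have "chain_generator ?R N H0 k = G k"
        unfolding chain_generator_def G_def H_def using k by simp
      then show ?thesis using F_m[OF k] H_eq[OF k] by simp
    qed
    then show ?thesis by simp
  qed
  also have "\<dots> = - (\<integral>x. F x \<partial>\<mu>)" using dirac_sum_integral[OF \<mu> \<omega> F] by simp
  finally have eq: "- (\<Sum>k\<in>?K. chain_generator ?R N H0 k / H0 k * \<omega> k) = - (\<integral>x. F x \<partial>\<mu>)" .
  show "ereal (- (\<Sum>k\<in>?K. chain_generator ?R N H0 k / H0 k * \<omega> k))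
    \<le> Liminf (at_right 0) (\<lambda>\<epsilon>. ereal (exp (\<h> / \<epsilon>)) * rate_functional a b \<epsilon> (M \<epsilon>))" (is "_ \<le> ?L")
    unfolding eq
  proof (rule ereal_le_epsilon2)
    fix e :: real assume e: "0 < e"
    define \<eta> where "\<eta> = e / 2"
    have \<eta>: "\<eta> > 0" using e by (simp add: \<eta>_def)
    have "((\<lambda>\<epsilon>. \<integral>x. F x \<partial>M \<epsilon>) \<longlongrightarrow> (\<integral>x. F x \<partial>\<mu>)) (at_right 0)"
      using conv F by (simp add: torus_weak_conv_def)
    then have ev: "\<forall>\<^sub>F \<epsilon> in at_right 0. (\<integral>x. F x \<partial>M \<epsilon>) < (\<integral>x. F x \<partial>\<mu>) + \<eta>"
      using \<eta> by (intro order_tendstoD(2)) auto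
    have "\<forall>\<^sub>F \<epsilon> in at_right 0. ereal (- (\<integral>x. F x \<partial>\<mu>) - e) \<le> ereal (exp (\<h> / \<epsilon>)) * rate_functional a b \<epsilon> (M \<epsilon>)"
      using ev well_test_uniform[where H = H, OF \<delta> H \<eta>] eventually_at_right_less[of 0]
    proof eventually_elim
      case (elim \<epsilon>)
      define p where "p = exp (\<h> / \<epsilon>)"
      have p: "p > 0" by (simp add: p_def)
      obtain u where u: "u \<in> torus_C2" "\<And>x. 0 < u x" "\<And>x. \<bar>p * (generator a b \<epsilon> u x / u x) - F x\<bar> \<le> \<eta>"
        using elim(2) unfolding F_def G_def p_def by blast
      have "(\<lambda>x. - (F x / p)) \<in> torus_continuous"
        using F p by (auto simp: torus_continuous_def intro!: continuous_intros)
      then have "ereal ((\<integral>x. - (F x / p) \<partial>M \<epsilon>) - \<eta> / p) \<le> rate_functional a b \<epsilon> (M \<epsilon>)"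
      proof (rule rate_functional_ge[OF a_C2 b_C2 u(1,2) M[OF elim(3)]])
        fix x
        have "p * (generator a b \<epsilon> u x / u x) \<le> F x + \<eta>" using u(3)[of x] by linarith
        then show "generator a b \<epsilon> u x / u x \<le> \<eta> / p - - (F x / p)"
          using p by (simp add: field_simps)
      qed
      then have "ereal p * ereal ((\<integral>x. - (F x / p) \<partial>M \<epsilon>) - \<eta> / p) \<le> ereal p * rate_functional a b \<epsilon> (M \<epsilon>)"
        using p by (intro ereal_mult_left_mono) auto
      moreover have "p * ((\<integral>x. - (F x / p) \<partial>M \<epsilon>) - \<eta> / p) = - (\<integral>x. F x \<partial>M \<epsilon>) - \<eta>"
        using p by (simp add: field_simps)
      moreover have "- (\<integral>x. F x \<partial>\<mu>) - e \<le> - (\<integral>x. F x \<partial>M \<epsilon>) - \<eta>"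
        using elim(1) by (simp add: \<eta>_def)
      ultimately show ?case unfolding p_def[symmetric] by (metis ereal_less_eq(3) order_trans times_ereal.simps(1))
    qed
    then have "ereal (- (\<integral>x. F x \<partial>\<mu>) - e) \<le> ?L" by (rule Liminf_bounded)
    then have "ereal (- (\<integral>x. F x \<partial>\<mu>) - e) + ereal e \<le> ?L + ereal e" by (rule add_right_mono)
    then show "ereal (- (\<integral>x. F x \<partial>\<mu>)) \<le> ?L + ereal e" by simp
  qed
qed

theorem gamma_convergence:
  "gamma_converges (\<lambda>\<epsilon> \<mu>. ereal (exp (\<h> / \<epsilon>)) * rate_functional a b \<epsilon> \<mu>)
    (limit_functional (jump_rate a S m \<sigma>) N (\<lambda>k. frac (m k)))"
  unfolding gamma_converges_def
proof (intro ballI)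
  fix \<mu> assume \<mu>: "\<mu> \<in> torus_prob"
  let ?G = "limit_functional (jump_rate a S m \<sigma>) N (\<lambda>k. frac (m k))"
  show "(\<forall>M. (\<forall>\<epsilon>>0. M \<epsilon> \<in> torus_prob) \<and> torus_weak_conv M \<mu> (at_right 0) \<longrightarrow>
             ?G \<mu> \<le> Liminf (at_right 0) (\<lambda>\<epsilon>. ereal (exp (\<h> / \<epsilon>)) * rate_functional a b \<epsilon> (M \<epsilon>))) \<and>
        (\<exists>M. (\<forall>\<epsilon>>0. M \<epsilon> \<in> torus_prob) \<and> torus_weak_conv M \<mu> (at_right 0) \<and>
             Limsup (at_right 0) (\<lambda>\<epsilon>. ereal (exp (\<h> / \<epsilon>)) * rate_functional a b \<epsilon> (M \<epsilon>)) \<le> ?G \<mu>)"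
  proof (cases "\<exists>\<omega>. prob_vector N \<omega> \<and> is_dirac_sum N (\<lambda>k. frac (m k)) \<omega> \<mu>")
    case True
    then obtain \<omega> where \<omega>: "prob_vector N \<omega>" "is_dirac_sum N (\<lambda>k. frac (m k)) \<omega> \<mu>" by blast
    have "?G \<mu> = chain_rate_functional (jump_rate a S m \<sigma>) N \<omega>"
      by (rule limit_functional_dirac_sum[OF \<omega> inj_on_frac_m frac_m_in])
    then show ?thesis
      using Liminf_ge_chain[OF \<mu> _ _ \<omega>] recovery_sequence[OF \<mu> \<omega>] by auto
  next
    case False
    then have "?G \<mu> = \<infinity>" unfolding limit_functional_def by (rule if_not_P)
    moreover have "torus_weak_conv (\<lambda>_. \<mu>) \<mu> (at_right (0::real))" by (simp add: torus_weak_conv_def)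
    ultimately show ?thesis
      using Liminf_infinity_unless_dirac_sum[OF \<mu> _ _ False] \<mu> by (auto intro!: exI[of _ "\<lambda>_. \<mu>"])
  qed
qed

end

theorem proposition2p4:
  fixes a b :: "real \<Rightarrow> real" and c\<^sub>0 :: real and N :: nat and m \<sigma> :: "int \<Rightarrow> real"
  assumes "a \<in> torus_C2" and "b \<in> torus_C2"
    and "c\<^sub>0 > 0" and "\<And>x. a x \<ge> c\<^sub>0"
    and "N \<ge> 1"
    and "finite {x\<in>{0..<1}. b x = 0}" and "card {x\<in>{0..<1}. b x = 0} = 2 * N"
    and "\<And>x. b x = 0 \<Longrightarrow> deriv b x \<noteq> 0"
    and "(LBINT x:{0..<1}. b x / a x) \<ge> 0"
    and "range m = {x. b x = 0 \<and> deriv b x < 0}"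
    and "range \<sigma> = {x. b x = 0 \<and> deriv b x > 0}"
    and "\<And>k. m (k + int N) = m k + 1" and "\<And>k. \<sigma> (k + int N) = \<sigma> k + 1"
    and "m (-1) < 0" and "0 < \<sigma> 0"
    and "\<And>k. \<sigma> k < m k" and "\<And>k. m k < \<sigma> (k + 1)"
    and "m (int N - 1) < 1" and "1 < \<sigma> (int N)"
  defines "S \<equiv> potential a b"
  shows "gamma_converges
    (\<lambda>\<epsilon> \<mu>. ereal (exp (min_barrier S m \<sigma> / \<epsilon>)) * rate_functional a b \<epsilon> \<mu>)
    (limit_functional (jump_rate a S m \<sigma>) N (\<lambda>k. frac (m k)))"
proof -
  interpret landscape a b c\<^sub>0 N m \<sigma>
    by unfold_locales (fact assms)+
  show ?thesis unfolding S_def by (rule gamma_convergence)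
qed

end
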